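(* Let $N=1$, $\alpha\in\left[\frac12,1\right)$, $d>0$ and $a>0$. Let $u$ be the fundamental solution, i.e. the unique solution of $$\partial_t^\alpha u-d\,\partial_x^2 u=au\quad (x\in\mathbb{R},\ t>0),\qquad u(x,0)=\delta .$$ Let also $\beta\in\left(0,\frac12\right)$ and $c>0$. Then $$u(ct^\beta,t)\ge c\,\alpha\, t^{\beta-2\alpha}E_\alpha\left(t^\alpha\right)\left[1-o(1)\right],$$ where $o(1)$ is understood as $t\to+\infty$. In particular, $$u(ct^\beta,t)\to+\infty\qquad\text{as } t\to+\infty .$$
   Context: $E_\alpha(r)=\sum_{k=0}^\infty\frac{r^k}{\Gamma(1+k\alpha)}$ is the Mittag-Leffler function. $\delta$ is the Dirac delta at $0$. $\partial_t^\alpha u(t)=\frac{1}{\Gamma(1-\alpha)}\int_0^t\frac{\dot u(\tau)}{(t-\tau)^\alpha}\,d\tau$ is the Caputo derivative of order $\alpha$ with initial time $0$. Solutions are understood as follows. Fix a natural number $m>1/2$, and let $H^{-m}(\mathbb{R})$ be the dual of the Sobolev space $H^m(\mathbb{R})$. On a time interval $[0,T]$ one requires $u(t)\in H^{-m}(\mathbb{R})$ for all $t\in[0,T]$, $\sup_{t\in[0,T]}t^\alpha\|u(t)\|_{H^{-m}(\mathbb{R})}<+\infty$ and, for all $\varphi\in C_0^\infty(\mathbb{R})$, $$\langle u(t),\varphi\rangle=\varphi(0)+\frac{1}{\Gamma(\alpha)}\int_0^t\frac{d\langle u(\tau),\varphi''\rangle+a\langle u(\tau),\varphi\rangle}{(t-\tau)^{1-\alpha}}\,d\tau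 .$$ Such a solution exists and is unique, and it is given by $u(\cdot,t)=\mathcal{F}^{-1}\big(E_\alpha((a-4\pi^2d|\xi|^2)t^\alpha)\big)$, with the Fourier transform $\mathcal{F}f(\xi)=\int_{\mathbb{R}}f(x)e^{-2\pi i x\xi}\,dx$. For $t>0$ the function $\xi\mapsto E_\alpha((a-4\pi^2d|\xi|^2)t^\alpha)$ belongs to $L^1(\mathbb{R})$, so pointwise values of $u$ are those of $$u(x,t)=\int_{\mathbb{R}}E_\alpha\big((a-4\pi^2d|\xi|^2)t^\alpha\big)\cos(2\pi x\xi)\,d\xi .$$
   Formalization: The printed inequality with E_α(t^α) fails for every 0<a<1, since u grows only like exp(a^{1/α} t); it is proved for a≥1, and for all a>0 with E_α(a t^α) in place of E_α(t^α). The divergence u(ct^β,t)→+∞ is proved for all a>0. *)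

theory Defs
  imports "HOL-Analysis.Analysis" "HOL-Library.Landau_Symbols"
begin

definition mittag_leffler :: "real \<Rightarrow> real \<Rightarrow> real" where
  "mittag_leffler \<alpha> r = (\<Sum>k. r ^ k / Gamma (1 + real k * \<alpha>))"

section \<open>Test functions, Sobolev spaces on the line, and their duals\<close>

definition test_functions :: "(real \<Rightarrow> real) set" where
  "test_functions =
     {\<phi>. (\<forall>k x. (deriv ^^ k) \<phi> differentiable (at x)) \<and> compact (closure {x. \<phi> x \<noteq> 0})}"

definition L2 :: "(real \<Rightarrow> real) set" where
  "L2 = {f \<in> borel_measurable lborel. integrable lborel (\<lambda>x. (f x)\<^sup>2)}"

definition weak_derivative :: "nat \<Rightarrow> (real \<Rightarrow> real) \<Rightarrow> (real \<Rightarrow> real) \<Rightarrow> bool" where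
  "weak_derivative k f g \<longleftrightarrow>
     (\<forall>\<phi>\<in>test_functions.
        (LINT x|lborel. f x * (deriv ^^ k) \<phi> x) = (-1) ^ k * (LINT x|lborel. g x * \<phi> x))"

text \<open>Elements of \<open>sobolev m\<close> are functions rather than classes modulo null sets. A linear
  functional that is bounded by \<open>sobolev_norm m\<close> takes the same value on functions that agree
  almost everywhere, so \<open>sobolev_dual m\<close> is the usual dual space. In \<open>sobolev_norm\<close> the choice of
  the weak derivative is immaterial, since it is unique up to null sets.\<close>

definition sobolev :: "nat \<Rightarrow> (real \<Rightarrow> real) set" where
  "sobolev m = {f \<in> L2. \<forall>k\<le>m. \<exists>g\<in>L2. weak_derivative k f g}"

definition sobolev_norm :: "nat \<Rightarrow> (real \<Rightarrow> real) \<Rightarrow> real" where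
  "sobolev_norm m f =
     sqrt (\<Sum>k\<le>m. LINT x|lborel. ((SOME g. g \<in> L2 \<and> weak_derivative k f g) x)\<^sup>2)"

definition sobolev_dual :: "nat \<Rightarrow> ((real \<Rightarrow> real) \<Rightarrow> real) set" where
  "sobolev_dual m =
     {l. (\<forall>f\<in>sobolev m. \<forall>g\<in>sobolev m. l (\<lambda>x. f x + g x) = l f + l g) \<and>
         (\<forall>f\<in>sobolev m. \<forall>b. l (\<lambda>x. b * f x) = b * l f) \<and>
         (\<exists>C. \<forall>f\<in>sobolev m. \<bar>l f\<bar> \<le> C * sobolev_norm m f)}"

definition sobolev_dual_norm :: "nat \<Rightarrow> ((real \<Rightarrow> real) \<Rightarrow> real) \<Rightarrow> real" where
  "sobolev_dual_norm m l = (SUP f\<in>{f \<in> sobolev m. sobolev_norm m f \<le> 1}. \<bar>l f\<bar>)"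

section \<open>The fundamental solution\<close>

text \<open>\<open>U t \<phi>\<close> is the duality pairing of \<open>U t\<close> with \<open>\<phi>\<close>. Existence of the
  integral is required explicitly because a Bochner integral that does not exist is \<open>0\<close>.\<close>

definition solution_on ::
    "nat \<Rightarrow> real \<Rightarrow> real \<Rightarrow> real \<Rightarrow> real \<Rightarrow> (real \<Rightarrow> (real \<Rightarrow> real) \<Rightarrow> real) \<Rightarrow> bool" where
  "solution_on m \<alpha> d a T U \<longleftrightarrow>
     (\<forall>t\<in>{0..T}. U t \<in> sobolev_dual m) \<and>
     bdd_above ((\<lambda>t. t powr \<alpha> * sobolev_dual_norm m (U t)) ` {0..T}) \<and>
     (\<forall>\<phi>\<in>test_functions. \<forall>t\<in>{0..T}.
        set_integrable lborel {0..t}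
          (\<lambda>\<tau>. (d * U \<tau> ((deriv ^^ 2) \<phi>) + a * U \<tau> \<phi>) / (t - \<tau>) powr (1 - \<alpha>)) \<and>
        U t \<phi> = \<phi> 0 + 1 / Gamma \<alpha> *
          (LINT \<tau>:{0..t}|lborel. (d * U \<tau> ((deriv ^^ 2) \<phi>) + a * U \<tau> \<phi>) / (t - \<tau>) powr (1 - \<alpha>)))"

definition fundamental_solution ::
    "nat \<Rightarrow> real \<Rightarrow> real \<Rightarrow> real \<Rightarrow> (real \<Rightarrow> (real \<Rightarrow> real) \<Rightarrow> real) \<Rightarrow> bool" where
  "fundamental_solution m \<alpha> d a U \<longleftrightarrow> (\<forall>T>0. solution_on m \<alpha> d a T U)"

text \<open>The pointwise values of \<open>U t\<close> for \<open>t > 0\<close> are those of the (unique) continuous function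
  that represents the distribution \<open>U t\<close>. For the fundamental solution this is the function
  given by the absolutely convergent inverse Fourier integral
  \<open>u x t = (LINT \<xi>|lborel. mittag_leffler \<alpha> ((a - 4 * pi\<^sup>2 * d * \<xi>\<^sup>2) * t powr \<alpha>) * cos (2 * pi * x * \<xi>))\<close>.\<close>

definition pointwise_values ::
    "(real \<Rightarrow> (real \<Rightarrow> real) \<Rightarrow> real) \<Rightarrow> (real \<Rightarrow> real \<Rightarrow> real) \<Rightarrow> bool" where
  "pointwise_values U u \<longleftrightarrow>
     (\<forall>t>0. continuous_on UNIV (\<lambda>x. u x t) \<and>
            (\<forall>\<phi>\<in>test_functions. U t \<phi> = (LINT x|lborel. u x t * \<phi> x)))"

end

theory Submission
  imports Defs "HOL-Probability.Sinc_Integral" "HOL-Real_Asymp.Real_Asymp"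
begin

text \<open>
  Write \<open>E\<^sub>\<alpha>\<close> for the Mittag-Leffler function. Up to a positive constant, the fundamental solution is
  \<open>u x t = \<integral>\<^sub>0\<^sup>\<infinity> E\<^sub>\<alpha>((a - d \<eta>\<^sup>2) t\<^sup>\<alpha>) cos (x \<eta>) d\<eta>\<close>. For large \<open>z\<close> the value \<open>E\<^sub>\<alpha>(z)\<close> grows like the exponential of \<open>z powr (1 / \<alpha>)\<close>,
  so as a function of \<open>\<eta>\<close> the integrand is essentially a Gaussian of height \<open>E\<^sub>\<alpha>(a t\<^sup>\<alpha>)\<close> and width \<open>t powr (-1/2)\<close>. At
  \<open>x = c t\<^sup>\<beta>\<close> with \<open>\<beta> < 1/2\<close> the cosine does not oscillate on this width, and the integral is at least a positive constant times
  \<open>t powr (-1/2) E\<^sub>\<alpha>(a t\<^sup>\<alpha>)\<close>. Since \<open>\<beta> - 2 \<alpha> < -1/2\<close>, this exceeds the asserted bound by a positive power of \<open>t\<close>, whatever the constants.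

  The estimates for positive arguments of \<open>E\<^sub>\<alpha>\<close> (\<open>ml_perturb_lower\<close>, \<open>ml_perturb_upper\<close>) come from the power series, whose terms rise
  and fall geometrically away from an index of order \<open>t\<close>. For negative arguments, \<open>0 \<le> E\<^sub>\<alpha>(- s) \<le> 1 / (1 + s / Gamma (1 + \<alpha>))\<close>
  (\<open>ml_neg_bounds\<close>) is derived from an extremum principle for the relaxation equation that \<open>t \<mapsto> E\<^sub>\<alpha>(- t\<^sup>\<alpha>)\<close> solves.

  The representation of \<open>u\<close> (\<open>fejer_mass_times_solution\<close>) has to be extracted from the weak formulation. First, the integral equation
  extends by density from test functions to smooth functions all of whose derivatives decay quadratically (\<open>solution_on_quad_decay\<close>). Next, with \<open>L = d \<partial>\<^sup>2 + a\<close>, iterating it expresses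
  \<open>U t \<psi>\<close> by the series \<open>\<Sum>\<^sub>k (L\<^sup>k \<psi>)(0) t\<^bsup>k\<alpha>\<^esup> / Gamma (1 + k \<alpha>)\<close> (\<open>iterated_fractional_integral\<close>), provided that the Sobolev norms of
  \<open>L\<^sup>k \<psi>\<close> grow at most geometrically. Band-limited functions have this property, and convolution of a test function with Fejer kernels
  produces enough of them to determine \<open>U t\<close> (\<open>solution_conv_band_kernel\<close>, \<open>sobolev_dual_fejer_tendsto\<close>).
\<close>

section \<open>Growth of the Mittag-Leffler function on the positive axis\<close>

lemma Gamma_real_plus1: "x > 0 \<Longrightarrow> Gamma (x + 1) = x * Gamma (x::real)"
  by (rule Gamma_plus1) (auto simp: nonpos_Ints_altdef)

text \<open>Convexity of \<open>ln \<circ> Gamma\<close> between \<open>x\<close> and \<open>x + 1\<close>, where \<open>Gamma (x + 1) = x * Gamma x\<close>.\<close>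

lemma Gamma_add_le:
  fixes x \<alpha> :: real
  assumes x: "x > 0" and \<alpha>: "0 < \<alpha>" "\<alpha> < 1"
  shows "Gamma (x + \<alpha>) \<le> x powr \<alpha> * Gamma x"
proof -
  have G: "Gamma x \<noteq> 0" using Gamma_real_pos[OF x] by linarith
  have "(ln \<circ> Gamma) ((1 - \<alpha>) *\<^sub>R x + \<alpha> *\<^sub>R (x + 1)) \<le> (1 - \<alpha>) * (ln \<circ> Gamma) x + \<alpha> * (ln \<circ> Gamma) (x + 1)"
    using log_convex_Gamma_real by (rule convex_onD) (use assms in auto)
  moreover have "(1 - \<alpha>) *\<^sub>R x + \<alpha> *\<^sub>R (x + 1) = x + \<alpha>" by (simp add: algebra_simps)
  moreover have "Gamma (x + 1) = x * Gamma x" using x by (rule Gamma_real_plus1)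
  moreover have "ln (x * Gamma x) = ln x + ln (Gamma x)"
    using x G by (simp add: ln_mult)
  ultimately have "ln (Gamma (x + \<alpha>)) \<le> \<alpha> * ln x + ln (Gamma x)"
    by (simp add: algebra_simps)
  also have "\<dots> = ln (x powr \<alpha> * Gamma x)"
    using x G by (simp add: ln_mult ln_powr)
  finally show ?thesis
    using x \<alpha> Gamma_real_pos[of x] by (subst (asm) ln_le_cancel_iff) (auto intro!: Gamma_real_pos mult_pos_pos)
qed

text \<open>The upper bound on the remaining step from \<open>x + \<alpha>\<close> to \<open>x + 1\<close>, which has length \<open>1 - \<alpha>\<close>, gives a lower
  bound on the step from \<open>x\<close> to \<open>x + \<alpha>\<close>.\<close>

lemma Gamma_add_ge:
  fixes x \<alpha> :: real
  assumes x: "x \<ge> 1" and \<alpha>: "0 < \<alpha>" "\<alpha> < 1"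
  shows "x powr \<alpha> * Gamma x \<le> 2 * Gamma (x + \<alpha>)"
proof -
  have G: "Gamma x > 0" "Gamma (x + \<alpha>) > 0" using assms by (auto intro!: Gamma_real_pos)
  have "x * Gamma x = Gamma (x + 1)" using x by (simp add: Gamma_real_plus1)
  also have "\<dots> = Gamma (x + \<alpha> + (1 - \<alpha>))" by simp
  also have "\<dots> \<le> (x + \<alpha>) powr (1 - \<alpha>) * Gamma (x + \<alpha>)"
    by (rule Gamma_add_le) (use assms in auto)
  also have "\<dots> \<le> (2 * x) powr (1 - \<alpha>) * Gamma (x + \<alpha>)"
    using assms G by (intro mult_right_mono powr_mono2) auto
  also have "(2 * x) powr (1 - \<alpha>) \<le> 2 * x powr (1 - \<alpha>)"
  proof -
    have "2 powr (1 - \<alpha>) \<le> (2::real) powr 1" using \<alpha> by (intro powr_mono) auto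
    thus ?thesis using x by (auto simp: powr_mult intro!: mult_right_mono)
  qed
  finally have "x * Gamma x \<le> 2 * x powr (1 - \<alpha>) * Gamma (x + \<alpha>)"
    using G by (simp add: mult_right_mono)
  moreover have "x = x powr (1 - \<alpha>) * x powr \<alpha>" using x by (simp flip: powr_add)
  ultimately have "x powr (1 - \<alpha>) * (x powr \<alpha> * Gamma x) \<le> x powr (1 - \<alpha>) * (2 * Gamma (x + \<alpha>))"
    by (simp add: mult_ac)
  thus ?thesis using x by (subst (asm) mult_le_cancel_left_pos) auto
qed

context
  fixes \<alpha> :: real
  assumes \<alpha>: "0 < \<alpha>" "\<alpha> < 1"
begin

lemma ml_Gamma_pos: "Gamma (1 + real k * \<alpha>) > 0"
proof -
  have "1 + real k * \<alpha> > 0" using \<alpha> by (intro add_pos_nonneg mult_nonneg_nonneg) auto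
  thus ?thesis by (rule Gamma_real_pos)
qed

lemma ml_term_nonneg: "z \<ge> 0 \<Longrightarrow> z ^ k / Gamma (1 + real k * \<alpha>) \<ge> 0"
  using ml_Gamma_pos[of k] by simp

lemma ml_Gamma_Suc:
  "Gamma (1 + real (Suc k) * \<alpha>) \<le> (1 + real k * \<alpha>) powr \<alpha> * Gamma (1 + real k * \<alpha>)"
  "(1 + real k * \<alpha>) powr \<alpha> * Gamma (1 + real k * \<alpha>) \<le> 2 * Gamma (1 + real (Suc k) * \<alpha>)"
proof -
  have e: "1 + real (Suc k) * \<alpha> = (1 + real k * \<alpha>) + \<alpha>" by (simp add: algebra_simps)
  have p: "1 + real k * \<alpha> \<ge> 1" using \<alpha> by simp
  show "Gamma (1 + real (Suc k) * \<alpha>) \<le> (1 + real k * \<alpha>) powr \<alpha> * Gamma (1 + real k * \<alpha>)"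
    unfolding e by (rule Gamma_add_le) (use p \<alpha> in \<open>linarith+\<close>)
  show "(1 + real k * \<alpha>) powr \<alpha> * Gamma (1 + real k * \<alpha>) \<le> 2 * Gamma (1 + real (Suc k) * \<alpha>)"
    unfolding e by (rule Gamma_add_ge) (use p \<alpha> in auto)
qed

text \<open>By the two Gamma estimates the ratio of consecutive terms of the series of \<open>E\<^sub>\<alpha>(z)\<close> lies between
  \<open>z / x powr \<alpha>\<close> and twice that number, where \<open>x = 1 + k * \<alpha>\<close>. So the terms rise geometrically up to an
  index of order \<open>z powr (1 / \<alpha>)\<close> and fall geometrically soon after it. All estimates for positive
  arguments rest on this.\<close>

lemma ml_term_halves:
  assumes z: "z \<ge> 0" "4 * z \<le> (1 + real k * \<alpha>) powr \<alpha>"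
  shows "z ^ Suc k / Gamma (1 + real (Suc k) * \<alpha>) \<le> (z ^ k / Gamma (1 + real k * \<alpha>)) / 2"
proof -
  have "4 * z * Gamma (1 + real k * \<alpha>) \<le> (1 + real k * \<alpha>) powr \<alpha> * Gamma (1 + real k * \<alpha>)"
    using z ml_Gamma_pos[of k] by (intro mult_right_mono) auto
  also note ml_Gamma_Suc(2)
  finally have "2 * z * Gamma (1 + real k * \<alpha>) \<le> Gamma (1 + real (Suc k) * \<alpha>)" by simp
  hence "z ^ k * (2 * z * Gamma (1 + real k * \<alpha>)) \<le> z ^ k * Gamma (1 + real (Suc k) * \<alpha>)"
    using z by (intro mult_left_mono) auto
  thus ?thesis using ml_Gamma_pos[of k] ml_Gamma_pos[of "Suc k"]
    by (simp add: field_simps del: of_nat_Suc)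
qed

lemma ml_term_doubles:
  assumes z: "z \<ge> 0" "(1 + real k * \<alpha>) powr \<alpha> \<le> z / 2"
  shows "z ^ k / Gamma (1 + real k * \<alpha>) \<le> (z ^ Suc k / Gamma (1 + real (Suc k) * \<alpha>)) / 2"
proof -
  note ml_Gamma_Suc(1)[of k]
  also have "(1 + real k * \<alpha>) powr \<alpha> * Gamma (1 + real k * \<alpha>) \<le> z / 2 * Gamma (1 + real k * \<alpha>)"
    using z ml_Gamma_pos[of k] by (intro mult_right_mono) auto
  finally have "z ^ k * (2 * Gamma (1 + real (Suc k) * \<alpha>)) \<le> z ^ k * (z * Gamma (1 + real k * \<alpha>))"
    using z by (intro mult_left_mono) auto
  thus ?thesis using ml_Gamma_pos[of k] ml_Gamma_pos[of "Suc k"]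
    by (simp add: field_simps del: of_nat_Suc)
qed

lemma ml_summable: "summable (\<lambda>k. z ^ k / Gamma (1 + real k * \<alpha>))"
proof -
  have "filterlim (\<lambda>k. (1 + real k * \<alpha>) powr \<alpha>) at_top sequentially"
    using \<alpha> by real_asymp
  hence "eventually (\<lambda>k. 4 * \<bar>z\<bar> \<le> (1 + real k * \<alpha>) powr \<alpha>) sequentially"
    by (simp add: filterlim_at_top)
  then obtain N where N: "\<And>k. k \<ge> N \<Longrightarrow> 4 * \<bar>z\<bar> \<le> (1 + real k * \<alpha>) powr \<alpha>"
    by (auto simp: eventually_sequentially)
  show ?thesis
  proof (rule summable_ratio_test[of "1/2" N])
    fix k assume "k \<ge> N"
    from ml_term_halves[OF _ N[OF this]] show
      "norm (z ^ Suc k / Gamma (1 + real (Suc k) * \<alpha>)) \<le> 1 / 2 * norm (z ^ k / Gamma (1 + real k * \<alpha>))"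
      using ml_Gamma_pos[of k] ml_Gamma_pos[of "Suc k"]
      by (simp add: abs_mult power_abs del: of_nat_Suc)
  qed simp
qed

lemma ml_nonneg: "z \<ge> 0 \<Longrightarrow> mittag_leffler \<alpha> z \<ge> 0"
  unfolding mittag_leffler_def by (rule suminf_nonneg[OF ml_summable ml_term_nonneg])

lemma ml_ge_term: "z \<ge> 0 \<Longrightarrow> z ^ k / Gamma (1 + real k * \<alpha>) \<le> mittag_leffler \<alpha> z"
  unfolding mittag_leffler_def
  using sum_le_suminf[OF ml_summable, of "{k}" z] ml_term_nonneg by auto

lemma ml_pos: "z \<ge> 0 \<Longrightarrow> mittag_leffler \<alpha> z > 0"
  using ml_ge_term[of z 0] by simp

lemma ml_mono: "0 \<le> z \<Longrightarrow> z \<le> w \<Longrightarrow> mittag_leffler \<alpha> z \<le> mittag_leffler \<alpha> w"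
  unfolding mittag_leffler_def
  by (intro suminf_le ml_summable divide_right_mono power_mono less_imp_le[OF ml_Gamma_pos]) auto

text \<open>Beyond index \<open>k1\<close> the series is dominated by a geometric one, so half of the value is carried
  by the first terms, and these barely feel a small relative change of the argument.\<close>

lemma ml_perturb_lower:
  assumes z: "z \<ge> 0" and k: "4 * z \<le> (1 + real k1 * \<alpha>) powr \<alpha>"
    and \<epsilon>: "0 \<le> \<epsilon>" "\<epsilon> \<le> 1" "real k1 * \<epsilon> \<le> 1 / 2"
  shows "mittag_leffler \<alpha> z / 4 \<le> mittag_leffler \<alpha> (z * (1 - \<epsilon>))"
proof -
  define t where "t k = z ^ k / Gamma (1 + real k * \<alpha>)" for k
  have t0: "t k \<ge> 0" for k unfolding t_def using z by (rule ml_term_nonneg)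
  have sm: "summable t" unfolding t_def by (rule ml_summable)
  have E: "mittag_leffler \<alpha> z = (\<Sum>k. t k)" by (simp add: mittag_leffler_def t_def)
  have half: "t (Suc k) \<le> t k / 2" if "k \<ge> k1" for k
    unfolding t_def
  proof (rule ml_term_halves[OF z])
    have "(1 + real k1 * \<alpha>) powr \<alpha> \<le> (1 + real k * \<alpha>) powr \<alpha>"
      using that \<alpha> by (intro powr_mono2) (auto intro!: mult_right_mono)
    thus "4 * z \<le> (1 + real k * \<alpha>) powr \<alpha>" using k by simp
  qed
  have geo: "t (i + k1) \<le> t k1 * (1/2) ^ i" for i
  proof (induction i)
    case (Suc i) thus ?case using half[of "i + k1"] by simp
  qed simp
  have "(\<Sum>i. t (i + k1)) \<le> (\<Sum>i. t k1 * (1/2) ^ i)"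
    by (intro suminf_le geo summable_mult summable_geometric) (use sm in auto)
  also have "\<dots> = 2 * t k1" by (subst suminf_mult) (auto simp: suminf_geometric)
  finally have "(\<Sum>k. t k) \<le> 2 * t k1 + (\<Sum>i<k1. t i)"
    using suminf_split_initial_segment[OF sm, of k1] by simp
  also have "\<dots> \<le> 2 * (\<Sum>i\<le>k1. t i)"
    using sum_nonneg[of "{..<k1}" t] t0 by (simp add: lessThan_Suc_atMost[symmetric])
  finally have a: "mittag_leffler \<alpha> z \<le> 2 * (\<Sum>i\<le>k1. t i)" using E by simp
  have "(1/2) * (\<Sum>i\<le>k1. t i) = (\<Sum>i\<le>k1. (1/2) * t i)" by (simp add: sum_distrib_left)
  also have "\<dots> \<le> (\<Sum>i\<le>k1. (1 - \<epsilon>) ^ i * t i)"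
  proof (intro sum_mono mult_right_mono t0)
    fix i assume i: "i \<in> {..k1}"
    have "real i * \<epsilon> \<le> real k1 * \<epsilon>" using i \<epsilon> by (intro mult_right_mono) auto
    moreover have "1 + real i * (- \<epsilon>) \<le> (1 + (- \<epsilon>)) ^ i" by (rule Bernoulli_inequality) (use \<epsilon> in auto)
    ultimately show "1 / 2 \<le> (1 - \<epsilon>) ^ i" using \<epsilon>(3) by simp
  qed
  also have "\<dots> = (\<Sum>i\<le>k1. (z * (1 - \<epsilon>)) ^ i / Gamma (1 + real i * \<alpha>))"
    by (simp add: t_def power_mult_distrib mult_ac)
  also have "\<dots> \<le> mittag_leffler \<alpha> (z * (1 - \<epsilon>))"
    unfolding mittag_leffler_def
    by (rule sum_le_suminf[OF ml_summable]) (use z \<epsilon> ml_term_nonneg in auto)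
  finally show ?thesis using a by simp
qed

text \<open>The terms below index \<open>k0\<close> are negligible because the terms double up to index \<open>2 * k0\<close>; all later
  terms shrink by the factor \<open>(1 - \<epsilon>) ^ k0\<close>.\<close>

lemma ml_perturb_upper:
  assumes z: "z \<ge> 0" and k: "(1 + real (2 * k0) * \<alpha>) powr \<alpha> \<le> z / 2"
    and \<epsilon>: "0 \<le> \<epsilon>" "\<epsilon> \<le> 1 / 2"
  shows "mittag_leffler \<alpha> (z * (1 - \<epsilon>)) \<le> 2 * (1 - \<epsilon>) ^ k0 * mittag_leffler \<alpha> z"
proof -
  define t where "t k = z ^ k / Gamma (1 + real k * \<alpha>)" for k
  have t0: "t k \<ge> 0" for k unfolding t_def using z by (rule ml_term_nonneg)
  have sm: "summable t" unfolding t_def by (rule ml_summable)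
  have E: "mittag_leffler \<alpha> z = (\<Sum>k. t k)" by (simp add: mittag_leffler_def t_def)
  have E': "mittag_leffler \<alpha> (z * (1 - \<epsilon>)) = (\<Sum>k. (1 - \<epsilon>) ^ k * t k)"
    by (simp add: mittag_leffler_def t_def power_mult_distrib mult_ac)
  have sm': "summable (\<lambda>k. (1 - \<epsilon>) ^ k * t k)"
    using ml_summable[of "z * (1 - \<epsilon>)"] by (simp add: t_def power_mult_distrib mult_ac)
  have dbl: "t k \<le> t (Suc k) / 2" if "k \<le> 2 * k0" for k
    unfolding t_def
  proof (rule ml_term_doubles[OF z])
    have "(1 + real k * \<alpha>) powr \<alpha> \<le> (1 + real (2 * k0) * \<alpha>) powr \<alpha>"
      using that \<alpha> by (intro powr_mono2) (auto intro!: mult_right_mono)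
    thus "(1 + real k * \<alpha>) powr \<alpha> \<le> z / 2" using k by simp
  qed
  have head: "t i \<le> (1/2) ^ k0 * t (k0 + i)" if "i < k0" for i
  proof -
    have "t (k0 + i - j) \<le> (1/2) ^ j * t (k0 + i)" if "j \<le> k0" for j
      using that
    proof (induction j)
      case (Suc j)
      have "t (k0 + i - Suc j) \<le> t (Suc (k0 + i - Suc j)) / 2" by (rule dbl) (use \<open>i < k0\<close> in auto)
      also have "Suc (k0 + i - Suc j) = k0 + i - j" using Suc.prems by simp
      finally show ?case using Suc by simp
    qed simp
    from this[of k0] show ?thesis by simp
  qed
  have pw: "(1/2) ^ k0 \<le> (1 - \<epsilon>) ^ k0" using \<epsilon> by (intro power_mono) auto
  have "(\<Sum>i<k0. (1 - \<epsilon>) ^ i * t i) \<le> (\<Sum>i<k0. (1 - \<epsilon>) ^ k0 * t (k0 + i))"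
  proof (intro sum_mono)
    fix i assume "i \<in> {..<k0}"
    have "(1 - \<epsilon>) ^ i * t i \<le> 1 * t i" using \<epsilon> t0 by (intro mult_right_mono power_le_one) auto
    also have "\<dots> \<le> (1/2) ^ k0 * t (k0 + i)" using head \<open>i \<in> {..<k0}\<close> by simp
    also have "\<dots> \<le> (1 - \<epsilon>) ^ k0 * t (k0 + i)" using pw t0 by (rule mult_right_mono)
    finally show "(1 - \<epsilon>) ^ i * t i \<le> (1 - \<epsilon>) ^ k0 * t (k0 + i)" .
  qed
  also have "\<dots> = (1 - \<epsilon>) ^ k0 * (\<Sum>i<k0. t (k0 + i))" by (simp add: sum_distrib_left)
  also have "(\<Sum>i<k0. t (k0 + i)) = (\<Sum>i\<in>{k0..<k0+k0}. t i)"
    using sum.atLeastLessThan_shift_0[of t k0 "k0+k0"] by (simp add: lessThan_atLeast0 add.commute comp_def)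
  also have "\<dots> \<le> mittag_leffler \<alpha> z" unfolding E by (rule sum_le_suminf[OF sm]) (use t0 in auto)
  finally have h: "(\<Sum>i<k0. (1 - \<epsilon>) ^ i * t i) \<le> (1 - \<epsilon>) ^ k0 * mittag_leffler \<alpha> z"
    using \<epsilon> by (simp add: mult_left_mono)
  have "(\<Sum>i. (1 - \<epsilon>) ^ (i + k0) * t (i + k0)) \<le> (\<Sum>i. (1 - \<epsilon>) ^ k0 * t (i + k0))"
  proof (intro suminf_le)
    fix i
    show "(1 - \<epsilon>) ^ (i + k0) * t (i + k0) \<le> (1 - \<epsilon>) ^ k0 * t (i + k0)"
      using \<epsilon> t0 by (intro mult_right_mono power_decreasing) auto
    show "summable (\<lambda>i. (1 - \<epsilon>) ^ (i + k0) * t (i + k0))"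
      using sm' by (rule summable_ignore_initial_segment)
    show "summable (\<lambda>i. (1 - \<epsilon>) ^ k0 * t (i + k0))"
      using sm by (intro summable_mult) (rule summable_ignore_initial_segment)
  qed
  also have "\<dots> = (1 - \<epsilon>) ^ k0 * (\<Sum>i. t (i + k0))"
    by (intro suminf_mult) (use sm in auto)
  also have "\<dots> \<le> (1 - \<epsilon>) ^ k0 * mittag_leffler \<alpha> z"
    unfolding E using \<epsilon> suminf_split_initial_segment[OF sm, of k0] sum_nonneg[of "{..<k0}" t] t0
    by (intro mult_left_mono) auto
  finally show ?thesis
    unfolding E' using suminf_split_initial_segment[OF sm', of k0] h by simp
qed

end

section \<open>Fractional integrals of powers and of series of powers\<close>

lemma has_bochner_integral_Beta:
  fixes p q t :: real
  assumes p: "p > 0" and q: "q > 0" and t: "t > 0"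
  shows "has_bochner_integral lborel
           (\<lambda>\<tau>. indicator {0..t} \<tau> * (\<tau> powr (p - 1) * (t - \<tau>) powr (q - 1))) (t powr (p + q - 1) * Beta p q)"
proof -
  define f where "f \<tau> = indicator {0..1} \<tau> * (\<tau> powr (p - 1) * (1 - \<tau>) powr (q - 1))" for \<tau> :: real
  have "has_bochner_integral lborel f (LINT \<tau>:{0..1}|lborel. \<tau> powr (p - 1) * (1 - \<tau>) powr (q - 1))"
    using integrable_Beta[OF p q]
    unfolding set_integrable_def set_lebesgue_integral_def has_bochner_integral_iff f_def by simp
  also have "(LINT \<tau>:{0..1}|lborel. \<tau> powr (p - 1) * (1 - \<tau>) powr (q - 1)) = Beta p q"
    using set_borel_integral_eq_integral(2)[OF integrable_Beta[OF p q]]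
      integral_unique[OF has_integral_Beta_real[OF p q]] by simp
  finally have "has_bochner_integral lborel (\<lambda>x. t powr (p + q - 2) * f x) (t powr (p + q - 2) * Beta p q)"
    by (rule has_bochner_integral_mult_right)
  also have "(\<lambda>x. t powr (p + q - 2) * f x) =
      (\<lambda>x. indicator {0..t} (0 + t * x) * ((0 + t * x) powr (p - 1) * (t - (0 + t * x)) powr (q - 1)))"
  proof
    fix x :: real
    show "t powr (p + q - 2) * f x =
      indicator {0..t} (0 + t * x) * ((0 + t * x) powr (p - 1) * (t - (0 + t * x)) powr (q - 1))"
    proof (cases "x \<in> {0..1}")
      case True
      have "(t - t * x) powr (q - 1) = (t * (1 - x)) powr (q - 1)" by (simp add: algebra_simps)
      also have "\<dots> = t powr (q - 1) * (1 - x) powr (q - 1)" using t True by (simp add: powr_mult)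
      finally have "(t * x) powr (p - 1) * (t - t * x) powr (q - 1)
          = (t powr (p - 1) * t powr (q - 1)) * (x powr (p - 1) * (1 - x) powr (q - 1))"
        using t True by (simp add: powr_mult mult_ac)
      also have "t powr (p - 1) * t powr (q - 1) = t powr (p + q - 2)"
        by (simp flip: powr_add add: algebra_simps)
      finally show ?thesis using True t by (simp add: f_def mult_le_cancel_left1)
    next
      case False
      thus ?thesis using t by (auto simp: f_def indicator_def zero_le_mult_iff mult_le_cancel_left1)
    qed
  qed
  also have "t powr (p + q - 2) * Beta p q = (t powr (p + q - 1) * Beta p q) /\<^sub>R \<bar>t\<bar>"
    using t powr_mult_base[of t "p + q - 2"] by (simp add: field_simps)
  finally show ?thesis
    using t by (subst lborel_has_bochner_integral_real_affine_iff[where c = t and t = 0]) auto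
qed

text \<open>Convolution with a power can be carried out term by term. At \<open>\<tau> = 0\<close> every power is \<open>0\<close>, also the one
  with exponent \<open>0\<close>; a single point does not affect the integrals.\<close>

lemma has_bochner_integral_Beta_series:
  fixes c p :: "nat \<Rightarrow> real" and q t :: real
  assumes p: "\<And>k. p k > 0" and q: "q > 0" and t: "t > 0"
    and s1: "\<And>\<tau>. \<tau> > 0 \<Longrightarrow> summable (\<lambda>k. \<bar>c k\<bar> * \<tau> powr (p k - 1))"
    and s2: "summable (\<lambda>k. \<bar>c k\<bar> * (t powr (p k + q - 1) * Beta (p k) q))"
  shows "has_bochner_integral lborel
           (\<lambda>\<tau>. indicator {0..t} \<tau> * ((\<Sum>k. c k * \<tau> powr (p k - 1)) * (t - \<tau>) powr (q - 1)))
           (\<Sum>k. c k * (t powr (p k + q - 1) * Beta (p k) q))"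
proof -
  define g where "g k \<tau> = indicator {0..t} \<tau> * (\<tau> powr (p k - 1) * (t - \<tau>) powr (q - 1))" for k \<tau>
  have g: "has_bochner_integral lborel (g k) (t powr (p k + q - 1) * Beta (p k) q)" for k
    unfolding g_def by (rule has_bochner_integral_Beta[OF p q t])
  have g0: "g k \<tau> \<ge> 0" for k \<tau> by (auto simp: g_def)
  define f where "f k \<tau> = c k * g k \<tau>" for k \<tau>
  have f: "has_bochner_integral lborel (f k) (c k * (t powr (p k + q - 1) * Beta (p k) q))" for k
    unfolding f_def by (rule has_bochner_integral_mult_right[OF g])
  have fa: "has_bochner_integral lborel (\<lambda>\<tau>. norm (f k \<tau>)) (\<bar>c k\<bar> * (t powr (p k + q - 1) * Beta (p k) q))" for k
    using has_bochner_integral_mult_right[OF g, of "\<bar>c k\<bar>" k] g0 by (simp add: f_def abs_mult)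
  have sm: "summable (\<lambda>k. norm (f k \<tau>))" for \<tau>
  proof (cases "\<tau> > 0")
    case True
    have "summable (\<lambda>k. (\<bar>c k\<bar> * \<tau> powr (p k - 1)) * (indicator {0..t} \<tau> * (t - \<tau>) powr (q - 1)))"
      by (rule summable_mult2[OF s1[OF True]])
    thus ?thesis by (simp add: f_def g_def abs_mult mult_ac)
  next
    case False
    hence "f k \<tau> = 0" for k by (auto simp: f_def g_def indicator_def)
    thus ?thesis by simp
  qed
  have i: "integrable lborel (f i)" for i using f by (auto simp: has_bochner_integral_iff)
  have s: "summable (\<lambda>k. \<integral>\<tau>. norm (f k \<tau>) \<partial>lborel)"
    using s2 fa by (simp add: has_bochner_integral_iff)
  have "has_bochner_integral lborel (\<lambda>\<tau>. \<Sum>k. f k \<tau>) (\<Sum>k. integral\<^sup>L lborel (f k))"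
    unfolding has_bochner_integral_iff
    using integrable_suminf[OF i _ s] integral_suminf[OF i _ s] sm by simp
  also have "(\<lambda>\<tau>. \<Sum>k. f k \<tau>) = (\<lambda>\<tau>. indicator {0..t} \<tau> * ((\<Sum>k. c k * \<tau> powr (p k - 1)) * (t - \<tau>) powr (q - 1)))"
  proof
    fix \<tau> :: real
    show "(\<Sum>k. f k \<tau>) = indicator {0..t} \<tau> * ((\<Sum>k. c k * \<tau> powr (p k - 1)) * (t - \<tau>) powr (q - 1))"
    proof (cases "\<tau> > 0")
      case True
      have "summable (\<lambda>k. c k * \<tau> powr (p k - 1))"
        by (rule summable_norm_cancel) (use s1[OF True] in \<open>simp add: abs_mult\<close>)
      from suminf_mult2[OF this, of "indicator {0..t} \<tau> * (t - \<tau>) powr (q - 1)"]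
      show ?thesis by (simp add: f_def g_def mult_ac)
    next
      case False
      thus ?thesis by (auto simp: f_def g_def indicator_def)
    qed
  qed
  also have "(\<Sum>k. integral\<^sup>L lborel (f k)) = (\<Sum>k. c k * (t powr (p k + q - 1) * Beta (p k) q))"
    using f by (simp add: has_bochner_integral_iff)
  finally show ?thesis .
qed

text \<open>Integration by parts up to \<open>c < b\<close> produces \<open>W c * K c - W a * K a\<close> and the integral of \<open>- W * K'\<close>, and only the
  first of these can be positive; it vanishes as \<open>c\<close> tends to \<open>b\<close>. Below, \<open>W\<close> is the distance of a function
  to an extremum that it attains at \<open>b\<close>, and \<open>K\<close> is the singular kernel of the Caputo derivative at time \<open>b\<close>.
  The lemma then is the extremum principle: at a point where a function is minimal among all its past
  values, its Caputo derivative is at most \<open>0\<close>.\<close>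

lemma integral_by_parts_sign:
  fixes W W' K K' :: "real \<Rightarrow> real"
  assumes ab: "a < b"
    and W: "continuous_on {a..b} W" "\<And>\<tau>. a < \<tau> \<Longrightarrow> \<tau> < b \<Longrightarrow> (W has_real_derivative W' \<tau>) (at \<tau>)"
      "\<And>\<tau>. a \<le> \<tau> \<Longrightarrow> \<tau> \<le> b \<Longrightarrow> W \<tau> \<ge> 0"
    and K: "\<And>\<tau>. a \<le> \<tau> \<Longrightarrow> \<tau> < b \<Longrightarrow> (K has_real_derivative K' \<tau>) (at \<tau>)"
      "\<And>\<tau>. a \<le> \<tau> \<Longrightarrow> \<tau> < b \<Longrightarrow> K' \<tau> \<ge> 0" "K a \<ge> 0"
    and lim: "((\<lambda>\<tau>. W \<tau> * K \<tau>) \<longlongrightarrow> 0) (at_left b)"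
    and int: "(\<lambda>\<tau>. W' \<tau> * K \<tau>) integrable_on {a..b}"
  shows "integral {a..b} (\<lambda>\<tau>. W' \<tau> * K \<tau>) \<le> 0"
proof -
  have le: "integral {a..c} (\<lambda>\<tau>. W' \<tau> * K \<tau>) \<le> W c * K c" if c: "a < c" "c < b" for c
  proof -
    have 1: "((\<lambda>\<tau>. W' \<tau> * K \<tau> + W \<tau> * K' \<tau>) has_integral (W c * K c - W a * K a)) {a..c}"
    proof (rule fundamental_theorem_of_calculus_interior)
      have "continuous_on {a..c} K"
        by (rule DERIV_continuous_on[where D = K'])
           (use K(1) c in \<open>auto intro: has_field_derivative_at_within\<close>)
      moreover have "continuous_on {a..c} W" using W(1) by (rule continuous_on_subset) (use c in auto)
      ultimately show "continuous_on {a..c} (\<lambda>\<tau>. W \<tau> * K \<tau>)" by (intro continuous_intros)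
      fix x assume "x \<in> {a<..<c}"
      thus "((\<lambda>\<tau>. W \<tau> * K \<tau>) has_vector_derivative W' x * K x + W x * K' x) (at x)"
        using W(2)[of x] K(1)[of x] c
        by (auto intro!: derivative_eq_intros simp flip: has_real_derivative_iff_has_vector_derivative)
    qed (use c in auto)
    have "(\<lambda>\<tau>. W' \<tau> * K \<tau>) integrable_on {a..c}"
      using int by (rule integrable_on_subinterval) (use c in auto)
    hence 2: "((\<lambda>\<tau>. W' \<tau> * K \<tau>) has_integral integral {a..c} (\<lambda>\<tau>. W' \<tau> * K \<tau>)) {a..c}"
      by (rule integrable_integral)
    have "integral {a..c} (\<lambda>\<tau>. W' \<tau> * K \<tau>) \<le> W c * K c - W a * K a"
      by (rule has_integral_le[OF 2 1]) (use W(3) K(2) c in auto)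
    also have "\<dots> \<le> W c * K c" using W(3)[of a] K(3) ab by simp
    finally show ?thesis .
  qed
  have "continuous_on {a..b} (\<lambda>x. integral {a..x} (\<lambda>\<tau>. W' \<tau> * K \<tau>))"
    by (rule indefinite_integral_continuous_1[OF int])
  hence "((\<lambda>x. integral {a..x} (\<lambda>\<tau>. W' \<tau> * K \<tau>)) \<longlongrightarrow> integral {a..b} (\<lambda>\<tau>. W' \<tau> * K \<tau>)) (at b within {a..b})"
    using ab by (auto simp: continuous_on_def)
  hence l: "((\<lambda>x. integral {a..x} (\<lambda>\<tau>. W' \<tau> * K \<tau>)) \<longlongrightarrow> integral {a..b} (\<lambda>\<tau>. W' \<tau> * K \<tau>)) (at_left b)"
    using ab by (simp add: at_within_Icc_at_left)
  show ?thesis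
  proof (rule tendsto_le[OF _ lim l])
    show "eventually (\<lambda>x. integral {a..x} (\<lambda>\<tau>. W' \<tau> * K \<tau>) \<le> W x * K x) (at_left b)"
      using eventually_at_left_real[OF ab] by eventually_elim (use le in auto)
  qed simp
qed

section \<open>Decay of the Mittag-Leffler function on the negative axis\<close>

text \<open>The function \<open>t \<mapsto> E\<^sub>\<alpha>(- t powr \<alpha>)\<close> solves the relaxation equation with Caputo derivative of
  order \<open>\<alpha>\<close> and initial value \<open>1\<close>. Both the differentiated and the integrated form of this equation are
  obtained from the power series; the first yields positivity and monotonicity, the second turns
  monotonicity into decay.\<close>

context
  fixes \<alpha> :: real
  assumes \<alpha>: "0 < \<alpha>" "\<alpha> < 1"
begin

definition ml_decay :: "real \<Rightarrow> real" where
  "ml_decay t = mittag_leffler \<alpha> (- (t powr \<alpha>))"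

definition ml_decay' :: "real \<Rightarrow> real" where
  "ml_decay' t = (\<Sum>k. (-1) ^ Suc k / Gamma (real (Suc k) * \<alpha>) * t powr (real (Suc k) * \<alpha> - 1))"

lemma Gamma_Suc_mult: "Gamma (1 + real (Suc k) * \<alpha>) = real (Suc k) * \<alpha> * Gamma (real (Suc k) * \<alpha>)"
proof -
  have "real (Suc k) * \<alpha> > 0" using \<alpha> by simp
  thus ?thesis
    using Gamma_real_plus1[of "real (Suc k) * \<alpha>"] by (simp only: add.commute)
qed

lemma powr_mult_nat: "t > 0 \<Longrightarrow> (t powr \<alpha>) ^ k = t powr (real k * \<alpha>)" for t :: real
  by (simp add: powr_powr mult.commute flip: powr_realpow)

lemma diffs_ml: "diffs (\<lambda>k. 1 / Gamma (1 + real k * \<alpha>)) k = 1 / (\<alpha> * Gamma (real (Suc k) * \<alpha>))"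
  unfolding diffs_def Gamma_Suc_mult using \<alpha> by (simp del: of_nat_Suc)

lemma ml_deriv_summable: "summable (\<lambda>k. z ^ k / Gamma (real (Suc k) * \<alpha>))"
proof -
  have "summable (\<lambda>k. diffs (\<lambda>k. 1 / Gamma (1 + real k * \<alpha>)) k * z ^ k)"
    by (rule termdiff_converges_all) (use ml_summable[OF \<alpha>] in simp)
  hence "summable (\<lambda>k. \<alpha> * (diffs (\<lambda>k. 1 / Gamma (1 + real k * \<alpha>)) k * z ^ k))" by (rule summable_mult)
  thus ?thesis using \<alpha> unfolding diffs_ml by simp
qed

lemma ml_has_derivative:
  "(mittag_leffler \<alpha> has_real_derivative (\<Sum>k. z ^ k / (\<alpha> * Gamma (real (Suc k) * \<alpha>)))) (at z)"
proof -
  have "((\<lambda>z. \<Sum>k. 1 / Gamma (1 + real k * \<alpha>) * z ^ k) has_real_derivative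
      (\<Sum>k. diffs (\<lambda>k. 1 / Gamma (1 + real k * \<alpha>)) k * z ^ k)) (at z)"
    by (rule termdiffs_strong_converges_everywhere) (use ml_summable[OF \<alpha>] in simp)
  thus ?thesis unfolding diffs_ml by (simp add: mittag_leffler_def[abs_def])
qed

lemma ml_continuous: "continuous_on A (mittag_leffler \<alpha>)"
  by (rule DERIV_continuous_on) (rule has_field_derivative_at_within[OF ml_has_derivative])

lemma ml_decay_has_derivative:
  assumes t: "t > 0"
  shows "(ml_decay has_real_derivative ml_decay' t) (at t)"
proof -
  define S where "S = (\<Sum>k. (- (t powr \<alpha>)) ^ k / (\<alpha> * Gamma (real (Suc k) * \<alpha>)))"
  have "((\<lambda>t. - (t powr \<alpha>)) has_real_derivative - (\<alpha> * t powr (\<alpha> - 1))) (at t)"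
    using t by (auto intro!: derivative_eq_intros)
  from DERIV_chain2[OF ml_has_derivative this]
  have "(ml_decay has_real_derivative S * - (\<alpha> * t powr (\<alpha> - 1))) (at t)"
    unfolding ml_decay_def[abs_def] S_def .
  also have "S * - (\<alpha> * t powr (\<alpha> - 1)) = (\<Sum>k. (- (t powr \<alpha>)) ^ k / (\<alpha> * Gamma (real (Suc k) * \<alpha>)) * - (\<alpha> * t powr (\<alpha> - 1)))"
    unfolding S_def
    by (rule suminf_mult2) (use summable_mult[OF ml_deriv_summable[of "- (t powr \<alpha>)"], of "1/\<alpha>"] in simp)
  also have "\<dots> = ml_decay' t"
    unfolding ml_decay'_def
  proof (intro suminf_cong)
    fix k
    have "t powr (real (Suc k) * \<alpha> - 1) = t powr (real k * \<alpha>) * t powr (\<alpha> - 1)"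
      by (simp flip: powr_add add: algebra_simps)
    moreover have "(- (t powr \<alpha>)) ^ k = (-1) ^ k * t powr (real k * \<alpha>)"
      using powr_mult_nat[OF t, of k] by (simp add: power_minus[of "t powr \<alpha>"])
    ultimately show "(- (t powr \<alpha>)) ^ k / (\<alpha> * Gamma (real (Suc k) * \<alpha>)) * - (\<alpha> * t powr (\<alpha> - 1)) =
       (-1) ^ Suc k / Gamma (real (Suc k) * \<alpha>) * t powr (real (Suc k) * \<alpha> - 1)"
      using \<alpha> by simp
  qed
  finally show ?thesis .
qed

lemma ml_decay_0: "ml_decay 0 = 1"
  unfolding ml_decay_def mittag_leffler_def
  using powser_zero[of "\<lambda>k. 1 / Gamma (1 + real k * \<alpha>)"] by simp

lemma ml_decay_continuous: "continuous_on {0..} ml_decay"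
proof -
  have "continuous_on {0..} (\<lambda>t. - (t powr \<alpha>))"
    using \<alpha> by (intro continuous_on_minus continuous_on_powr' continuous_intros) auto
  thus ?thesis unfolding ml_decay_def[abs_def]
    by (rule continuous_on_compose2[OF ml_continuous]) auto
qed

lemma ml_decay_caputo:
  assumes t: "t > 0"
  shows "has_bochner_integral lborel
           (\<lambda>\<tau>. indicator {0..t} \<tau> * (ml_decay' \<tau> * (t - \<tau>) powr (- \<alpha>))) (- Gamma (1 - \<alpha>) * ml_decay t)"
proof -
  define c where "c k = (-1) ^ Suc k / Gamma (real (Suc k) * \<alpha>)" for k
  define p where "p k = real (Suc k) * \<alpha>" for k
  have p: "p k > 0" for k using \<alpha> by (simp add: p_def)
  have G: "Gamma (real (Suc k) * \<alpha>) > 0" for k using \<alpha> by (intro Gamma_real_pos) simp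
  have B: "c k * (t powr (p k + (1 - \<alpha>) - 1) * Beta (p k) (1 - \<alpha>))
         = - Gamma (1 - \<alpha>) * ((- (t powr \<alpha>)) ^ k / Gamma (1 + real k * \<alpha>))" for k
  proof -
    have e: "p k + (1 - \<alpha>) = 1 + real k * \<alpha>" by (simp add: p_def algebra_simps)
    moreover have "(- (t powr \<alpha>)) ^ k = (-1) ^ k * t powr (real k * \<alpha>)"
      using powr_mult_nat[OF t, of k] by (simp add: power_minus[of "t powr \<alpha>"])
    ultimately show ?thesis using G[of k]
      unfolding Beta_def c_def e p_def[symmetric] by simp
  qed
  have "has_bochner_integral lborel
           (\<lambda>\<tau>. indicator {0..t} \<tau> * ((\<Sum>k. c k * \<tau> powr (p k - 1)) * (t - \<tau>) powr ((1 - \<alpha>) - 1)))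
           (\<Sum>k. c k * (t powr (p k + (1 - \<alpha>) - 1) * Beta (p k) (1 - \<alpha>)))"
  proof (rule has_bochner_integral_Beta_series[OF p _ t])
    fix \<tau> :: real assume \<tau>: "\<tau> > 0"
    have "\<bar>c k\<bar> * \<tau> powr (p k - 1) = \<tau> powr (\<alpha> - 1) * ((\<tau> powr \<alpha>) ^ k / Gamma (real (Suc k) * \<alpha>))" for k
    proof -
      have "\<tau> powr (p k - 1) = \<tau> powr (real k * \<alpha>) * \<tau> powr (\<alpha> - 1)"
        by (simp flip: powr_add add: p_def algebra_simps)
      thus ?thesis using G[of k] unfolding c_def powr_mult_nat[OF \<tau>]
        by (simp add: abs_mult)
    qed
    thus "summable (\<lambda>k. \<bar>c k\<bar> * \<tau> powr (p k - 1))"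
      using summable_mult[OF ml_deriv_summable] by simp
  next
    have "\<bar>c k\<bar> * (t powr (p k + (1 - \<alpha>) - 1) * Beta (p k) (1 - \<alpha>))
        = Gamma (1 - \<alpha>) * ((t powr \<alpha>) ^ k / Gamma (1 + real k * \<alpha>))" for k
    proof -
      have "Beta (p k) (1 - \<alpha>) \<ge> 0" unfolding Beta_def using p[of k] \<alpha>
        by (intro divide_nonneg_nonneg mult_nonneg_nonneg less_imp_le[OF Gamma_real_pos]) auto
      hence "\<bar>c k\<bar> * (t powr (p k + (1 - \<alpha>) - 1) * Beta (p k) (1 - \<alpha>))
        = \<bar>c k * (t powr (p k + (1 - \<alpha>) - 1) * Beta (p k) (1 - \<alpha>))\<bar>" by (simp add: abs_mult)
      thus ?thesis unfolding B using ml_Gamma_pos[OF \<alpha>, of k] Gamma_real_pos[of "1 - \<alpha>"] \<alpha>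
        by (simp add: abs_mult power_abs)
    qed
    thus "summable (\<lambda>k. \<bar>c k\<bar> * (t powr (p k + (1 - \<alpha>) - 1) * Beta (p k) (1 - \<alpha>)))"
      using summable_mult[OF ml_summable[OF \<alpha>]] by simp
  qed (use \<alpha> in auto)
  moreover have "(\<Sum>k. c k * (t powr (p k + (1 - \<alpha>) - 1) * Beta (p k) (1 - \<alpha>))) = - Gamma (1 - \<alpha>) * ml_decay t"
    unfolding B ml_decay_def mittag_leffler_def by (rule suminf_mult[OF ml_summable[OF \<alpha>]])
  ultimately show ?thesis by (simp add: ml_decay'_def c_def p_def)
qed

lemma ml_decay_volterra:
  assumes t: "t > 0"
  shows "has_bochner_integral lborel
           (\<lambda>\<tau>. indicator {0..t} \<tau> * (ml_decay \<tau> * (t - \<tau>) powr (\<alpha> - 1))) (Gamma \<alpha> * (1 - ml_decay t))"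
proof -
  define c where "c k = (-1) ^ k / Gamma (1 + real k * \<alpha>)" for k
  define p where "p k = 1 + real k * \<alpha>" for k
  have p: "p k > 0" for k using \<alpha> unfolding p_def by (intro add_pos_nonneg) auto
  note G = ml_Gamma_pos[OF \<alpha>]
  have cp: "c k * \<tau> powr (p k - 1) = (- (\<tau> powr \<alpha>)) ^ k / Gamma (1 + real k * \<alpha>)" if "\<tau> > 0" for \<tau> k
    using powr_mult_nat[OF that, of k] by (simp add: power_minus[of "\<tau> powr \<alpha>"] c_def p_def)
  have B: "c k * (t powr (p k + \<alpha> - 1) * Beta (p k) \<alpha>)
         = - Gamma \<alpha> * ((- (t powr \<alpha>)) ^ Suc k / Gamma (1 + real (Suc k) * \<alpha>))" for k
  proof -
    have "p k + \<alpha> = 1 + real (Suc k) * \<alpha>" by (simp add: p_def algebra_simps)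
    moreover have "(- (t powr \<alpha>)) ^ Suc k = (-1) ^ Suc k * t powr (real (Suc k) * \<alpha>)"
      using powr_mult_nat[OF t, of "Suc k"] power_minus[of "t powr \<alpha>" "Suc k"] by simp
    ultimately show ?thesis using G[of k]
      unfolding Beta_def c_def by (simp add: p_def[symmetric])
  qed
  have "has_bochner_integral lborel
           (\<lambda>\<tau>. indicator {0..t} \<tau> * ((\<Sum>k. c k * \<tau> powr (p k - 1)) * (t - \<tau>) powr (\<alpha> - 1)))
           (\<Sum>k. c k * (t powr (p k + \<alpha> - 1) * Beta (p k) \<alpha>))"
  proof (rule has_bochner_integral_Beta_series[OF p _ t])
    fix \<tau> :: real assume \<tau>: "\<tau> > 0"
    have "\<bar>c k\<bar> * \<tau> powr (p k - 1) = (\<tau> powr \<alpha>) ^ k / Gamma (1 + real k * \<alpha>)" for k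
      using powr_mult_nat[OF \<tau>, of k] G[of k] by (simp add: c_def p_def abs_mult)
    thus "summable (\<lambda>k. \<bar>c k\<bar> * \<tau> powr (p k - 1))"
      using ml_summable[OF \<alpha>] by simp
  next
    have "\<bar>c k\<bar> * (t powr (p k + \<alpha> - 1) * Beta (p k) \<alpha>)
        = Gamma \<alpha> * ((t powr \<alpha>) ^ Suc k / Gamma (1 + real (Suc k) * \<alpha>))" for k
    proof -
      have "Beta (p k) \<alpha> \<ge> 0" unfolding Beta_def using p[of k] \<alpha>
        by (intro divide_nonneg_nonneg mult_nonneg_nonneg less_imp_le[OF Gamma_real_pos]) auto
      hence "\<bar>c k\<bar> * (t powr (p k + \<alpha> - 1) * Beta (p k) \<alpha>)
        = \<bar>c k * (t powr (p k + \<alpha> - 1) * Beta (p k) \<alpha>)\<bar>" by (simp add: abs_mult)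
      thus ?thesis unfolding B using G[of "Suc k"] Gamma_real_pos[of \<alpha>] \<alpha>
        by (simp add: abs_mult power_abs del: of_nat_Suc)
    qed
    moreover have "summable (\<lambda>k. (t powr \<alpha>) ^ Suc k / Gamma (1 + real (Suc k) * \<alpha>))"
      using ml_summable[OF \<alpha>, of "t powr \<alpha>"] by (subst summable_Suc_iff)
    ultimately show "summable (\<lambda>k. \<bar>c k\<bar> * (t powr (p k + \<alpha> - 1) * Beta (p k) \<alpha>))"
      by (simp only: summable_mult)
  qed (use \<alpha> in auto)
  also have "(\<Sum>k. c k * (t powr (p k + \<alpha> - 1) * Beta (p k) \<alpha>)) = Gamma \<alpha> * (1 - ml_decay t)"
  proof -
    have sm: "summable (\<lambda>k. (- (t powr \<alpha>)) ^ k / Gamma (1 + real k * \<alpha>))" by (rule ml_summable[OF \<alpha>])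
    hence "summable (\<lambda>k. (- (t powr \<alpha>)) ^ Suc k / Gamma (1 + real (Suc k) * \<alpha>))"
      by (subst summable_Suc_iff)
    hence "(\<Sum>k. c k * (t powr (p k + \<alpha> - 1) * Beta (p k) \<alpha>)) =
        - Gamma \<alpha> * (\<Sum>k. (- (t powr \<alpha>)) ^ Suc k / Gamma (1 + real (Suc k) * \<alpha>))"
      unfolding B by (rule suminf_mult)
    also have "(\<Sum>k. (- (t powr \<alpha>)) ^ Suc k / Gamma (1 + real (Suc k) * \<alpha>)) = ml_decay t - 1"
      using suminf_split_head[OF sm] by (simp add: ml_decay_def mittag_leffler_def)
    finally show ?thesis by (simp add: algebra_simps)
  qed
  finally have *: "has_bochner_integral lborel
           (\<lambda>\<tau>. indicator {0..t} \<tau> * ((\<Sum>k. c k * \<tau> powr (p k - 1)) * (t - \<tau>) powr (\<alpha> - 1)))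
           (Gamma \<alpha> * (1 - ml_decay t))" .
  have eq: "indicator {0..t} \<tau> * ((\<Sum>k. c k * \<tau> powr (p k - 1)) * (t - \<tau>) powr (\<alpha> - 1))
     = indicator {0..t} \<tau> * (ml_decay \<tau> * (t - \<tau>) powr (\<alpha> - 1))" if "\<tau> \<noteq> 0" for \<tau>
    using that cp[of \<tau>] by (auto simp: indicator_def ml_decay_def mittag_leffler_def)
  have cont: "continuous_on {0<..<t} ml_decay"
    using ml_decay_continuous by (rule continuous_on_subset) auto
  have "(\<lambda>\<tau>. indicator {0<..<t} \<tau> *\<^sub>R ml_decay \<tau>) \<in> borel_measurable borel"
    by (rule borel_measurable_continuous_on_indicator[OF _ cont]) simp
  hence "(\<lambda>\<tau>. (indicator {0<..<t} \<tau> *\<^sub>R ml_decay \<tau> + indicator {0} \<tau>) * (t - \<tau>) powr (\<alpha> - 1)) \<in> borel_measurable borel"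
    by measurable
  also have "(\<lambda>\<tau>. (indicator {0<..<t} \<tau> *\<^sub>R ml_decay \<tau> + indicator {0} \<tau>) * (t - \<tau>) powr (\<alpha> - 1)) =
    (\<lambda>\<tau>. indicator {0..t} \<tau> * (ml_decay \<tau> * (t - \<tau>) powr (\<alpha> - 1)))"
    using ml_decay_0 t by (auto simp: fun_eq_iff indicator_def)
  finally have m: "(\<lambda>\<tau>. indicator {0..t} \<tau> * (ml_decay \<tau> * (t - \<tau>) powr (\<alpha> - 1))) \<in> borel_measurable lborel"
    by simp
  have ae: "AE \<tau> in lborel. indicator {0..t} \<tau> * ((\<Sum>k. c k * \<tau> powr (p k - 1)) * (t - \<tau>) powr (\<alpha> - 1))
     = indicator {0..t} \<tau> * (ml_decay \<tau> * (t - \<tau>) powr (\<alpha> - 1))"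
    using AE_lborel_singleton[of 0] by eventually_elim (use eq in auto)
  have "(\<lambda>\<tau>. indicator {0..t} \<tau> * ((\<Sum>k. c k * \<tau> powr (p k - 1)) * (t - \<tau>) powr (\<alpha> - 1))) \<in> borel_measurable lborel"
    using * by (simp add: has_bochner_integral_iff borel_measurable_integrable)
  from has_bochner_integral_cong_AE[OF this m ae] * show ?thesis by blast
qed

end

context
  fixes \<alpha> :: real
  assumes \<alpha>: "0 < \<alpha>" "\<alpha> < 1"
begin

abbreviation "Y \<equiv> ml_decay \<alpha>"
abbreviation "Y' \<equiv> ml_decay' \<alpha>"

lemma ml_decay_diff_powr_tendsto_0:
  assumes b: "b > 0"
  shows "((\<lambda>\<tau>. (Y \<tau> - Y b) * (b - \<tau>) powr (-\<alpha>)) \<longlongrightarrow> 0) (at_left b)"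
proof -
  have "((\<lambda>\<tau>. (Y \<tau> - Y b) / (\<tau> - b)) \<longlongrightarrow> Y' b) (at b)"
    using ml_decay_has_derivative[OF \<alpha> b] by (simp add: has_field_derivative_iff)
  hence 1: "((\<lambda>\<tau>. (Y \<tau> - Y b) / (\<tau> - b)) \<longlongrightarrow> Y' b) (at_left b)"
    by (rule filterlim_mono) (auto simp: at_le)
  have 2: "((\<lambda>\<tau>. (b - \<tau>) powr (1 - \<alpha>)) \<longlongrightarrow> 0) (at_left b)"
    using \<alpha> by real_asymp
  have "((\<lambda>\<tau>. - (((Y \<tau> - Y b) / (\<tau> - b)) * (b - \<tau>) powr (1 - \<alpha>))) \<longlongrightarrow> - (Y' b * 0)) (at_left b)"
    by (intro tendsto_intros 1 2)
  moreover have "eventually (\<lambda>\<tau>. - (((Y \<tau> - Y b) / (\<tau> - b)) * (b - \<tau>) powr (1 - \<alpha>))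
       = (Y \<tau> - Y b) * (b - \<tau>) powr (-\<alpha>)) (at_left b)"
    using eventually_at_left_real[of "b - 1" b, simplified]
  proof eventually_elim
    case (elim \<tau>)
    define x where "x = b - \<tau>"
    have x: "x > 0" "\<tau> - b = - x" "b - \<tau> = x" using elim by (auto simp: x_def)
    have "x powr (1 - \<alpha>) = x * x powr (- \<alpha>)"
      using x powr_mult_base[of x "- \<alpha>"] by simp
    thus ?case using x(1) unfolding x(2,3) by simp
  qed
  ultimately show ?thesis by (simp add: tendsto_cong)
qed

lemma ml_decay_caputo_HK:
  assumes t: "t > 0"
  shows "((\<lambda>\<tau>. Y' \<tau> * (t - \<tau>) powr (- \<alpha>)) has_integral (- Gamma (1 - \<alpha>) * Y t)) {0..t}"
proof -
  note h = ml_decay_caputo[OF \<alpha> t]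
  have s: "set_integrable lborel {0..t} (\<lambda>\<tau>. Y' \<tau> * (t - \<tau>) powr (- \<alpha>))"
    using h by (simp add: set_integrable_def has_bochner_integral_iff)
  have "(LINT \<tau>:{0..t}|lborel. Y' \<tau> * (t - \<tau>) powr (- \<alpha>)) = - Gamma (1 - \<alpha>) * Y t"
    using h by (simp add: set_lebesgue_integral_def has_bochner_integral_iff)
  thus ?thesis using set_borel_integral_eq_integral[OF s] integrable_integral by metis
qed

lemma ml_decay_caputo_integral:
  assumes t: "t > 0"
  shows "(\<lambda>\<tau>. Y' \<tau> * (t - \<tau>) powr (- \<alpha>)) integrable_on {0..t}"
    and "integral {0..t} (\<lambda>\<tau>. Y' \<tau> * (t - \<tau>) powr (- \<alpha>)) = - Gamma (1 - \<alpha>) * Y t"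
  using ml_decay_caputo_HK[OF t] by (auto simp: has_integral_integrable_integral)

lemma ml_decay_continuous_Icc: "0 \<le> a \<Longrightarrow> continuous_on {a..b} Y"
  using ml_decay_continuous[OF \<alpha>] by (rule continuous_on_subset) auto

lemma kernel_deriv: "\<tau> < b \<Longrightarrow>
   ((\<lambda>\<tau>. (b - \<tau>) powr (-\<alpha>)) has_real_derivative (\<alpha> * (b - \<tau>) powr (-\<alpha> - 1))) (at \<tau>)"
  by (auto intro!: derivative_eq_intros)

lemma Gamma_1_minus_pos: "Gamma (1 - \<alpha>) > 0"
  using \<alpha> by (intro Gamma_real_pos) auto

text \<open>At a negative minimum over \<open>[0, t]\<close> the relaxation equation would make the Caputo derivative positive,
  against the extremum principle.\<close>

lemma ml_decay_nonneg:
  assumes t: "t \<ge> 0"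
  shows "Y t \<ge> 0"
proof (rule ccontr)
  assume neg: "\<not> Y t \<ge> 0"
  have "\<exists>s\<in>{0..t}. \<forall>x\<in>{0..t}. Y s \<le> Y x"
    by (rule continuous_attains_inf) (use t ml_decay_continuous_Icc in auto)
  then obtain s where s: "0 \<le> s" "s \<le> t" "\<And>x. 0 \<le> x \<Longrightarrow> x \<le> t \<Longrightarrow> Y s \<le> Y x" by auto
  have Ys: "Y s < 0" using s(3)[of t] t neg by simp
  hence "s > 0" using s(1) ml_decay_0[OF \<alpha>] by (cases "s = 0") auto
  have "integral {0..s} (\<lambda>\<tau>. Y' \<tau> * (s - \<tau>) powr (- \<alpha>)) \<le> 0"
  proof (rule integral_by_parts_sign[OF \<open>s > 0\<close>, where W = "\<lambda>\<tau>. Y \<tau> - Y s"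
        and K' = "\<lambda>\<tau>. \<alpha> * (s - \<tau>) powr (-\<alpha> - 1)"])
    show "continuous_on {0..s} (\<lambda>\<tau>. Y \<tau> - Y s)"
      by (intro continuous_intros ml_decay_continuous_Icc) simp
    show "((\<lambda>\<tau>. Y \<tau> - Y s) has_real_derivative Y' \<tau>) (at \<tau>)" if "0 < \<tau>" for \<tau>
      using ml_decay_has_derivative[OF \<alpha> that] by (auto intro!: derivative_eq_intros)
    show "0 \<le> Y \<tau> - Y s" if "0 \<le> \<tau>" "\<tau> \<le> s" for \<tau> using s(2) s(3)[of \<tau>] that by simp
  qed (use kernel_deriv \<alpha> ml_decay_diff_powr_tendsto_0[OF \<open>s > 0\<close>] ml_decay_caputo_integral[OF \<open>s > 0\<close>] in auto)
  hence "Gamma (1 - \<alpha>) * Y s \<ge> 0" by (simp add: ml_decay_caputo_integral[OF \<open>s > 0\<close>])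
  thus False using Gamma_1_minus_pos Ys by (simp add: zero_le_mult_iff)
qed

text \<open>Suppose that the function increases somewhere. Let \<open>s\<close> be a minimum over the whole past, and \<open>r > s\<close> a
  maximum over the times after \<open>s\<close>. The past before \<open>s\<close> acts on the Caputo derivative at \<open>r\<close> with a smaller
  kernel than at \<open>s\<close>, where its contribution is nonpositive, and the times between \<open>s\<close> and \<open>r\<close> contribute
  positively. Hence the derivative is at least as large at \<open>r\<close> as at \<open>s\<close>, and by the equation the value
  at \<open>r\<close> is at most the value at \<open>s\<close>: a contradiction.\<close>

lemma ml_decay_antimono:
  assumes "0 \<le> x" "x \<le> y"
  shows "Y y \<le> Y x"
proof (rule ccontr)
  assume "\<not> Y y \<le> Y x"
  hence xy: "Y x < Y y" by simp
  have "\<exists>s\<in>{0..y}. \<forall>x\<in>{0..y}. Y s \<le> Y x"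
    by (rule continuous_attains_inf) (use assms ml_decay_continuous_Icc in auto)
  then obtain s where s: "0 \<le> s" "s \<le> y" "\<And>x. 0 \<le> x \<Longrightarrow> x \<le> y \<Longrightarrow> Y s \<le> Y x" by auto
  have "\<exists>r\<in>{s..y}. \<forall>x\<in>{s..y}. Y x \<le> Y r"
    by (rule continuous_attains_sup) (use s ml_decay_continuous_Icc in auto)
  then obtain r where r: "s \<le> r" "r \<le> y" "\<And>x. s \<le> x \<Longrightarrow> x \<le> y \<Longrightarrow> Y x \<le> Y r" by auto
  have "Y s \<le> Y x" "Y y \<le> Y r" using assms s(2) s(3)[of x] r(3)[of y] by auto
  hence less: "Y s < Y r" using xy by linarith
  hence sr: "s < r" using r(1) by (cases "s = r") auto
  hence "r > 0" using s by simp
  define f where "f b \<tau> = Y' \<tau> * (b - \<tau>) powr (- \<alpha>)" for b \<tau>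
  have fr: "f r integrable_on {0..r}" "integral {0..r} (f r) = - Gamma (1 - \<alpha>) * Y r"
    unfolding f_def by (rule ml_decay_caputo_integral[OF \<open>r > 0\<close>])+
  have fr1: "f r integrable_on {0..s}" "f r integrable_on {s..r}"
    using sr s by (auto intro: integrable_on_subinterval[OF fr(1)])
  have split: "integral {0..s} (f r) + integral {s..r} (f r) = integral {0..r} (f r)"
    by (rule Henstock_Kurzweil_Integration.integral_combine) (use s sr fr in auto)
  have late: "integral {s..r} (f r) \<ge> 0"
  proof -
    have "integral {s..r} (\<lambda>\<tau>. (- Y' \<tau>) * (r - \<tau>) powr (- \<alpha>)) \<le> 0"
    proof (rule integral_by_parts_sign[OF sr, where W = "\<lambda>\<tau>. Y r - Y \<tau>"
        and K' = "\<lambda>\<tau>. \<alpha> * (r - \<tau>) powr (-\<alpha> - 1)"])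
      show "continuous_on {s..r} (\<lambda>\<tau>. Y r - Y \<tau>)"
        by (intro continuous_intros ml_decay_continuous_Icc s)
      show "((\<lambda>\<tau>. Y r - Y \<tau>) has_real_derivative - Y' \<tau>) (at \<tau>)" if "s < \<tau>" for \<tau>
        using ml_decay_has_derivative[OF \<alpha>, of \<tau>] that s by (auto intro!: derivative_eq_intros)
      show "0 \<le> Y r - Y \<tau>" if "s \<le> \<tau>" "\<tau> \<le> r" for \<tau> using r(2) r(3)[of \<tau>] that by simp
      show "((\<lambda>\<tau>. (Y r - Y \<tau>) * (r - \<tau>) powr - \<alpha>) \<longlongrightarrow> 0) (at_left r)"
        using tendsto_minus[OF ml_decay_diff_powr_tendsto_0[OF \<open>r > 0\<close>]] by (simp add: algebra_simps)
      show "(\<lambda>\<tau>. (- Y' \<tau>) * (r - \<tau>) powr (- \<alpha>)) integrable_on {s..r}"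
        using integrable_neg[OF fr1(2)] by (simp add: f_def)
    qed (use kernel_deriv \<alpha> in auto)
    thus ?thesis by (simp add: f_def[abs_def])
  qed
  have early: "integral {0..s} (f r) \<ge> - Gamma (1 - \<alpha>) * Y s" if "s > 0"
  proof -
    have fs: "f s integrable_on {0..s}" "integral {0..s} (f s) = - Gamma (1 - \<alpha>) * Y s"
      unfolding f_def by (rule ml_decay_caputo_integral[OF that])+
    have int: "(\<lambda>\<tau>. Y' \<tau> * ((s - \<tau>) powr (- \<alpha>) - (r - \<tau>) powr (- \<alpha>))) integrable_on {0..s}"
      using integrable_diff[OF fs(1) fr1(1)] by (simp add: f_def algebra_simps)
    \<comment> \<open>the difference of the two kernels is again nonnegative and increasing\<close>
    have "integral {0..s} (\<lambda>\<tau>. Y' \<tau> * ((s - \<tau>) powr (- \<alpha>) - (r - \<tau>) powr (- \<alpha>))) \<le> 0"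
    proof (rule integral_by_parts_sign[OF that, where W = "\<lambda>\<tau>. Y \<tau> - Y s"])
      show "continuous_on {0..s} (\<lambda>\<tau>. Y \<tau> - Y s)"
        by (intro continuous_intros ml_decay_continuous_Icc) simp
      show "((\<lambda>\<tau>. Y \<tau> - Y s) has_real_derivative Y' \<tau>) (at \<tau>)" if "0 < \<tau>" for \<tau>
        using ml_decay_has_derivative[OF \<alpha> that] by (auto intro!: derivative_eq_intros)
      show "0 \<le> Y \<tau> - Y s" if "0 \<le> \<tau>" "\<tau> \<le> s" for \<tau> using s(2) s(3)[of \<tau>] that by simp
      show "((\<lambda>\<tau>. (s - \<tau>) powr (- \<alpha>) - (r - \<tau>) powr (- \<alpha>)) has_real_derivative
         \<alpha> * (s - \<tau>) powr (-\<alpha> - 1) - \<alpha> * (r - \<tau>) powr (-\<alpha> - 1)) (at \<tau>)" if "\<tau> < s" for \<tau>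
        using that sr by (intro DERIV_diff kernel_deriv) auto
      show "0 \<le> \<alpha> * (s - \<tau>) powr (-\<alpha> - 1) - \<alpha> * (r - \<tau>) powr (-\<alpha> - 1)" if "\<tau> < s" for \<tau>
        using that sr \<alpha> powr_mono2'[of "-\<alpha> - 1" "s - \<tau>" "r - \<tau>"] by (simp add: mult_left_mono)
      show "0 \<le> (s - 0) powr (- \<alpha>) - (r - 0) powr (- \<alpha>)"
        using that sr \<alpha> powr_mono2'[of "-\<alpha>" "s" "r"] by simp
      have "((\<lambda>\<tau>. (Y \<tau> - Y s) * (s - \<tau>) powr (-\<alpha>) - (Y \<tau> - Y s) * (r - \<tau>) powr (-\<alpha>)) \<longlongrightarrow>
              0 - (Y s - Y s) * (r - s) powr (-\<alpha>)) (at_left s)"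
      proof (intro tendsto_diff tendsto_mult ml_decay_diff_powr_tendsto_0 tendsto_powr tendsto_const tendsto_ident_at)
        have "isCont Y s" using ml_decay_has_derivative[OF \<alpha> that] by (rule DERIV_isCont)
        thus "(Y \<longlongrightarrow> Y s) (at_left s)" by (simp add: isCont_def filterlim_at_split)
      qed (use that sr in auto)
      thus "((\<lambda>\<tau>. (Y \<tau> - Y s) * ((s - \<tau>) powr (- \<alpha>) - (r - \<tau>) powr (- \<alpha>))) \<longlongrightarrow> 0) (at_left s)"
        by (simp add: algebra_simps)
    qed (rule int)
    also have "integral {0..s} (\<lambda>\<tau>. Y' \<tau> * ((s - \<tau>) powr (- \<alpha>) - (r - \<tau>) powr (- \<alpha>)))
        = integral {0..s} (f s) - integral {0..s} (f r)"
      using Henstock_Kurzweil_Integration.integral_diff[OF fs(1) fr1(1)] by (simp add: f_def algebra_simps)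
    finally show ?thesis using fs by simp
  qed
  show False
  proof (cases "s > 0")
    case True
    have "- Gamma (1 - \<alpha>) * Y s \<le> - Gamma (1 - \<alpha>) * Y r"
      using early[OF True] late split fr(2) by linarith
    thus False using less Gamma_1_minus_pos by simp
  next
    case False
    hence "s = 0" using s by simp
    hence "Gamma (1 - \<alpha>) * Y r \<le> 0" using late split fr(2) by simp
    moreover have "Y r > 1" using less \<open>s = 0\<close> ml_decay_0[OF \<alpha>] by simp
    ultimately show False using Gamma_1_minus_pos by (simp add: mult_le_0_iff)
  qed
qed

text \<open>In the integrated equation the values before \<open>t\<close> are at least the value at \<open>t\<close>.\<close>

lemma ml_decay_upper:
  assumes t: "t \<ge> 0"
  shows "Y t * (1 + t powr \<alpha> / Gamma (1 + \<alpha>)) \<le> 1"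
proof (cases "t = 0")
  case True
  thus ?thesis using ml_decay_0[OF \<alpha>] by simp
next
  case False
  hence t: "t > 0" using t by simp
  have B: "has_bochner_integral lborel (\<lambda>\<tau>. indicator {0..t} \<tau> * (\<tau> powr (1 - 1) * (t - \<tau>) powr (\<alpha> - 1)))
    (t powr (1 + \<alpha> - 1) * Beta 1 \<alpha>)" by (rule has_bochner_integral_Beta) (use \<alpha> t in auto)
  have "Gamma \<alpha> \<noteq> 0" using Gamma_real_pos[of \<alpha>] \<alpha> by linarith
  hence Be: "Beta 1 \<alpha> = 1 / \<alpha>" using \<alpha> Gamma_real_plus1[of \<alpha>]
    by (simp add: Beta_def add.commute)
  have V: "has_bochner_integral lborel (\<lambda>\<tau>. indicator {0..t} \<tau> * (Y \<tau> * (t - \<tau>) powr (\<alpha> - 1)))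
    (Gamma \<alpha> * (1 - Y t))" by (rule ml_decay_volterra[OF \<alpha> t])
  have "Y t * (t powr \<alpha> / \<alpha>) \<le> Gamma \<alpha> * (1 - Y t)"
  proof -
    have L: "has_bochner_integral lborel (\<lambda>\<tau>. Y t * (indicator {0..t} \<tau> * (\<tau> powr (1 - 1) * (t - \<tau>) powr (\<alpha> - 1))))
      (Y t * (t powr \<alpha> / \<alpha>))"
      using has_bochner_integral_mult_right[OF B, of "Y t"] Be by simp
    have le: "AE \<tau> in lborel. Y t * (indicator {0..t} \<tau> * (\<tau> powr (1 - 1) * (t - \<tau>) powr (\<alpha> - 1)))
       \<le> indicator {0..t} \<tau> * (Y \<tau> * (t - \<tau>) powr (\<alpha> - 1))"
    proof (rule AE_I2)
      fix \<tau> :: real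
      show "Y t * (indicator {0..t} \<tau> * (\<tau> powr (1 - 1) * (t - \<tau>) powr (\<alpha> - 1)))
       \<le> indicator {0..t} \<tau> * (Y \<tau> * (t - \<tau>) powr (\<alpha> - 1))"
        using ml_decay_antimono[of \<tau> t] ml_decay_nonneg[of \<tau>] by (auto simp: indicator_def intro!: mult_right_mono)
    qed
    show ?thesis using integral_mono_AE[OF _ _ le] L V by (simp add: has_bochner_integral_iff)
  qed
  hence le: "Y t * t powr \<alpha> \<le> (\<alpha> * Gamma \<alpha>) * (1 - Y t)"
    using \<alpha> by (simp add: field_simps)
  have g: "Gamma (1 + \<alpha>) = \<alpha> * Gamma \<alpha>" using Gamma_real_plus1[of \<alpha>] \<alpha> by (simp add: add.commute)
  have pos: "\<alpha> * Gamma \<alpha> > 0" using Gamma_real_pos[of \<alpha>] \<alpha> by simp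
  have "Y t * (1 + t powr \<alpha> / (\<alpha> * Gamma \<alpha>)) = Y t + Y t * t powr \<alpha> / (\<alpha> * Gamma \<alpha>)"
    by (simp add: algebra_simps)
  also have "Y t * t powr \<alpha> / (\<alpha> * Gamma \<alpha>) \<le> 1 - Y t"
    using le pos by (simp only: pos_divide_le_eq mult.commute)
  finally show ?thesis unfolding g by simp
qed

lemma ml_neg_bounds:
  assumes s: "s \<ge> 0"
  shows "0 \<le> mittag_leffler \<alpha> (- s)" "mittag_leffler \<alpha> (- s) \<le> 1 / (1 + s / Gamma (1 + \<alpha>))"
proof -
  have e: "mittag_leffler \<alpha> (- s) = Y (s powr (1 / \<alpha>))"
    using s \<alpha> by (simp add: ml_decay_def powr_powr)
  show "0 \<le> mittag_leffler \<alpha> (- s)" unfolding e by (rule ml_decay_nonneg) simp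
  have "Gamma (1 + \<alpha>) > 0" using \<alpha> by (intro Gamma_real_pos) auto
  hence "1 + s / Gamma (1 + \<alpha>) > 0" using s by (intro add_pos_nonneg) auto
  moreover have "Y (s powr (1 / \<alpha>)) * (1 + s / Gamma (1 + \<alpha>)) \<le> 1"
    using ml_decay_upper[of "s powr (1 / \<alpha>)"] s \<alpha> by (simp add: powr_powr)
  ultimately show "mittag_leffler \<alpha> (- s) \<le> 1 / (1 + s / Gamma (1 + \<alpha>))"
    unfolding e by (simp add: field_simps)
qed

end

section \<open>Smooth functions\<close>

definition smooth :: "(real \<Rightarrow> real) \<Rightarrow> bool" where
  "smooth f \<longleftrightarrow> (\<forall>k x. (deriv ^^ k) f differentiable (at x))"

lemma smooth_has_derivative:
  "smooth f \<Longrightarrow> ((deriv ^^ k) f has_real_derivative (deriv ^^ Suc k) f x) (at x)"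
  by (simp add: smooth_def DERIV_deriv_iff_real_differentiable)

lemma smooth_continuous: "smooth f \<Longrightarrow> continuous_on A ((deriv ^^ k) f)"
  by (rule DERIV_continuous_on) (rule has_field_derivative_at_within[OF smooth_has_derivative])

lemma smooth_measurable: "smooth f \<Longrightarrow> (deriv ^^ k) f \<in> borel_measurable borel"
  by (rule borel_measurable_continuous_onI) (rule smooth_continuous)

lemma funpow_deriv_deriv: "(deriv ^^ k) (deriv f) = (deriv ^^ Suc k) f"
  by (simp add: funpow_swap1)

lemma funpow_deriv_add: "(deriv ^^ i) ((deriv ^^ j) f) = (deriv ^^ (i + j)) f"
  by (simp add: funpow_add)

lemma smooth_deriv: "smooth f \<Longrightarrow> smooth ((deriv ^^ j) f)"
  unfolding smooth_def by (simp add: funpow_deriv_add)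

text \<open>A sequence of functions each of which is the derivative of its predecessor is the sequence of
  iterated derivatives of its first member. All derivatives below are identified in this way.\<close>

lemma derivative_sequence:
  assumes F: "\<And>k x. (F k has_real_derivative F (Suc k) x) (at x)"
  shows "(deriv ^^ k) (F 0) = F k" and "smooth (F 0)"
proof -
  have d: "(deriv ^^ k) (F 0) = F k" for k
  proof (induction k)
    case (Suc k)
    have "deriv (F k) = F (Suc k)" using DERIV_imp_deriv[OF F] by (intro ext) simp
    thus ?case using Suc by simp
  qed simp
  thus "(deriv ^^ k) (F 0) = F k" .
  show "smooth (F 0)" unfolding smooth_def d using F by (auto simp: real_differentiable_def)
qed

lemma
  assumes "smooth f" "smooth g"
  shows smooth_add: "smooth (\<lambda>x. f x + g x)"
    and funpow_deriv_plus: "(deriv ^^ k) (\<lambda>x. f x + g x) = (\<lambda>x. (deriv ^^ k) f x + (deriv ^^ k) g x)"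
proof -
  define F where "F k = (\<lambda>x. (deriv ^^ k) f x + (deriv ^^ k) g x)" for k
  have "(F k has_real_derivative F (Suc k) x) (at x)" for k x
    unfolding F_def by (intro DERIV_add smooth_has_derivative assms)
  from derivative_sequence[of F, OF this] show "smooth (\<lambda>x. f x + g x)"
    "(deriv ^^ k) (\<lambda>x. f x + g x) = (\<lambda>x. (deriv ^^ k) f x + (deriv ^^ k) g x)"
    unfolding F_def by simp_all
qed

lemma
  assumes "smooth f"
  shows smooth_affine: "smooth (\<lambda>x. b * f (c * x + e))"
    and funpow_deriv_affine: "(deriv ^^ k) (\<lambda>x. b * f (c * x + e)) = (\<lambda>x. b * c ^ k * (deriv ^^ k) f (c * x + e))"
proof -
  define F where "F k = (\<lambda>x. b * c ^ k * (deriv ^^ k) f (c * x + e))" for k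
  have "(F k has_real_derivative F (Suc k) x) (at x)" for k x
  proof -
    have "((\<lambda>x. (deriv ^^ k) f (c * x + e)) has_real_derivative (deriv ^^ Suc k) f (c * x + e) * c) (at x)"
      by (rule DERIV_chain2[OF smooth_has_derivative[OF assms]]) (auto intro!: derivative_eq_intros)
    from DERIV_cmult[OF this, of "b * c ^ k"] show ?thesis unfolding F_def by (simp add: mult_ac)
  qed
  from derivative_sequence[of F, OF this] show "smooth (\<lambda>x. b * f (c * x + e))"
    "(deriv ^^ k) (\<lambda>x. b * f (c * x + e)) = (\<lambda>x. b * c ^ k * (deriv ^^ k) f (c * x + e))"
    unfolding F_def by simp_all
qed

lemma
  assumes "smooth f"
  shows smooth_cmult: "smooth (\<lambda>x. b * f x)"
    and funpow_deriv_cmult: "(deriv ^^ k) (\<lambda>x. b * f x) = (\<lambda>x. b * (deriv ^^ k) f x)"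
  using smooth_affine[OF assms, of b 1 0] funpow_deriv_affine[OF assms, of k b 1 0] by simp_all

lemma binomial_sum_Suc:
  fixes a b :: "nat \<Rightarrow> real"
  shows "(\<Sum>i\<le>k. real (k choose i) * (a (Suc i) * b (k - i) + b (Suc (k - i)) * a i)) =
         (\<Sum>i\<le>Suc k. real (Suc k choose i) * (a i * b (Suc k - i)))"
proof -
  have "(\<Sum>i\<le>Suc k. real (Suc k choose i) * (a i * b (Suc k - i))) =
      a 0 * b (Suc k) + (\<Sum>i\<le>k. real (Suc k choose Suc i) * (a (Suc i) * b (k - i)))"
    unfolding sum.atMost_Suc_shift by simp
  also have "(\<Sum>i\<le>k. real (Suc k choose Suc i) * (a (Suc i) * b (k - i))) =
      (\<Sum>i\<le>k. real (k choose i) * (a (Suc i) * b (k - i))) + (\<Sum>i\<le>k. real (k choose Suc i) * (a (Suc i) * b (k - i)))"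
    unfolding sum.distrib[symmetric] binomial_Suc_Suc of_nat_add distrib_right ..
  also have "a 0 * b (Suc k) + ((\<Sum>i\<le>k. real (k choose i) * (a (Suc i) * b (k - i))) +
      (\<Sum>i\<le>k. real (k choose Suc i) * (a (Suc i) * b (k - i)))) =
      (\<Sum>i\<le>k. real (k choose i) * (a (Suc i) * b (k - i))) +
      (a 0 * b (Suc k) + (\<Sum>i\<le>k. real (k choose Suc i) * (a (Suc i) * b (k - i))))"
    by simp
  also have "a 0 * b (Suc k) + (\<Sum>i\<le>k. real (k choose Suc i) * (a (Suc i) * b (k - i))) =
      (\<Sum>i\<le>Suc k. real (k choose i) * (a i * b (Suc k - i)))"
    unfolding sum.atMost_Suc_shift by simp
  also have "\<dots> = (\<Sum>i\<le>k. real (k choose i) * (b (Suc (k - i)) * a i))"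
    by (simp add: Suc_diff_le mult.commute)
  finally show ?thesis unfolding distrib_left sum.distrib by simp
qed

lemma
  assumes f: "smooth f" and g: "smooth g"
  shows smooth_mult: "smooth (\<lambda>x. f x * g x)"
    and funpow_deriv_mult: "(deriv ^^ k) (\<lambda>x. f x * g x) =
      (\<lambda>x. \<Sum>i\<le>k. real (k choose i) * (deriv ^^ i) f x * (deriv ^^ (k - i)) g x)"
proof -
  define F where "F k = (\<lambda>x. \<Sum>i\<le>k. real (k choose i) * (deriv ^^ i) f x * (deriv ^^ (k - i)) g x)" for k
  have "(F k has_real_derivative F (Suc k) x) (at x)" for k x
  proof -
    have t: "((\<lambda>x. real (k choose i) * ((deriv ^^ i) f x * (deriv ^^ (k - i)) g x)) has_real_derivative
        real (k choose i) * ((deriv ^^ Suc i) f x * (deriv ^^ (k - i)) g x +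
         (deriv ^^ Suc (k - i)) g x * (deriv ^^ i) f x)) (at x)" for i
      by (rule DERIV_cmult[OF DERIV_mult[OF smooth_has_derivative[OF f] smooth_has_derivative[OF g]]])
    have "(F k has_real_derivative (\<Sum>i\<le>k. real (k choose i) * ((deriv ^^ Suc i) f x * (deriv ^^ (k - i)) g x +
         (deriv ^^ Suc (k - i)) g x * (deriv ^^ i) f x))) (at x)"
      unfolding F_def mult.assoc by (rule DERIV_sum) (rule t)
    also have "(\<Sum>i\<le>k. real (k choose i) * ((deriv ^^ Suc i) f x * (deriv ^^ (k - i)) g x +
         (deriv ^^ Suc (k - i)) g x * (deriv ^^ i) f x)) = F (Suc k) x"
      unfolding F_def mult.assoc
      by (rule binomial_sum_Suc[of k "\<lambda>i. (deriv ^^ i) f x" "\<lambda>i. (deriv ^^ i) g x"])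
    finally show ?thesis .
  qed
  from derivative_sequence[of F, OF this] show "smooth (\<lambda>x. f x * g x)"
    "(deriv ^^ k) (\<lambda>x. f x * g x) = (\<lambda>x. \<Sum>i\<le>k. real (k choose i) * (deriv ^^ i) f x * (deriv ^^ (k - i)) g x)"
    unfolding F_def by simp_all
qed

section \<open>Bump functions\<close>

text \<open>All derivatives of \<open>exp (- (1 / y))\<close>, extended by \<open>0\<close> to \<open>y \<le> 0\<close>, are linear combinations of the functions
  \<open>flat n\<close>, each of which is differentiable at \<open>0\<close> because \<open>flat n y / y = flat (n + 1) y\<close> tends to \<open>0\<close>.\<close>

definition flat :: "nat \<Rightarrow> real \<Rightarrow> real" where
  "flat n y = (if y > 0 then (1 / y) ^ n * exp (- (1 / y)) else 0)"

lemma flat_tendsto_0: "(flat n \<longlongrightarrow> 0) (at 0)"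
proof (rule filterlim_split_at_real)
  show "(flat n \<longlongrightarrow> 0) (at_left 0)"
  proof (rule tendsto_eventually)
    show "eventually (\<lambda>y. flat n y = 0) (at_left 0)"
      using eventually_at_left_real[of "-1" "0::real", simplified] by eventually_elim (simp add: flat_def)
  qed
  have "((\<lambda>y. (inverse y) ^ n / exp (inverse y)) \<longlongrightarrow> (0::real)) (at_right 0)"
    by (rule filterlim_compose[OF tendsto_power_div_exp_0 filterlim_inverse_at_top_right])
  moreover have "eventually (\<lambda>y. (inverse y) ^ n / exp (inverse y) = flat n y) (at_right 0)"
    using eventually_at_right_real[of 0 "1::real", simplified]
    by eventually_elim (simp add: flat_def exp_minus field_simps)
  ultimately show "(flat n \<longlongrightarrow> 0) (at_right 0)" by (simp add: tendsto_cong)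
qed

lemma flat_has_derivative:
  "(flat n has_real_derivative flat (n + 2) y - real n * flat (n + 1) y) (at y)"
proof -
  consider "y > 0" | "y < 0" | "y = 0" by linarith
  thus ?thesis
  proof cases
    case 1
    have "((\<lambda>y. (1 / y) ^ n * exp (- (1 / y))) has_real_derivative flat (n + 2) y - real n * flat (n + 1) y) (at y)"
    proof -
      have d: "((\<lambda>y. 1 / y) has_real_derivative - ((1 / y) ^ 2)) (at y)"
        using 1 by (auto intro!: derivative_eq_intros simp: power2_eq_square)
      have e: "((\<lambda>y. exp (- (1 / y))) has_real_derivative exp (- (1 / y)) * (1 / y) ^ 2) (at y)"
        using DERIV_chain2[OF DERIV_exp DERIV_minus[OF d]] by simp
      have "real n * (- ((1 / y) ^ 2) * (1 / y) ^ (n - Suc 0)) = - (real n * (1 / y) ^ (n + 1))"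
        by (cases n) (auto simp: power2_eq_square)
      thus ?thesis
        using DERIV_mult[OF DERIV_power[OF d, of n] e] 1
        by (simp add: flat_def power_add power2_eq_square mult_ac)
    qed
    thus ?thesis
      by (rule has_field_derivative_transform_within_open[where S = "{0<..}"]) (use 1 in \<open>auto simp: flat_def\<close>)
  next
    case 2
    have "((\<lambda>_. 0) has_real_derivative flat (n + 2) y - real n * flat (n + 1) y) (at y)"
      using 2 by (simp add: flat_def)
    thus ?thesis
      by (rule has_field_derivative_transform_within_open[where S = "{..<0}"]) (use 2 in \<open>auto simp: flat_def\<close>)
  next
    case 3
    have "(flat (Suc n) \<longlongrightarrow> 0) (at 0)" by (rule flat_tendsto_0)
    moreover have "eventually (\<lambda>y. flat (Suc n) y = (flat n y - flat n 0) / (y - 0)) (at 0)"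
      by (auto simp: flat_def eventually_at_filter)
    ultimately have "((\<lambda>y. (flat n y - flat n 0) / (y - 0)) \<longlongrightarrow> 0) (at 0)"
      by (simp add: tendsto_cong)
    thus ?thesis using 3 by (simp add: has_field_derivative_iff flat_def)
  qed
qed

inductive_set flat_span :: "(real \<Rightarrow> real) set" where
  base: "flat n \<in> flat_span"
| add: "f \<in> flat_span \<Longrightarrow> g \<in> flat_span \<Longrightarrow> (\<lambda>x. f x + g x) \<in> flat_span"
| scale: "f \<in> flat_span \<Longrightarrow> (\<lambda>x. b * f x) \<in> flat_span"

lemma flat_span_derivative:
  "f \<in> flat_span \<Longrightarrow> \<exists>f'\<in>flat_span. \<forall>x. (f has_real_derivative f' x) (at x)"
proof (induction rule: flat_span.induct)
  case (base n)
  have "(\<lambda>x. flat (n + 2) x + (- real n) * flat (n + 1) x) \<in> flat_span"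
    by (intro flat_span.intros)
  thus ?case using flat_has_derivative[of n] by (intro bexI[rotated]) auto
next
  case (add f g)
  then obtain f' g' where "f' \<in> flat_span" "g' \<in> flat_span"
    "\<forall>x. (f has_real_derivative f' x) (at x)" "\<forall>x. (g has_real_derivative g' x) (at x)" by blast
  thus ?case by (intro bexI[of _ "\<lambda>x. f' x + g' x"] allI DERIV_add flat_span.add) auto
next
  case (scale f b)
  then obtain f' where "f' \<in> flat_span" "\<forall>x. (f has_real_derivative f' x) (at x)" by blast
  thus ?case by (intro bexI[of _ "\<lambda>x. b * f' x"] allI DERIV_cmult flat_span.scale) auto
qed

lemma smooth_flat: "smooth (flat n)"
proof -
  have "(deriv ^^ k) f \<in> flat_span" if "f \<in> flat_span" for f k
  proof (induction k)
    case (Suc k)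
    then obtain f' where f': "f' \<in> flat_span" "\<And>x. ((deriv ^^ k) f has_real_derivative f' x) (at x)"
      using flat_span_derivative by blast
    have "deriv ((deriv ^^ k) f) = f'" using DERIV_imp_deriv[OF f'(2)] by (intro ext) simp
    thus ?case using f' by simp
  qed (use that in simp)
  hence "(deriv ^^ k) (flat n) \<in> flat_span" for k by (simp add: flat_span.base)
  hence "\<exists>f'. \<forall>x. ((deriv ^^ k) (flat n) has_real_derivative f' x) (at x)" for k
    using flat_span_derivative by blast
  thus ?thesis unfolding smooth_def real_differentiable_def by metis
qed

section \<open>Test functions\<close>

lemma test_functions_iff:
  "\<phi> \<in> test_functions \<longleftrightarrow> smooth \<phi> \<and> (\<exists>S>0. \<forall>x. \<bar>x\<bar> > S \<longrightarrow> \<phi> x = 0)"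
proof
  assume \<phi>: "\<phi> \<in> test_functions"
  hence "bounded {x. \<phi> x \<noteq> 0}"
    by (auto simp: test_functions_def compact_eq_bounded_closed intro: bounded_subset[OF _ closure_subset])
  then obtain S where "S > 0" "\<forall>x\<in>{x. \<phi> x \<noteq> 0}. norm x \<le> S" by (auto simp: bounded_pos)
  thus "smooth \<phi> \<and> (\<exists>S>0. \<forall>x. \<bar>x\<bar> > S \<longrightarrow> \<phi> x = 0)"
    using \<phi> by (force simp: test_functions_def smooth_def)
next
  assume *: "smooth \<phi> \<and> (\<exists>S>0. \<forall>x. \<bar>x\<bar> > S \<longrightarrow> \<phi> x = 0)"
  then obtain S where "\<And>x. \<bar>x\<bar> > S \<Longrightarrow> \<phi> x = 0" by blast
  hence "\<forall>x\<in>{x. \<phi> x \<noteq> 0}. norm x \<le> S" by (metis mem_Collect_eq not_le real_norm_def)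
  hence "bounded {x. \<phi> x \<noteq> 0}" by (auto simp: bounded_iff)
  thus "\<phi> \<in> test_functions" using * by (auto simp: test_functions_def smooth_def)
qed

lemma test_smooth: "\<phi> \<in> test_functions \<Longrightarrow> smooth \<phi>"
  by (simp add: test_functions_iff)

lemma derivatives_vanish:
  assumes "smooth \<phi>" "\<And>x. \<bar>x\<bar> > S \<Longrightarrow> \<phi> x = 0" "\<bar>x\<bar> > S"
  shows "(deriv ^^ k) \<phi> x = 0"
  using assms(3)
proof (induction k arbitrary: x)
  case (Suc k)
  have "((\<lambda>_. 0) has_real_derivative 0) (at x)" by simp
  hence "((deriv ^^ k) \<phi> has_real_derivative 0) (at x)"
  proof (rule has_field_derivative_transform_within_open[where S = "{x. \<bar>x\<bar> > S}"])
    show "open {x. \<bar>x\<bar> > S}" by (intro open_Collect_less continuous_intros)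
  qed (use Suc in auto)
  thus ?case by (simp add: DERIV_imp_deriv)
qed (use assms in simp)

lemma test_support:
  assumes "\<phi> \<in> test_functions"
  obtains S where "S > 0" "\<And>k x. \<bar>x\<bar> > S \<Longrightarrow> (deriv ^^ k) \<phi> x = 0"
  using assms derivatives_vanish unfolding test_functions_iff by metis

lemma test_deriv: "\<phi> \<in> test_functions \<Longrightarrow> (deriv ^^ k) \<phi> \<in> test_functions"
proof -
  assume \<phi>: "\<phi> \<in> test_functions"
  obtain S where S: "S > 0" "\<And>k x. \<bar>x\<bar> > S \<Longrightarrow> (deriv ^^ k) \<phi> x = 0"
    using test_support[OF \<phi>] by blast
  show ?thesis unfolding test_functions_iff using S smooth_deriv[OF test_smooth[OF \<phi>]] by blast
qed

lemma test_mult: "smooth f \<Longrightarrow> \<phi> \<in> test_functions \<Longrightarrow> (\<lambda>x. f x * \<phi> x) \<in> test_functions"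
  by (auto simp: test_functions_iff intro!: smooth_mult)

lemma test_bounded:
  assumes "\<phi> \<in> test_functions"
  obtains M where "M \<ge> 0" "\<And>x. \<bar>(deriv ^^ k) \<phi> x\<bar> \<le> M"
proof -
  obtain S where S: "S > 0" "\<And>k x. \<bar>x\<bar> > S \<Longrightarrow> (deriv ^^ k) \<phi> x = 0"
    using test_support[OF assms] by blast
  have "compact ((deriv ^^ k) \<phi> ` {-S..S})"
    by (intro compact_continuous_image smooth_continuous test_smooth assms) auto
  then obtain M where M: "M > 0" "\<forall>x\<in>{-S..S}. \<bar>(deriv ^^ k) \<phi> x\<bar> \<le> M"
    by (auto dest!: compact_imp_bounded simp: bounded_pos)
  show ?thesis
  proof (rule that[of M])
    fix x show "\<bar>(deriv ^^ k) \<phi> x\<bar> \<le> M"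
    proof (cases "\<bar>x\<bar> > S")
      case True thus ?thesis using M S(2)[of x k] by simp
    next
      case False
      hence "x \<in> {-S..S}" by auto
      thus ?thesis using M by blast
    qed
  qed (use M in simp)
qed

text \<open>As \<open>n\<close> grows, \<open>bump n a b\<close> increases to the indicator of the open interval between \<open>a\<close> and \<open>b\<close>.\<close>

definition bump :: "real \<Rightarrow> real \<Rightarrow> real \<Rightarrow> real \<Rightarrow> real" where
  "bump n a b x = flat 0 (n * (x - a)) * flat 0 (n * (b - x))"

lemma bump_eq: "n > 0 \<Longrightarrow> bump n a b x = (if a < x \<and> x < b then exp (- (1 / (n * (x - a)))) * exp (- (1 / (n * (b - x)))) else 0)"
  by (auto simp: bump_def flat_def zero_less_mult_iff)

lemma bump_test: 
  assumes "n > 0" shows "bump n a b \<in> test_functions"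
proof -
  have "smooth (\<lambda>x. (1 * flat 0 (n * x + (- n * a))) * (1 * flat 0 ((- n) * x + n * b)))"
    by (intro smooth_mult smooth_affine smooth_flat)
  hence "smooth (bump n a b)" by (simp add: bump_def[abs_def] algebra_simps)
  moreover have "\<forall>x. \<bar>x\<bar> > \<bar>a\<bar> + \<bar>b\<bar> + 1 \<longrightarrow> bump n a b x = 0"
    using assms by (auto simp: bump_eq)
  ultimately show ?thesis unfolding test_functions_iff
    by (intro conjI exI[of _ "\<bar>a\<bar> + \<bar>b\<bar> + 1"]) auto
qed

lemma bump_bounds:
  assumes n: "n > 0"
  shows "0 \<le> bump n a b x" "bump n a b x \<le> indicator {a<..<b} x"
proof -
  from n show "0 \<le> bump n a b x" by (simp add: bump_eq)
  have "exp (- (1 / (n * (x - a)))) * exp (- (1 / (n * (b - x)))) \<le> 1 * 1" if "a < x" "x < b"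
    using n that by (intro mult_mono) auto
  thus "bump n a b x \<le> indicator {a<..<b} x" using n by (auto simp: bump_eq indicator_def)
qed

lemma bump_tendsto: "(\<lambda>n. bump (real (Suc n)) a b x) \<longlonglongrightarrow> indicator {a<..<b} x"
proof (cases "a < x \<and> x < b")
  case True
  hence "(\<lambda>n. exp (- (1 / (real (Suc n) * (x - a)))) * exp (- (1 / (real (Suc n) * (b - x))))) \<longlonglongrightarrow> exp (- 0) * exp (- 0)"
  proof (intro tendsto_intros)
    have *: "(\<lambda>n. 1 / (real (Suc n) * c)) \<longlonglongrightarrow> 0" for c :: real
      using tendsto_mult_left_zero[OF LIMSEQ_inverse_real_of_nat, of "inverse c"]
      by (simp only: divide_inverse inverse_mult_distrib mult_1_left)
    show "(\<lambda>n. 1 / (real (Suc n) * (x - a))) \<longlonglongrightarrow> 0" "(\<lambda>n. 1 / (real (Suc n) * (b - x))) \<longlonglongrightarrow> 0"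
      using * by blast+
  qed
  thus ?thesis using True by (simp add: bump_eq del: of_nat_Suc)
next
  case False
  thus ?thesis by (auto simp: bump_eq indicator_def)
qed

section \<open>Weak derivatives\<close>

lemma integrable_inverse_1_plus_sq: "integrable lborel (\<lambda>x::real. 1 / (1 + x\<^sup>2))"
  using integrable_inverse_1_plus_square
  by (simp add: set_integrable_def inverse_eq_divide)

lemma one_plus_sq_pos: "1 + (x::real)\<^sup>2 > 0"
  by (intro add_pos_nonneg) auto

lemma test_integrable:
  assumes "\<phi> \<in> test_functions"
  shows "integrable lborel \<phi>"
proof -
  obtain S where S: "S > 0" "\<And>k x. \<bar>x\<bar> > S \<Longrightarrow> (deriv ^^ k) \<phi> x = 0"
    using test_support[OF assms] by blast
  have "integrable lborel (\<lambda>x. indicator {-S..S} x *\<^sub>R \<phi> x)"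
    by (rule borel_integrable_compact) (use smooth_continuous[OF test_smooth[OF assms], of _ 0] in auto)
  also have "(\<lambda>x. indicator {-S..S} x *\<^sub>R \<phi> x) = \<phi>"
  proof
    fix x show "indicator {-S..S} x *\<^sub>R \<phi> x = \<phi> x"
      using S(2)[of x 0] by (cases "\<bar>x\<bar> > S") (auto simp: indicator_def)
  qed
  finally show ?thesis .
qed

lemma integral_test_by_parts:
  assumes f: "smooth f" and \<phi>: "\<phi> \<in> test_functions"
  shows "(LINT x|lborel. f x * deriv \<phi> x) = - (LINT x|lborel. deriv f x * \<phi> x)"
proof -
  obtain S where S: "S > 0" "\<And>k x. \<bar>x\<bar> > S \<Longrightarrow> (deriv ^^ k) \<phi> x = 0"
    using test_support[OF \<phi>] by blast
  define g where "g x = f x * deriv \<phi> x + deriv f x * \<phi> x" for x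
  have "has_bochner_integral lborel (\<lambda>x. g x * indicator {-(S+1)..S+1} x) (f (S+1) * \<phi> (S+1) - f (-(S+1)) * \<phi> (-(S+1)))"
  proof (rule has_bochner_integral_FTC_Icc_real)
    fix x
    show "((\<lambda>x. f x * \<phi> x) has_real_derivative g x) (at x)"
      using smooth_has_derivative[OF f, of 0 x] smooth_has_derivative[OF test_smooth[OF \<phi>], of 0 x]
      unfolding g_def by (auto intro!: derivative_eq_intros)
    have "continuous_on UNIV g" unfolding g_def
      using smooth_continuous[OF f, of _ 0] smooth_continuous[OF f, of _ 1]
        smooth_continuous[OF test_smooth[OF \<phi>], of _ 0] smooth_continuous[OF test_smooth[OF \<phi>], of _ 1]
      by (intro continuous_intros) auto
    thus "isCont g x" by (simp add: continuous_on_eq_continuous_at)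
  qed (use S in auto)
  moreover have "(\<lambda>x. g x * indicator {-(S+1)..S+1} x) = g"
  proof
    fix x show "g x * indicator {-(S+1)..S+1} x = g x"
      using S(2)[of x 0] S(2)[of x 1] by (cases "\<bar>x\<bar> > S") (auto simp: g_def indicator_def)
  qed
  moreover have "\<phi> (S+1) = 0" "\<phi> (-(S+1)) = 0" using S(2)[of _ 0] S(1) by auto
  ultimately have "(LINT x|lborel. g x) = 0" by (simp add: has_bochner_integral_iff)
  moreover have "integrable lborel (\<lambda>x. f x * deriv \<phi> x)"
    using test_integrable[OF test_mult[OF f test_deriv[OF \<phi>, of 1]]] by simp
  moreover have "integrable lborel (\<lambda>x. deriv f x * \<phi> x)"
    using test_integrable[OF test_mult[OF smooth_deriv[OF f, of 1] \<phi>]] by simp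
  ultimately show ?thesis by (simp add: g_def)
qed

lemma smooth_weak_derivative:
  assumes "smooth f"
  shows "weak_derivative k f ((deriv ^^ k) f)"
proof -
  have "(LINT x|lborel. f x * (deriv ^^ k) \<phi> x) = (-1) ^ k * (LINT x|lborel. (deriv ^^ k) f x * \<phi> x)"
    if \<phi>: "\<phi> \<in> test_functions" for \<phi>
    using assms
  proof (induction k arbitrary: f)
    case (Suc k)
    have f': "smooth (deriv f)" using smooth_deriv[OF Suc.prems, of 1] by simp
    have "(LINT x|lborel. f x * (deriv ^^ Suc k) \<phi> x) = - (LINT x|lborel. deriv f x * (deriv ^^ k) \<phi> x)"
      using integral_test_by_parts[OF Suc.prems test_deriv[OF \<phi>, of k]] by simp
    also have "(LINT x|lborel. deriv f x * (deriv ^^ k) \<phi> x) = (-1) ^ k * (LINT x|lborel. (deriv ^^ Suc k) f x * \<phi> x)"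
      by (subst Suc.IH[OF f']) (simp only: funpow_deriv_deriv)
    finally show ?case by simp
  qed simp
  thus ?thesis by (simp add: weak_derivative_def)
qed

lemma continuous_set_integrable:
  fixes f :: "real \<Rightarrow> real"
  assumes "continuous_on UNIV f"
  shows "set_integrable lborel {a..b} f"
  unfolding set_integrable_def
  by (rule borel_integrable_compact[OF compact_Icc continuous_on_subset[OF assms subset_UNIV]])

text \<open>Since the bumps converge to the indicator of an interval, a function that integrates to \<open>0\<close> against
  all of them integrates to \<open>0\<close> over every interval. On a bounded interval its positive and negative
  part then are densities of the same measure.\<close>

lemma du_Bois_Reymond:
  fixes h :: "real \<Rightarrow> real"
  assumes h: "\<And>a b. set_integrable lborel {a..b} h"
    and zero: "\<And>\<phi>. \<phi> \<in> test_functions \<Longrightarrow> (LINT x|lborel. h x * \<phi> x) = 0"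
  shows "AE x in lborel. h x = 0"
proof -
  have int0: "(LINT x|lborel. indicator {a<..<b} x * h x) = 0" for a b
  proof -
    have hi: "integrable lborel (\<lambda>x. indicator {a..b} x * h x)"
      using h by (simp add: set_integrable_def)
    have "(\<lambda>n. LINT x|lborel. bump (real (Suc n)) a b x * (indicator {a..b} x * h x)) \<longlonglongrightarrow>
          (LINT x|lborel. indicator {a<..<b} x * (indicator {a..b} x * h x))"
    proof (rule integral_dominated_convergence[where w = "\<lambda>x. norm (indicator {a..b} x * h x)"])
      show "(\<lambda>x. bump (real (Suc n)) a b x * (indicator {a..b} x * h x)) \<in> borel_measurable lborel" for n
        using smooth_measurable[OF test_smooth[OF bump_test[of "real (Suc n)" a b]], of 0] borel_measurable_integrable[OF hi]
        by auto
      show "AE x in lborel. (\<lambda>n. bump (real (Suc n)) a b x * (indicator {a..b} x * h x))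
              \<longlonglongrightarrow> indicator {a<..<b} x * (indicator {a..b} x * h x)"
        by (intro AE_I2 tendsto_mult bump_tendsto tendsto_const)
      show "AE x in lborel. norm (bump (real (Suc n)) a b x * (indicator {a..b} x * h x)) \<le> norm (indicator {a..b} x * h x)" for n
      proof (rule AE_I2)
        fix x
        have "\<bar>bump (real (Suc n)) a b x\<bar> \<le> 1"
          using bump_bounds[of "real (Suc n)" a b x] 
          by (cases "a < x \<and> x < b") auto
        thus "norm (bump (real (Suc n)) a b x * (indicator {a..b} x * h x)) \<le> norm (indicator {a..b} x * h x)"
          using mult_right_mono[of "\<bar>bump (real (Suc n)) a b x\<bar>" 1 "norm (indicator {a..b} x * h x)"]
          by (simp add: abs_mult)
      qed
    qed (use hi in auto)
    moreover have "(LINT x|lborel. bump (real (Suc n)) a b x * (indicator {a..b} x * h x)) = 0" for n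
    proof -
      have "(\<lambda>x. bump (real (Suc n)) a b x * (indicator {a..b} x * h x)) = (\<lambda>x. h x * bump (real (Suc n)) a b x)"
        by (auto simp: bump_eq indicator_def fun_eq_iff)
      moreover have "(LINT x|lborel. h x * bump (real (Suc n)) a b x) = 0"
        by (rule zero[OF bump_test]) simp
      ultimately show ?thesis by (simp only:)
    qed
    moreover have "indicator {a<..<b} x * (indicator {a..b} x * h x) = indicator {a<..<b} x * h x" for x :: real
      by (auto simp: indicator_def)
    ultimately show ?thesis by (simp add: LIMSEQ_const_iff)
  qed
  have "AE x in lborel. indicator {-n<..<n} x * h x = 0" for n :: real
  proof -
    define H where "H x = indicator {-n<..<n} x * h x" for x
    have "set_integrable lborel {-n<..<n} h"
      by (rule set_integrable_subset[OF h[of "-n" n]]) auto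
    hence Hi: "integrable lborel H" by (simp add: H_def[abs_def] set_integrable_def)
    have Hm[measurable]: "H \<in> borel_measurable borel" using borel_measurable_integrable[OF Hi] by simp
    have tail: "emeasure (density lborel (\<lambda>x. ennreal (max 0 (H x)))) {x<..} < \<infinity> \<and>
        emeasure (density lborel (\<lambda>x. ennreal (max 0 (H x)))) {x<..} =
        emeasure (density lborel (\<lambda>x. ennreal (max 0 (- H x)))) {x<..}" for x
    proof -
      have i1: "integrable lborel (\<lambda>y. max 0 (H y) * indicator {x<..} y)"
        by (rule Bochner_Integration.integrable_bound[OF Hi]) (auto simp: indicator_def)
      have i2: "integrable lborel (\<lambda>y. max 0 (- H y) * indicator {x<..} y)"
        by (rule Bochner_Integration.integrable_bound[OF Hi]) (auto simp: indicator_def)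
      have e1: "emeasure (density lborel (\<lambda>x. ennreal (max 0 (H x)))) {x<..} = ennreal (LINT y|lborel. max 0 (H y) * indicator {x<..} y)"
        by (subst emeasure_density) (auto simp: ennreal_mult' ennreal_indicator nn_integral_eq_integral[OF i1, symmetric])
      have e2: "emeasure (density lborel (\<lambda>x. ennreal (max 0 (- H x)))) {x<..} = ennreal (LINT y|lborel. max 0 (- H y) * indicator {x<..} y)"
        by (subst emeasure_density) (auto simp: ennreal_mult' ennreal_indicator nn_integral_eq_integral[OF i2, symmetric])
      have "(LINT y|lborel. max 0 (H y) * indicator {x<..} y) - (LINT y|lborel. max 0 (- H y) * indicator {x<..} y)
          = (LINT y|lborel. max 0 (H y) * indicator {x<..} y - max 0 (- H y) * indicator {x<..} y)"
        using i1 i2 by simp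
      also have "(\<lambda>y. max 0 (H y) * indicator {x<..} y - max 0 (- H y) * indicator {x<..} y)
          = (\<lambda>y. indicator {max x (-n)<..<n} y * h y)"
        by (auto simp: fun_eq_iff indicator_def H_def max_def)
      finally show ?thesis using e1 e2 int0 by simp
    qed
    have "density lborel (\<lambda>x. ennreal (max 0 (H x))) = density lborel (\<lambda>x. ennreal (max 0 (- H x)))"
      proof (rule measure_eqI_lessThan)
      fix x
      show "emeasure (density lborel (\<lambda>x. ennreal (max 0 (H x)))) {x<..} < \<infinity>"
        and "emeasure (density lborel (\<lambda>x. ennreal (max 0 (H x)))) {x<..} =
          emeasure (density lborel (\<lambda>x. ennreal (max 0 (- H x)))) {x<..}"
        using tail[of x] by blast+
    qed simp_all
    hence "AE x in lborel. ennreal (max 0 (H x)) = ennreal (max 0 (- H x))"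
      by (subst (asm) sigma_finite_measure.density_unique_iff[OF sigma_finite_lborel]) auto
    thus ?thesis
    proof eventually_elim
      case (elim x)
      hence "max 0 (H x) = max 0 (- H x)" by (subst (asm) ennreal_inj) auto
      thus ?case by (auto simp: H_def max_def split: if_splits)
    qed
  qed
  hence "AE x in lborel. \<forall>n. indicator {- real n<..<real n} x * h x = 0"
    by (subst AE_all_countable) blast
  thus ?thesis
  proof eventually_elim
    case (elim x)
    obtain n where "\<bar>x\<bar> < real n" using reals_Archimedean2 by blast
    thus ?case using elim[rule_format, of n] by (auto simp: indicator_def)
  qed
qed

lemma L2_set_integrable:
  assumes "g \<in> L2"
  shows "set_integrable lborel {a..b} g"
  unfolding set_integrable_def
proof (rule Bochner_Integration.integrable_bound)
  have "integrable lborel (indicator {a..b} :: real \<Rightarrow> real)"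
    by (rule integrable_real_indicator) (auto simp: emeasure_lborel_Icc_eq)
  thus "integrable lborel (\<lambda>x. indicator {a..b} x + (g x)\<^sup>2)"
    using assms by (intro Bochner_Integration.integrable_add) (auto simp: L2_def)
  show "(\<lambda>x. indicator {a..b} x *\<^sub>R g x) \<in> borel_measurable lborel" using assms by (auto simp: L2_def)
  show "AE x in lborel. norm (indicator {a..b} x *\<^sub>R g x) \<le> norm (indicator {a..b} x + (g x)\<^sup>2)"
  proof (rule AE_I2)
    fix x
    have "\<bar>g x\<bar> \<le> 1 + (g x)\<^sup>2" using sum_squares_bound[of 1 "\<bar>g x\<bar>"] by (simp add: power2_eq_square)
    thus "norm (indicator {a..b} x *\<^sub>R g x) \<le> norm (indicator {a..b} x + (g x)\<^sup>2)"
      by (auto simp: indicator_def)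
  qed
qed

lemma L2_mult_test_integrable:
  assumes "g \<in> L2" "\<phi> \<in> test_functions"
  shows "integrable lborel (\<lambda>x. g x * \<phi> x)"
proof (rule Bochner_Integration.integrable_bound)
  have "integrable lborel (\<lambda>x. \<phi> x * \<phi> x)"
    using test_integrable[OF test_mult[OF test_smooth[OF assms(2)] assms(2)]] .
  thus "integrable lborel (\<lambda>x. (g x)\<^sup>2 + \<phi> x * \<phi> x)"
    using assms by (auto simp: L2_def)
  show "(\<lambda>x. g x * \<phi> x) \<in> borel_measurable lborel"
    using assms smooth_measurable[OF test_smooth[OF assms(2)], of 0] by (auto simp: L2_def)
  show "AE x in lborel. norm (g x * \<phi> x) \<le> norm ((g x)\<^sup>2 + \<phi> x * \<phi> x)"
  proof (rule AE_I2)
    fix x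
    have "2 * (\<bar>g x\<bar> * \<bar>\<phi> x\<bar>) \<le> (g x)\<^sup>2 + \<phi> x * \<phi> x"
      using sum_squares_bound[of "\<bar>g x\<bar>" "\<bar>\<phi> x\<bar>"] by (simp add: power2_eq_square)
    moreover have "\<bar>g x\<bar> * \<bar>\<phi> x\<bar> \<ge> 0" by simp
    ultimately have "\<bar>g x\<bar> * \<bar>\<phi> x\<bar> \<le> (g x)\<^sup>2 + \<phi> x * \<phi> x" by linarith
    thus "norm (g x * \<phi> x) \<le> norm ((g x)\<^sup>2 + \<phi> x * \<phi> x)" by (simp add: abs_mult)
  qed
qed

lemma weak_derivative_unique:
  assumes "weak_derivative k f g1" "weak_derivative k f g2" "g1 \<in> L2" "g2 \<in> L2"
  shows "AE x in lborel. g1 x = g2 x"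
proof -
  have "AE x in lborel. g1 x - g2 x = 0"
  proof (rule du_Bois_Reymond)
    show "set_integrable lborel {a..b} (\<lambda>x. g1 x - g2 x)" for a b
      by (intro set_integral_diff L2_set_integrable assms)
    fix \<phi> assume \<phi>: "\<phi> \<in> test_functions"
    have "(-1) ^ k * (LINT x|lborel. g1 x * \<phi> x) = (-1) ^ k * (LINT x|lborel. g2 x * \<phi> x)"
      using assms(1,2)[unfolded weak_derivative_def, rule_format, OF \<phi>] by simp
    thus "(LINT x|lborel. (g1 x - g2 x) * \<phi> x) = 0"
      using L2_mult_test_integrable[OF assms(3) \<phi>] L2_mult_test_integrable[OF assms(4) \<phi>]
      by (simp add: left_diff_distrib)
  qed
  thus ?thesis by simp
qed

section \<open>Functions with quadratic decay\<close>

text \<open>This class contains the test functions as well as the band-limited kernels below. It is contained in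
  all Sobolev spaces and closed under differentiation, and the rate \<open>1 / (1 + x\<^sup>2)\<close> makes the squares of all
  derivatives integrable.\<close>

definition quad_decay :: "(real \<Rightarrow> real) \<Rightarrow> bool" where
  "quad_decay f \<longleftrightarrow> smooth f \<and> (\<forall>k. \<exists>C. \<forall>x. \<bar>(deriv ^^ k) f x\<bar> \<le> C / (1 + x\<^sup>2))"

lemma quad_decay_smooth: "quad_decay f \<Longrightarrow> smooth f" by (simp add: quad_decay_def)

lemma quad_decay_bound:
  assumes "quad_decay f"
  obtains C where "C \<ge> 0" "\<And>x. \<bar>(deriv ^^ k) f x\<bar> \<le> C / (1 + x\<^sup>2)"
proof -
  obtain C where C: "\<And>x. \<bar>(deriv ^^ k) f x\<bar> \<le> C / (1 + x\<^sup>2)" using assms by (auto simp: quad_decay_def)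
  moreover have "C \<ge> 0" using C[of 0] by simp
  ultimately show ?thesis by (intro that)
qed

lemma quad_decay_deriv: "quad_decay f \<Longrightarrow> quad_decay ((deriv ^^ k) f)"
  by (auto simp: quad_decay_def smooth_deriv funpow_deriv_add)

lemma quad_decay_add:
  assumes "quad_decay f" "quad_decay g" shows "quad_decay (\<lambda>x. f x + g x)"
  unfolding quad_decay_def
proof (intro conjI allI)
  show "smooth (\<lambda>x. f x + g x)" using assms by (intro smooth_add quad_decay_smooth)
  fix k
  obtain C where C: "\<And>x. \<bar>(deriv ^^ k) f x\<bar> \<le> C / (1 + x\<^sup>2)" using quad_decay_bound[OF assms(1)] by metis
  obtain D where D: "\<And>x. \<bar>(deriv ^^ k) g x\<bar> \<le> D / (1 + x\<^sup>2)" using quad_decay_bound[OF assms(2)] by metis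
  have "\<bar>(deriv ^^ k) (\<lambda>x. f x + g x) x\<bar> \<le> (C + D) / (1 + x\<^sup>2)" for x
    using C[of x] D[of x] assms by (simp add: funpow_deriv_plus quad_decay_smooth add_divide_distrib)
  thus "\<exists>C. \<forall>x. \<bar>(deriv ^^ k) (\<lambda>x. f x + g x) x\<bar> \<le> C / (1 + x\<^sup>2)" by blast
qed

lemma quad_decay_cmult:
  assumes "quad_decay f" shows "quad_decay (\<lambda>x. b * f x)"
  unfolding quad_decay_def
proof (intro conjI allI)
  show "smooth (\<lambda>x. b * f x)" using assms by (intro smooth_cmult quad_decay_smooth)
  fix k
  obtain C where C: "\<And>x. \<bar>(deriv ^^ k) f x\<bar> \<le> C / (1 + x\<^sup>2)" using quad_decay_bound[OF assms(1)] by metis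
  have "\<bar>(deriv ^^ k) (\<lambda>x. b * f x) x\<bar> \<le> (\<bar>b\<bar> * C) / (1 + x\<^sup>2)" for x
    using mult_left_mono[OF C[of x], of "\<bar>b\<bar>"] assms by (simp add: funpow_deriv_cmult quad_decay_smooth abs_mult)
  thus "\<exists>C. \<forall>x. \<bar>(deriv ^^ k) (\<lambda>x. b * f x) x\<bar> \<le> C / (1 + x\<^sup>2)" by blast
qed

lemma test_quad_decay:
  assumes "\<phi> \<in> test_functions" shows "quad_decay \<phi>"
  unfolding quad_decay_def
proof (intro conjI allI)
  show "smooth \<phi>" using assms by (rule test_smooth)
  fix k
  obtain S where S: "S > 0" "\<And>k x. \<bar>x\<bar> > S \<Longrightarrow> (deriv ^^ k) \<phi> x = 0"
    using test_support[OF assms] by blast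
  obtain M where M: "M \<ge> 0" "\<And>x. \<bar>(deriv ^^ k) \<phi> x\<bar> \<le> M" using test_bounded[OF assms] by blast
  have "\<bar>(deriv ^^ k) \<phi> x\<bar> \<le> (M * (1 + S\<^sup>2)) / (1 + x\<^sup>2)" for x
  proof (cases "\<bar>x\<bar> > S")
    case True
    thus ?thesis using S M one_plus_sq_pos[of x] by (simp add: add_nonneg_nonneg)
  next
    case False
    hence "x\<^sup>2 \<le> S\<^sup>2" using S by (simp add: abs_le_square_iff[symmetric])
    hence "M * (1 + x\<^sup>2) \<le> M * (1 + S\<^sup>2)" using M by (intro mult_left_mono) auto
    hence "M \<le> (M * (1 + S\<^sup>2)) / (1 + x\<^sup>2)" using one_plus_sq_pos[of x] by (simp add: field_simps)
    thus ?thesis using M(2)[of x] by linarith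
  qed
  thus "\<exists>C. \<forall>x. \<bar>(deriv ^^ k) \<phi> x\<bar> \<le> C / (1 + x\<^sup>2)" by blast
qed

lemma sq_le_of_bound:
  fixes y C x :: real
  assumes "\<bar>y\<bar> \<le> C / (1 + x\<^sup>2)"
  shows "y\<^sup>2 \<le> C\<^sup>2 / (1 + x\<^sup>2)"
proof -
  have "\<bar>y\<bar>\<^sup>2 \<le> (C / (1 + x\<^sup>2))\<^sup>2" using assms by (intro power_mono) auto
  also have "\<dots> = C\<^sup>2 / ((1 + x\<^sup>2) * (1 + x\<^sup>2))" by (simp add: power2_eq_square)
  also have "\<dots> \<le> C\<^sup>2 / (1 * (1 + x\<^sup>2))"
    using one_plus_sq_pos[of x] by (intro divide_left_mono mult_right_mono mult_pos_pos) auto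
  finally show ?thesis by simp
qed

lemma quad_decay_L2:
  assumes "quad_decay f" shows "(deriv ^^ k) f \<in> L2"
proof -
  obtain C where C: "C \<ge> 0" "\<And>x. \<bar>(deriv ^^ k) f x\<bar> \<le> C / (1 + x\<^sup>2)" using quad_decay_bound[OF assms] by metis
  have m: "(deriv ^^ k) f \<in> borel_measurable borel" using assms by (intro smooth_measurable quad_decay_smooth)
  have "integrable lborel (\<lambda>x. ((deriv ^^ k) f x)\<^sup>2)"
  proof (rule Bochner_Integration.integrable_bound)
    show "integrable lborel (\<lambda>x. C\<^sup>2 * (1 / (1 + x\<^sup>2)))"
      by (intro integrable_mult_right integrable_inverse_1_plus_sq)
    show "AE x in lborel. norm (((deriv ^^ k) f x)\<^sup>2) \<le> norm (C\<^sup>2 * (1 / (1 + x\<^sup>2)))"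
      using sq_le_of_bound[OF C(2)] by (intro AE_I2) simp
  qed (use m in auto)
  thus ?thesis using m by (simp add: L2_def)
qed

lemma quad_decay_sobolev: "quad_decay f \<Longrightarrow> f \<in> sobolev m"
  unfolding sobolev_def
  using quad_decay_L2[of f 0] quad_decay_L2[of f] smooth_weak_derivative[OF quad_decay_smooth, of f] by auto

text \<open>The weak derivative chosen in \<open>sobolev_norm\<close> agrees with the classical one almost everywhere.\<close>

lemma quad_decay_sobolev_norm:
  assumes "quad_decay f"
  shows "sobolev_norm m f = sqrt (\<Sum>k\<le>m. LINT x|lborel. ((deriv ^^ k) f x)\<^sup>2)"
proof -
  have "(LINT x|lborel. ((SOME g. g \<in> L2 \<and> weak_derivative k f g) x)\<^sup>2) = (LINT x|lborel. ((deriv ^^ k) f x)\<^sup>2)" for k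
  proof -
    define g where "g = (SOME g. g \<in> L2 \<and> weak_derivative k f g)"
    have r: "(deriv ^^ k) f \<in> L2 \<and> weak_derivative k f ((deriv ^^ k) f)"
      using quad_decay_L2[OF assms] smooth_weak_derivative[OF quad_decay_smooth[OF assms]] by blast
    hence g: "g \<in> L2 \<and> weak_derivative k f g" unfolding g_def
      by (rule someI[of "\<lambda>g. g \<in> L2 \<and> weak_derivative k f g"])
    have "AE x in lborel. g x = (deriv ^^ k) f x"
      using weak_derivative_unique r g by blast
    hence "AE x in lborel. (g x)\<^sup>2 = ((deriv ^^ k) f x)\<^sup>2" by eventually_elim simp
    moreover have "(\<lambda>x. (g x)\<^sup>2) \<in> borel_measurable lborel" "(\<lambda>x. ((deriv ^^ k) f x)\<^sup>2) \<in> borel_measurable lborel"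
      using r g by (auto simp: L2_def)
    ultimately show ?thesis unfolding g_def[symmetric] by (rule integral_cong_AE[rotated 2])
  qed
  thus ?thesis by (simp add: sobolev_norm_def)
qed

lemma sobolev_dual_add: "l \<in> sobolev_dual m \<Longrightarrow> quad_decay f \<Longrightarrow> quad_decay g \<Longrightarrow> l (\<lambda>x. f x + g x) = l f + l g"
  by (simp add: sobolev_dual_def quad_decay_sobolev)

lemma sobolev_dual_cmult: "l \<in> sobolev_dual m \<Longrightarrow> quad_decay f \<Longrightarrow> l (\<lambda>x. b * f x) = b * l f"
  by (simp add: sobolev_dual_def quad_decay_sobolev)

lemma sobolev_norm_nonneg: "sobolev_norm m f \<ge> 0"
  by (auto simp: sobolev_norm_def intro!: sum_nonneg)

lemma sobolev_norm_cmult: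
  assumes "quad_decay f" shows "sobolev_norm m (\<lambda>x. b * f x) = \<bar>b\<bar> * sobolev_norm m f"
proof -
  have "(\<Sum>k\<le>m. LINT x|lborel. (b * (deriv ^^ k) f x)\<^sup>2) = b\<^sup>2 * (\<Sum>k\<le>m. LINT x|lborel. ((deriv ^^ k) f x)\<^sup>2)"
    by (simp add: power_mult_distrib sum_distrib_left)
  thus ?thesis
    using assms by (simp add: quad_decay_sobolev_norm quad_decay_cmult funpow_deriv_cmult quad_decay_smooth real_sqrt_mult)
qed

lemma sobolev_dual_bound:
  assumes l: "l \<in> sobolev_dual m" and f: "quad_decay f"
  shows "\<bar>l f\<bar> \<le> sobolev_dual_norm m l * sobolev_norm m f"
proof -
  obtain C where C: "\<And>f. f \<in> sobolev m \<Longrightarrow> \<bar>l f\<bar> \<le> C * sobolev_norm m f"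
    using l unfolding sobolev_dual_def by blast
  show ?thesis
  proof (cases "sobolev_norm m f = 0")
    case True
    thus ?thesis using C[OF quad_decay_sobolev[OF f]] by simp
  next
    case False
    define N where "N = sobolev_norm m f"
    have N: "N > 0" using False sobolev_norm_nonneg[of m f] by (simp add: N_def)
    have bdd: "bdd_above ((\<lambda>f. \<bar>l f\<bar>) ` {f \<in> sobolev m. sobolev_norm m f \<le> 1})"
    proof (rule bdd_aboveI2)
      fix f assume f: "f \<in> {f \<in> sobolev m. sobolev_norm m f \<le> 1}"
      have "\<bar>l f\<bar> \<le> C * sobolev_norm m f" using C f by auto
      also have "\<dots> \<le> \<bar>C\<bar> * 1" using f sobolev_norm_nonneg[of m f] by (intro mult_mono) auto
      finally show "\<bar>l f\<bar> \<le> \<bar>C\<bar>" by simp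
    qed
    have "\<bar>l (\<lambda>x. (1 / N) * f x)\<bar> \<le> sobolev_dual_norm m l"
      unfolding sobolev_dual_norm_def
    proof (rule cSUP_upper[OF _ bdd])
      show "(\<lambda>x. (1 / N) * f x) \<in> {f \<in> sobolev m. sobolev_norm m f \<le> 1}"
      proof -
        have "sobolev_norm m (\<lambda>x. (1 / N) * f x) \<le> 1"
          unfolding sobolev_norm_cmult[OF f] N_def[symmetric] using N by simp
        thus ?thesis using quad_decay_sobolev[OF quad_decay_cmult[OF f]] by blast
      qed
    qed
    thus ?thesis unfolding sobolev_dual_cmult[OF l f] using N
      by (simp add: abs_mult N_def[symmetric] field_simps)
  qed
qed

text \<open>The squares of the derivatives of \<open>f n - g\<close> are dominated by a multiple of \<open>1 / (1 + x\<^sup>2)\<close>, so that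
  convergence in the Sobolev norm follows from pointwise convergence.\<close>

lemma sobolev_dual_tendsto:
  assumes l: "l \<in> sobolev_dual m" and f: "\<And>n. quad_decay (f n)" and g: "quad_decay g"
    and lim: "\<And>k x. (\<lambda>n. (deriv ^^ k) (f n) x) \<longlonglongrightarrow> (deriv ^^ k) g x"
    and dom: "\<And>k. \<exists>C. \<forall>n x. \<bar>(deriv ^^ k) (f n) x\<bar> \<le> C / (1 + x\<^sup>2)"
  shows "(\<lambda>n. l (f n)) \<longlonglongrightarrow> l g"
    and "\<exists>B. \<forall>n. sobolev_norm m (f n) \<le> B"
proof -
  define h where "h n = (\<lambda>x. f n x + (-1) * g x)" for n
  have h: "quad_decay (h n)" for n unfolding h_def by (intro quad_decay_add quad_decay_cmult f g)
  have hd: "(deriv ^^ k) (h n) = (\<lambda>x. (deriv ^^ k) (f n) x - (deriv ^^ k) g x)" for k n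
    unfolding h_def funpow_deriv_plus[OF quad_decay_smooth[OF f] quad_decay_smooth[OF quad_decay_cmult[OF g]]]
      funpow_deriv_cmult[OF quad_decay_smooth[OF g]] by simp
  have conv: "(\<lambda>n. LINT x|lborel. ((deriv ^^ k) (h n) x)\<^sup>2) \<longlonglongrightarrow> (LINT x|(lborel::real measure). 0)" for k
  proof -
    obtain C where C: "\<And>n x. \<bar>(deriv ^^ k) (f n) x\<bar> \<le> C / (1 + x\<^sup>2)" using dom by metis
    obtain D where D: "\<And>x. \<bar>(deriv ^^ k) g x\<bar> \<le> D / (1 + x\<^sup>2)" using quad_decay_bound[OF g] by metis
    have B: "\<bar>(deriv ^^ k) (h n) x\<bar> \<le> (C + D) / (1 + x\<^sup>2)" for n x
      using C[of n x] D[of x] by (simp add: hd add_divide_distrib)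
    show ?thesis
    proof (rule integral_dominated_convergence)
      show "integrable lborel (\<lambda>x. (C + D)\<^sup>2 * (1 / (1 + x\<^sup>2)))"
        by (intro integrable_mult_right integrable_inverse_1_plus_sq)
      show "AE x in lborel. norm (((deriv ^^ k) (h n) x)\<^sup>2) \<le> (C + D)\<^sup>2 * (1 / (1 + x\<^sup>2))" for n
        using sq_le_of_bound[OF B[of n]] by (intro AE_I2) simp
      show "(\<lambda>x. ((deriv ^^ k) (h n) x)\<^sup>2) \<in> borel_measurable lborel" for n
        using smooth_measurable[OF quad_decay_smooth[OF h]] by auto
      show "AE x in lborel. (\<lambda>n. ((deriv ^^ k) (h n) x)\<^sup>2) \<longlonglongrightarrow> 0"
      proof (rule AE_I2)
        fix x
        have "(\<lambda>n. ((deriv ^^ k) (f n) x - (deriv ^^ k) g x)\<^sup>2) \<longlonglongrightarrow> ((deriv ^^ k) g x - (deriv ^^ k) g x)\<^sup>2"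
          by (intro tendsto_intros lim)
        thus "(\<lambda>n. ((deriv ^^ k) (h n) x)\<^sup>2) \<longlonglongrightarrow> 0" by (simp add: hd)
      qed
    qed auto
  qed
  have "(\<lambda>n. sqrt (\<Sum>k\<le>m. LINT x|lborel. ((deriv ^^ k) (h n) x)\<^sup>2)) \<longlonglongrightarrow> sqrt (\<Sum>k\<le>m. (LINT x|(lborel::real measure). 0))"
    by (intro tendsto_intros conv)
  hence "(\<lambda>n. sobolev_norm m (h n)) \<longlonglongrightarrow> 0" by (simp add: quad_decay_sobolev_norm[OF h])
  hence "(\<lambda>n. sobolev_dual_norm m l * sobolev_norm m (h n)) \<longlonglongrightarrow> 0" by (rule tendsto_mult_right_zero)
  hence "(\<lambda>n. l (h n)) \<longlonglongrightarrow> 0"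
    by (rule Lim_null_comparison[rotated]) (use sobolev_dual_bound[OF l h] in \<open>auto intro!: always_eventually\<close>)
  hence "(\<lambda>n. l (h n) + l g) \<longlonglongrightarrow> 0 + l g" by (intro tendsto_add tendsto_const)
  moreover have "l (h n) = l (f n) - l g" for n
    unfolding h_def using sobolev_dual_add[OF l f quad_decay_cmult[OF g], of n "-1"] sobolev_dual_cmult[OF l g, of "-1"] by simp
  ultimately show "(\<lambda>n. l (f n)) \<longlonglongrightarrow> l g" by simp
  have "\<forall>k. \<exists>C. \<forall>n. (LINT x|lborel. ((deriv ^^ k) (f n) x)\<^sup>2) \<le> C"
  proof
    fix k
    obtain C where C: "\<And>n x. \<bar>(deriv ^^ k) (f n) x\<bar> \<le> C / (1 + x\<^sup>2)" using dom by metis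
    have "(LINT x|lborel. ((deriv ^^ k) (f n) x)\<^sup>2) \<le> (LINT x|lborel. C\<^sup>2 * (1 / (1 + x\<^sup>2)))" for n
    proof (rule integral_mono)
      show "integrable lborel (\<lambda>x. ((deriv ^^ k) (f n) x)\<^sup>2)" using quad_decay_L2[OF f] by (simp add: L2_def)
      show "integrable lborel (\<lambda>x. C\<^sup>2 * (1 / (1 + x\<^sup>2)))"
        by (intro integrable_mult_right integrable_inverse_1_plus_sq)
      show "((deriv ^^ k) (f n) x)\<^sup>2 \<le> C\<^sup>2 * (1 / (1 + x\<^sup>2))" for x
        using sq_le_of_bound[OF C[of n x]] by simp
    qed
    thus "\<exists>C. \<forall>n. (LINT x|lborel. ((deriv ^^ k) (f n) x)\<^sup>2) \<le> C" by blast
  qed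
  then obtain C where "\<And>k n. (LINT x|lborel. ((deriv ^^ k) (f n) x)\<^sup>2) \<le> C k" by metis
  hence "sobolev_norm m (f n) \<le> sqrt (\<Sum>k\<le>m. C k)" for n
    unfolding quad_decay_sobolev_norm[OF f] by (intro real_sqrt_le_mono sum_mono) auto
  thus "\<exists>B. \<forall>n. sobolev_norm m (f n) \<le> B" by blast
qed

lemma quad_decay_sobolev_norm_le:
  assumes "quad_decay f" "C \<ge> 0" "\<And>k x. k \<le> m \<Longrightarrow> \<bar>(deriv ^^ k) f x\<bar> \<le> C / (1 + x\<^sup>2)"
  shows "sobolev_norm m f \<le> C * sqrt (real (Suc m) * (LINT x|lborel. 1 / (1 + x\<^sup>2)))"
proof -
  have "(LINT x|lborel. ((deriv ^^ k) f x)\<^sup>2) \<le> (LINT x|lborel. C\<^sup>2 * (1 / (1 + x\<^sup>2)))" if "k \<le> m" for k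
  proof (rule integral_mono)
    show "integrable lborel (\<lambda>x. ((deriv ^^ k) f x)\<^sup>2)" using quad_decay_L2[OF assms(1)] by (simp add: L2_def)
    show "integrable lborel (\<lambda>x. C\<^sup>2 * (1 / (1 + x\<^sup>2)))"
      by (intro integrable_mult_right integrable_inverse_1_plus_sq)
    show "((deriv ^^ k) f x)\<^sup>2 \<le> C\<^sup>2 * (1 / (1 + x\<^sup>2))" for x
      using sq_le_of_bound[OF assms(3)[OF that]] by simp
  qed
  hence "sobolev_norm m f \<le> sqrt (\<Sum>k\<le>m. (LINT x|lborel. C\<^sup>2 * (1 / (1 + x\<^sup>2))))"
    unfolding quad_decay_sobolev_norm[OF assms(1)] by (intro real_sqrt_le_mono sum_mono) auto
  also have "\<dots> = sqrt (C\<^sup>2 * (real (Suc m) * (LINT x|lborel. 1 / (1 + x\<^sup>2))))"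
    unfolding integral_mult_right_zero by (simp add: mult_ac)
  also have "\<dots> = C * sqrt (real (Suc m) * (LINT x|lborel. 1 / (1 + x\<^sup>2)))"
    using assms(2) by (simp add: real_sqrt_mult)
  finally show ?thesis .
qed

section \<open>Band-limited kernels\<close>

lemma integral_Icc_lborel:
  fixes f :: "real \<Rightarrow> real"
  assumes "continuous_on {a..b} f"
  shows "integrable lborel (\<lambda>x. indicator {a..b} x * f x)"
    and "integral {a..b} f = (LINT x|lborel. indicator {a..b} x * f x)"
proof -
  have s: "set_integrable lborel {a..b} f"
    unfolding set_integrable_def by (rule borel_integrable_compact[OF compact_Icc assms])
  thus "integrable lborel (\<lambda>x. indicator {a..b} x * f x)" by (simp add: set_integrable_def)
  show "integral {a..b} f = (LINT x|lborel. indicator {a..b} x * f x)"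
    using set_borel_integral_eq_integral(2)[OF s] by (simp add: set_lebesgue_integral_def)
qed

text \<open>The product of two such functions has the bound \<open>4 * (M * N)\<close>, hence bounds of powers grow only
  geometrically in the exponent. This is what the iteration of the integral equation requires.\<close>

definition C2_bound :: "real \<Rightarrow> (real \<Rightarrow> real) \<Rightarrow> bool" where
  "C2_bound M q \<longleftrightarrow> (\<exists>q' q''. \<forall>s\<in>{0..1}. (q has_real_derivative q' s) (at s) \<and>
     (q' has_real_derivative q'' s) (at s) \<and> \<bar>q s\<bar> \<le> M \<and> \<bar>q' s\<bar> \<le> M \<and> \<bar>q'' s\<bar> \<le> M)"

lemma C2_bound_nonneg: "C2_bound M q \<Longrightarrow> M \<ge> 0"
  unfolding C2_bound_def by (meson abs_ge_zero atLeastAtMost_iff order.refl order_trans zero_le_one)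

lemma C2_bound_mult:
  assumes "C2_bound M q" "C2_bound N r"
  shows "C2_bound (4 * (M * N)) (\<lambda>s. q s * r s)"
proof -
  have M: "M \<ge> 0" "N \<ge> 0" using assms C2_bound_nonneg by auto
  obtain q' q'' where q: "\<And>s. s \<in> {0..1} \<Longrightarrow> (q has_real_derivative q' s) (at s) \<and>
     (q' has_real_derivative q'' s) (at s) \<and> \<bar>q s\<bar> \<le> M \<and> \<bar>q' s\<bar> \<le> M \<and> \<bar>q'' s\<bar> \<le> M"
    using assms(1) unfolding C2_bound_def by blast
  obtain r' r'' where r: "\<And>s. s \<in> {0..1} \<Longrightarrow> (r has_real_derivative r' s) (at s) \<and>
     (r' has_real_derivative r'' s) (at s) \<and> \<bar>r s\<bar> \<le> N \<and> \<bar>r' s\<bar> \<le> N \<and> \<bar>r'' s\<bar> \<le> N"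
    using assms(2) unfolding C2_bound_def by blast
  show ?thesis unfolding C2_bound_def
  proof (intro exI ballI conjI)
    fix s :: real assume s: "s \<in> {0..1}"
    note q = q[OF s] and r = r[OF s]
    have p: "\<bar>x * y\<bar> \<le> M * N" if "\<bar>x\<bar> \<le> M" "\<bar>y\<bar> \<le> N" for x y
      unfolding abs_mult by (intro mult_mono that M) auto
    have MN: "M * N \<ge> 0" using M by simp
    show "((\<lambda>s. q s * r s) has_real_derivative (q' s * r s + q s * r' s)) (at s)"
      using q r by (auto intro!: derivative_eq_intros)
    show "((\<lambda>s. q' s * r s + q s * r' s) has_real_derivative (q'' s * r s + 2 * (q' s * r' s) + q s * r'' s)) (at s)"
      using q r by (auto intro!: derivative_eq_intros simp: algebra_simps)
    have "\<bar>q s * r s\<bar> \<le> M * N" "\<bar>q' s * r s\<bar> \<le> M * N" "\<bar>q s * r' s\<bar> \<le> M * N" "\<bar>q'' s * r s\<bar> \<le> M * N"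
      "\<bar>q' s * r' s\<bar> \<le> M * N" "\<bar>q s * r'' s\<bar> \<le> M * N"
      using q r by (auto intro!: p)
    thus "\<bar>q s * r s\<bar> \<le> 4 * (M * N)" "\<bar>q' s * r s + q s * r' s\<bar> \<le> 4 * (M * N)"
      "\<bar>q'' s * r s + 2 * (q' s * r' s) + q s * r'' s\<bar> \<le> 4 * (M * N)"
      using MN by linarith+
  qed
qed

lemma C2_bound_power:
  assumes "C2_bound M q" "C2_bound N r"
  shows "C2_bound ((4 * M) ^ n * N) (\<lambda>s. r s * q s ^ n)"
proof (induction n)
  case (Suc n)
  have "C2_bound (4 * ((4 * M) ^ n * N * M)) (\<lambda>s. r s * q s ^ n * q s)"
    by (rule C2_bound_mult[OF Suc assms(1)])
  thus ?case by (simp add: mult_ac)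
qed (use assms in simp)

lemma C2_bound_quadratic: "C2_bound (\<bar>b0\<bar> + \<bar>b1\<bar> + 2 * \<bar>b2\<bar>) (\<lambda>s. b0 + b1 * s + b2 * s\<^sup>2)"
  unfolding C2_bound_def
proof (intro exI ballI conjI)
  fix s :: real assume s: "s \<in> {0..1}"
  have m: "\<bar>b * s\<bar> \<le> \<bar>b\<bar>" for b using s by (simp add: abs_mult mult_left_le)
  have m2: "\<bar>b * s\<^sup>2\<bar> \<le> \<bar>b\<bar>" for b
    using m[of "b * s"] m[of b] by (simp add: power2_eq_square mult.assoc)
  show "((\<lambda>s. b0 + b1 * s + b2 * s\<^sup>2) has_real_derivative (b1 + 2 * (b2 * s))) (at s)"
    by (auto intro!: derivative_eq_intros)
  show "((\<lambda>s. b1 + 2 * (b2 * s)) has_real_derivative (2 * b2)) (at s)"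
    by (auto intro!: derivative_eq_intros)
  show "\<bar>b0 + b1 * s + b2 * s\<^sup>2\<bar> \<le> \<bar>b0\<bar> + \<bar>b1\<bar> + 2 * \<bar>b2\<bar>" using m[of b1] m2[of b2] by linarith
  show "\<bar>b1 + 2 * (b2 * s)\<bar> \<le> \<bar>b0\<bar> + \<bar>b1\<bar> + 2 * \<bar>b2\<bar>" using m[of b2] by linarith
  show "\<bar>2 * b2\<bar> \<le> \<bar>b0\<bar> + \<bar>b1\<bar> + 2 * \<bar>b2\<bar>" by linarith
qed

text \<open>Two integrations by parts; the boundary terms of the first one vanish by assumption. They are done in
  one step with the primitive \<open>\<Phi>\<close>.\<close>

lemma oscillatory_integral_bound:
  assumes q: "C2_bound M q" and bd: "q 1 = 0" "q 0 * sin \<theta> = 0"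
  shows "\<bar>integral {0..1} (\<lambda>s. q s * cos (z * s + \<theta>))\<bar> \<le> 6 * M / (1 + z\<^sup>2)"
proof -
  have M: "M \<ge> 0" using q by (rule C2_bound_nonneg)
  obtain q' q'' where q: "\<And>s. s \<in> {0..1} \<Longrightarrow> (q has_real_derivative q' s) (at s) \<and>
     (q' has_real_derivative q'' s) (at s) \<and> \<bar>q s\<bar> \<le> M \<and> \<bar>q' s\<bar> \<le> M \<and> \<bar>q'' s\<bar> \<le> M"
    using q unfolding C2_bound_def by blast
  have qc: "continuous_on {0..1} q"
    by (rule DERIV_continuous_on[of _ _ q']) (use q has_field_derivative_at_within in blast)
  have int: "((\<lambda>s. q s * cos (z * s + \<theta>)) has_integral integral {0..1} (\<lambda>s. q s * cos (z * s + \<theta>))) {0..1}"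
    by (intro integrable_integral integrable_continuous_real continuous_intros qc)
  have pm: "\<bar>x * y\<bar> \<le> M" if "\<bar>x\<bar> \<le> M" "\<bar>y\<bar> \<le> 1" for x y :: real
    using mult_mono[OF that] M by (simp add: abs_mult)
  show ?thesis
  proof (cases "\<bar>z\<bar> \<le> 1")
    case True
    have "norm (integral {0..1} (\<lambda>s. q s * cos (z * s + \<theta>))) \<le> M * measure lborel (cbox 0 (1::real))"
      by (rule has_integral_bound[OF M]) (use int q pm in \<open>auto simp: cbox_interval\<close>)
    hence "\<bar>integral {0..1} (\<lambda>s. q s * cos (z * s + \<theta>))\<bar> \<le> M" by simp
    moreover have "z\<^sup>2 \<le> 1" using True by (simp add: abs_square_le_1)
    hence "M * (1 + z\<^sup>2) \<le> M * 6" using M by (intro mult_left_mono) auto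
    hence "M \<le> 6 * M / (1 + z\<^sup>2)" using one_plus_sq_pos[of z] by (simp add: field_simps)
    ultimately show ?thesis by linarith
  next
    case False
    hence z: "z \<noteq> 0" "z\<^sup>2 \<ge> 1" using abs_le_square_iff[of 1 z] by auto
    define \<Phi> where "\<Phi> s = q s * sin (z * s + \<theta>) / z + q' s * cos (z * s + \<theta>) / z\<^sup>2" for s
    have "((\<lambda>s. q s * cos (z * s + \<theta>) + q'' s * cos (z * s + \<theta>) / z\<^sup>2) has_integral \<Phi> 1 - \<Phi> 0) {0..1}"
    proof (rule fundamental_theorem_of_calculus)
      fix s :: real assume s: "s \<in> {0..1}"
      have "(\<Phi> has_real_derivative q s * cos (z * s + \<theta>) + q'' s * cos (z * s + \<theta>) / z\<^sup>2) (at s)"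
        unfolding \<Phi>_def using q[OF s] z
        by (auto intro!: derivative_eq_intros simp: field_simps power2_eq_square)
      thus "(\<Phi> has_vector_derivative q s * cos (z * s + \<theta>) + q'' s * cos (z * s + \<theta>) / z\<^sup>2) (at s within {0..1})"
        by (simp add: has_real_derivative_iff_has_vector_derivative has_vector_derivative_at_within)
    qed simp
    from has_integral_diff[OF this int]
    have h: "((\<lambda>s. q'' s * cos (z * s + \<theta>) / z\<^sup>2) has_integral
       \<Phi> 1 - \<Phi> 0 - integral {0..1} (\<lambda>s. q s * cos (z * s + \<theta>))) {0..1}" by simp
    have "norm (\<Phi> 1 - \<Phi> 0 - integral {0..1} (\<lambda>s. q s * cos (z * s + \<theta>))) \<le> (M / z\<^sup>2) * measure lborel (cbox 0 (1::real))"
    proof (rule has_integral_bound)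
      fix s :: real assume "s \<in> cbox 0 1"
      hence "\<bar>q'' s * cos (z * s + \<theta>)\<bar> \<le> M" using q[of s] by (intro pm) (auto simp: cbox_interval)
      thus "norm (q'' s * cos (z * s + \<theta>) / z\<^sup>2) \<le> M / z\<^sup>2"
        by (simp add: abs_mult divide_right_mono)
    qed (use h M in \<open>auto simp: cbox_interval\<close>)
    moreover have "\<bar>\<Phi> 1\<bar> \<le> M / z\<^sup>2"
    proof -
      have "\<bar>q' 1 * cos (z * 1 + \<theta>)\<bar> \<le> M" using q[of 1] by (intro pm) auto
      thus ?thesis using bd by (simp add: \<Phi>_def divide_right_mono)
    qed
    moreover have "\<bar>\<Phi> 0\<bar> \<le> M / z\<^sup>2"
    proof -
      have "\<bar>q' 0 * cos \<theta>\<bar> \<le> M" using q[of 0] by (intro pm) auto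
      moreover have "\<Phi> 0 = q' 0 * cos \<theta> / z\<^sup>2" using bd(2) by (simp add: \<Phi>_def)
      ultimately show ?thesis by (simp add: divide_right_mono)
    qed
    ultimately have "\<bar>integral {0..1} (\<lambda>s. q s * cos (z * s + \<theta>))\<bar> \<le> 3 * (M / z\<^sup>2)" by simp
    also have "3 * (M / z\<^sup>2) \<le> 6 * M / (1 + z\<^sup>2)"
    proof -
      have "M * (1 + z\<^sup>2) \<le> M * (2 * z\<^sup>2)" using M z by (intro mult_left_mono) auto
      thus ?thesis using one_plus_sq_pos[of z] z by (simp add: field_simps)
    qed
    finally show ?thesis .
  qed
qed

text \<open>\<open>band_kernel \<omega> a d n\<close> is \<open>(d \<partial>\<^sup>2 + a)\<^sup>n\<close> applied to the Fejer kernel of band width \<open>\<omega>\<close>, and \<open>j\<close> counts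
  further derivatives. Differentiation shifts the phase of the cosine by \<open>pi / 2\<close>, so that one formula covers
  even and odd \<open>j\<close>.\<close>

definition band_symbol :: "real \<Rightarrow> real \<Rightarrow> real \<Rightarrow> nat \<Rightarrow> nat \<Rightarrow> real \<Rightarrow> real" where
  "band_symbol \<omega> a d n j s = (1 - s) * (\<omega> * s) ^ j * (a - d * (\<omega> * s)\<^sup>2) ^ n"

definition band_kernel :: "real \<Rightarrow> real \<Rightarrow> real \<Rightarrow> nat \<Rightarrow> nat \<Rightarrow> real \<Rightarrow> real" where
  "band_kernel \<omega> a d n j x =
     \<omega> * integral {0..1} (\<lambda>s. band_symbol \<omega> a d n j s * cos (\<omega> * x * s + real j * (pi / 2)))"

lemma band_symbol_continuous: "continuous_on A (band_symbol \<omega> a d n j)"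
  unfolding band_symbol_def by (intro continuous_intros)

lemma band_kernel_derivative:
  "(band_kernel \<omega> a d n j has_real_derivative band_kernel \<omega> a d n (Suc j) x) (at x)"
proof -
  define f where "f x s = band_symbol \<omega> a d n j s * cos (\<omega> * x * s + real j * (pi / 2))" for x s
  define f' where "f' x s = band_symbol \<omega> a d n (Suc j) s * cos (\<omega> * x * s + real (Suc j) * (pi / 2))" for x s
  have "((\<lambda>x. integral (cbox 0 1) (f x)) has_real_derivative integral (cbox 0 1) (f' x)) (at x within UNIV)"
  proof (rule leibniz_rule_field_derivative)
    fix x s :: real
    have c: "cos (\<omega> * x * s + real (Suc j) * (pi / 2)) = - sin (\<omega> * x * s + real j * (pi / 2))"
    proof -
      have e: "\<omega> * x * s + real (Suc j) * (pi / 2) = (\<omega> * x * s + real j * (pi / 2)) + pi / 2"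
        by (simp add: field_simps)
      show ?thesis unfolding e cos_add[of _ "pi / 2"] by simp
    qed
    show "((\<lambda>x. f x s) has_real_derivative f' x s) (at x within UNIV)"
      unfolding f_def f'_def c
      by (auto intro!: derivative_eq_intros simp: band_symbol_def)
    show "f x integrable_on cbox 0 1" unfolding f_def
      by (intro integrable_continuous continuous_intros band_symbol_continuous)
  next
    show "continuous_on (UNIV \<times> cbox 0 1) (\<lambda>(x, s). f' x s)"
      unfolding f'_def band_symbol_def split_beta by (intro continuous_intros)
  qed auto
  thus ?thesis unfolding band_kernel_def[abs_def] f_def f'_def cbox_interval
    by (intro DERIV_cmult) simp
qed

lemma funpow_deriv_band_kernel: "(deriv ^^ j) (band_kernel \<omega> a d n 0) = band_kernel \<omega> a d n j"
  and smooth_band_kernel: "smooth (band_kernel \<omega> a d n 0)"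
  using derivative_sequence[of "band_kernel \<omega> a d n", OF band_kernel_derivative] by auto

lemma band_kernel_operator:
  "d * band_kernel \<omega> a d n 2 x + a * band_kernel \<omega> a d n 0 x = band_kernel \<omega> a d (Suc n) 0 x"
proof -
  define f where "f j s = band_symbol \<omega> a d n j s * cos (\<omega> * x * s + real j * (pi / 2))" for j s
  have f: "f j integrable_on {0..1}" for j unfolding f_def
    by (intro integrable_continuous_real continuous_intros band_symbol_continuous)
  have "d * integral {0..1} (f 2) + a * integral {0..1} (f 0) = integral {0..1} (\<lambda>s. d * f 2 s + a * f 0 s)"
    using f[of 0] f[of 2] by (subst Henstock_Kurzweil_Integration.integral_add) (auto intro!: integrable_on_mult_right)
  also have "(\<lambda>s. d * f 2 s + a * f 0 s) =
      (\<lambda>s. band_symbol \<omega> a d (Suc n) 0 s * cos (\<omega> * x * s + real 0 * (pi / 2)))"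
    by (auto simp: fun_eq_iff f_def band_symbol_def algebra_simps)
  finally show ?thesis by (simp add: band_kernel_def f_def algebra_simps)
qed

text \<open>The bound is geometric in \<open>n\<close> because the frequencies are bounded. No nonzero test function has this property:
  a function of compact support is not analytic, and its derivatives grow too fast for the iteration
  of the integral equation.\<close>

lemma band_kernel_bound:
  assumes \<omega>: "\<omega> > 0"
  obtains B A where "B \<ge> 0" "\<And>j. A j \<ge> 0" "\<And>n j x. \<bar>band_kernel \<omega> a d n j x\<bar> \<le> A j * B ^ n / (1 + x\<^sup>2)"
proof -
  define B where "B = \<bar>a\<bar> + 2 * \<bar>- d * \<omega>\<^sup>2\<bar>"
  have B: "C2_bound B (\<lambda>s. a - d * (\<omega> * s)\<^sup>2)"
    using C2_bound_quadratic[of a 0 "- d * \<omega>\<^sup>2"] by (simp add: B_def power_mult_distrib mult.assoc)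
  have C: "\<exists>C. C2_bound C (\<lambda>s. (1 - s) * (\<omega> * s) ^ j)" for j
  proof -
    have "C2_bound 2 (\<lambda>s. 1 - s)" using C2_bound_quadratic[of 1 "-1" 0] by simp
    moreover have "C2_bound \<bar>\<omega>\<bar> (\<lambda>s. \<omega> * s)" using C2_bound_quadratic[of 0 \<omega> 0] by simp
    ultimately show ?thesis using C2_bound_power by blast
  qed
  then obtain C where C: "\<And>j. C2_bound (C j) (\<lambda>s. (1 - s) * (\<omega> * s) ^ j)" by metis
  have C0: "C j \<ge> 0" for j using C by (rule C2_bound_nonneg)
  have B0: "B \<ge> 0" using B by (rule C2_bound_nonneg)
  show ?thesis
  proof (rule that[of "4 * B" "\<lambda>j. \<omega> * (6 * C j) * (1 + 1 / \<omega>\<^sup>2)"])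
    fix n j x
    have "\<bar>integral {0..1} (\<lambda>s. band_symbol \<omega> a d n j s * cos (\<omega> * x * s + real j * (pi / 2)))\<bar>
          \<le> 6 * ((4 * B) ^ n * C j) / (1 + (\<omega> * x)\<^sup>2)"
    proof (rule oscillatory_integral_bound)
      show "C2_bound ((4 * B) ^ n * C j) (band_symbol \<omega> a d n j)"
        unfolding band_symbol_def[abs_def] by (rule C2_bound_power[OF B C])
      show "band_symbol \<omega> a d n j 0 * sin (real j * (pi / 2)) = 0" by (cases j) (auto simp: band_symbol_def)
    qed (simp add: band_symbol_def)
    hence "\<bar>band_kernel \<omega> a d n j x\<bar> \<le> \<omega> * (6 * ((4 * B) ^ n * C j) / (1 + (\<omega> * x)\<^sup>2))"
      unfolding band_kernel_def abs_mult abs_of_pos[OF \<omega>] using \<omega> by (intro mult_left_mono) auto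
    also have "\<dots> = \<omega> * (6 * C j) * (4 * B) ^ n * (1 / (1 + (\<omega> * x)\<^sup>2))" by (simp add: mult_ac)
    also have "\<dots> \<le> \<omega> * (6 * C j) * (4 * B) ^ n * ((1 + 1 / \<omega>\<^sup>2) / (1 + x\<^sup>2))"
    proof (rule mult_left_mono)
      have "1 + x\<^sup>2 \<le> (1 + 1 / \<omega>\<^sup>2) * (1 + (\<omega> * x)\<^sup>2)"
        using \<omega> by (simp add: algebra_simps power_mult_distrib)
      thus "1 / (1 + (\<omega> * x)\<^sup>2) \<le> (1 + 1 / \<omega>\<^sup>2) / (1 + x\<^sup>2)"
        using one_plus_sq_pos[of x] one_plus_sq_pos[of "\<omega> * x"] by (simp add: field_simps)
    qed (use \<omega> B0 C0[of j] in auto)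
    also have "\<dots> = \<omega> * (6 * C j) * (1 + 1 / \<omega>\<^sup>2) * (4 * B) ^ n / (1 + x\<^sup>2)"
      by (simp only: times_divide_eq_right mult_ac)
    finally show "\<bar>band_kernel \<omega> a d n j x\<bar> \<le> \<omega> * (6 * C j) * (1 + 1 / \<omega>\<^sup>2) * (4 * B) ^ n / (1 + x\<^sup>2)" .
  qed (use \<omega> B0 C0 in auto)
qed

lemma band_kernel_quad_decay:
  assumes "\<omega> > 0" shows "quad_decay (band_kernel \<omega> a d n 0)"
proof -
  obtain A B where "B \<ge> 0" "\<And>j. A j \<ge> 0" "\<And>n j x. \<bar>band_kernel \<omega> a d n j x\<bar> \<le> A j * B ^ n / (1 + x\<^sup>2)"
    using band_kernel_bound[OF assms, of a d] by metis
  thus ?thesis unfolding quad_decay_def funpow_deriv_band_kernel using smooth_band_kernel by blast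
qed

definition fejer :: "real \<Rightarrow> real" where
  "fejer z = integral {0..1} (\<lambda>s. (1 - s) * cos (z * s))"

lemma band_kernel_fejer: "band_kernel \<omega> a d 0 0 x = \<omega> * fejer (\<omega> * x)"
  by (simp add: band_kernel_def fejer_def band_symbol_def)

lemma fejer_0: "fejer 0 = 1 / 2"
proof -
  have "((\<lambda>s::real. 1 - s) has_integral (1 - 1\<^sup>2 / 2) - (0 - 0\<^sup>2 / 2)) {0..1}"
    by (rule fundamental_theorem_of_calculus)
       (auto intro!: derivative_eq_intros simp flip: has_real_derivative_iff_has_vector_derivative)
  thus ?thesis by (simp add: fejer_def integral_unique)
qed

text \<open>Explicitly, \<open>fejer z = (1 - cos z) / z\<^sup>2\<close> for \<open>z \<noteq> 0\<close>.\<close>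

lemma fejer_nonneg: "fejer z \<ge> 0"
proof (cases "z = 0")
  case False
  define \<Phi> where "\<Phi> s = (1 - s) * sin (z * s) / z - cos (z * s) / z\<^sup>2" for s
  have "((\<lambda>s. (1 - s) * cos (z * s)) has_integral \<Phi> 1 - \<Phi> 0) {0..1}"
    unfolding \<Phi>_def
    by (rule fundamental_theorem_of_calculus)
       (use False in \<open>auto intro!: derivative_eq_intros simp: field_simps power2_eq_square simp flip: has_real_derivative_iff_has_vector_derivative\<close>)
  hence "fejer z = (1 - cos z) / z\<^sup>2"
    unfolding fejer_def by (subst integral_unique) (auto simp: \<Phi>_def diff_divide_distrib)
  thus ?thesis by simp
qed (simp add: fejer_0)

lemma fejer_le: "fejer z \<le> 12 / (1 + z\<^sup>2)"
proof -
  have "C2_bound 2 (\<lambda>s. 1 - s)" using C2_bound_quadratic[of 1 "-1" 0] by simp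
  from oscillatory_integral_bound[OF this, of 0 z] show ?thesis by (simp add: fejer_def)
qed

lemma fejer_continuous: "continuous_on A fejer"
  using smooth_continuous[OF smooth_band_kernel[of 1 0 0 0], of A 0]
  by (simp add: band_kernel_fejer[abs_def])

lemma fejer_measurable[measurable]: "fejer \<in> borel_measurable borel"
  by (rule borel_measurable_continuous_onI[OF fejer_continuous])

lemma fejer_integrable: "integrable lborel fejer"
proof (rule Bochner_Integration.integrable_bound)
  show "integrable lborel (\<lambda>x::real. 12 * (1 / (1 + x\<^sup>2)))"
    by (intro integrable_mult_right integrable_inverse_1_plus_sq)
  show "AE x in lborel. norm (fejer x) \<le> norm (12 * (1 / (1 + x\<^sup>2)))"
    using fejer_le fejer_nonneg by (intro AE_I2) auto
qed simp

definition fejer_mass :: real where "fejer_mass = (LINT z|lborel. fejer z)"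

lemma fejer_mass_pos: "fejer_mass > 0"
proof -
  have "isCont fejer 0" using fejer_continuous[of UNIV] by (simp add: continuous_on_eq_continuous_at)
  then obtain e where e: "e > 0" "\<And>z. dist z 0 < e \<Longrightarrow> dist (fejer z) (fejer 0) < 1 / 4"
    unfolding continuous_at_eps_delta by (metis zero_less_divide_1_iff zero_less_numeral)
  have "(LINT z|lborel. indicator {-e/2..e/2} z * (1 / 4)) \<le> fejer_mass"
    unfolding fejer_mass_def
  proof (rule integral_mono)
    show "integrable lborel (\<lambda>z. indicator {- e / 2..e / 2} z * (1 / 4::real))"
      by (intro integrable_mult_left integrable_real_indicator) (use e in auto)
    fix z
    show "indicator {- e / 2..e / 2} z * (1 / 4) \<le> fejer z"
    proof (cases "z \<in> {- e / 2..e / 2}")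
      case True
      hence "dist z 0 < e" using e by (auto simp: dist_real_def)
      from e(2)[OF this] have "fejer z \<ge> 1 / 4" unfolding fejer_0 dist_real_def by linarith
      thus ?thesis using True by simp
    qed (simp add: fejer_nonneg)
  qed (rule fejer_integrable)
  moreover have "(LINT z|lborel. indicator {-e/2..e/2} z * (1 / 4)) = e * (1 / 4)"
    using e by (simp)
  ultimately show ?thesis using e by simp
qed

section \<open>Convolution with test functions\<close>

definition conv :: "(real \<Rightarrow> real) \<Rightarrow> (real \<Rightarrow> real) \<Rightarrow> real \<Rightarrow> real" where
  "conv \<phi> g x = (LINT y|lborel. \<phi> y * g (x - y))"

lemma conv_integrable:
  assumes "\<phi> \<in> test_functions" "smooth g"
  shows "integrable lborel (\<lambda>y. \<phi> y * g (x - y))"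
proof -
  have "smooth (\<lambda>y. 1 * g ((-1) * y + x))" by (rule smooth_affine[OF assms(2)])
  from test_integrable[OF test_mult[OF this assms(1)]] show ?thesis by (simp add: mult.commute)
qed

lemma conv_has_derivative:
  assumes \<phi>: "\<phi> \<in> test_functions" and g: "smooth g"
  shows "(conv \<phi> ((deriv ^^ k) g) has_real_derivative conv \<phi> ((deriv ^^ Suc k) g) x) (at x)"
proof -
  obtain S where S: "S > 0" "\<And>k x. \<bar>x\<bar> > S \<Longrightarrow> (deriv ^^ k) \<phi> x = 0"
    using test_support[OF \<phi>] by blast
  have \<phi>c: "continuous_on A \<phi>" for A using smooth_continuous[OF test_smooth[OF \<phi>], of A 0] by simp
  have gc: "continuous_on UNIV ((deriv ^^ k) g)" for k by (rule smooth_continuous[OF g])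
  define f where "f k x y = \<phi> y * (deriv ^^ k) g (x - y)" for k x y
  have fc: "continuous_on A (f k x)" for A k x
    unfolding f_def[abs_def]
    by (intro continuous_on_mult \<phi>c continuous_on_compose2[OF gc] continuous_on_diff continuous_on_const continuous_on_id) simp
  have conv_eq: "conv \<phi> ((deriv ^^ k) g) x = integral (cbox (-S) S) (f k x)" for k x
  proof -
    have "indicator {-S..S} y * f k x y = \<phi> y * (deriv ^^ k) g (x - y)" for y
      using S(2)[of y 0] by (cases "\<bar>y\<bar> > S") (auto simp: f_def indicator_def)
    thus ?thesis unfolding cbox_interval integral_Icc_lborel(2)[OF fc] conv_def by simp
  qed
  have "((\<lambda>x. integral (cbox (-S) S) (f k x)) has_real_derivative integral (cbox (-S) S) (f (Suc k) x)) (at x within UNIV)"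
  proof (rule leibniz_rule_field_derivative)
    fix x y :: real
    have "((\<lambda>x. (deriv ^^ k) g (x - y)) has_real_derivative (deriv ^^ Suc k) g (x - y) * (1 - 0)) (at x)"
      by (rule DERIV_chain2[OF smooth_has_derivative[OF g]]) (auto intro!: derivative_eq_intros)
    thus "((\<lambda>x. f k x y) has_real_derivative f (Suc k) x y) (at x within UNIV)"
      unfolding f_def by (intro DERIV_cmult) simp
    show "f k x integrable_on cbox (- S) S" by (rule integrable_continuous[OF fc])
  next
    have "continuous_on (UNIV \<times> cbox (- S) S) (\<lambda>z. \<phi> (snd z))"
      by (rule continuous_on_compose2[OF \<phi>c[of UNIV]]) (auto intro!: continuous_intros)
    moreover have "continuous_on (UNIV \<times> cbox (- S) S) (\<lambda>z. (deriv ^^ Suc k) g (fst z - snd z))"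
      by (rule continuous_on_compose2[OF gc[of "Suc k"]]) (auto intro!: continuous_intros)
    ultimately show "continuous_on (UNIV \<times> cbox (- S) S) (\<lambda>(x, y). f (Suc k) x y)"
      unfolding f_def split_beta by (rule continuous_on_mult)
  qed auto
  moreover have "conv \<phi> ((deriv ^^ k) g) = (\<lambda>x. integral (cbox (-S) S) (f k x))" for k
    by (rule ext) (rule conv_eq)
  ultimately show ?thesis by (simp only:)
qed

lemma
  assumes "\<phi> \<in> test_functions" "smooth g"
  shows funpow_deriv_conv: "(deriv ^^ k) (conv \<phi> g) = conv \<phi> ((deriv ^^ k) g)"
    and smooth_conv: "smooth (conv \<phi> g)"
  using derivative_sequence[of "\<lambda>k. conv \<phi> ((deriv ^^ k) g)", OF conv_has_derivative[OF assms]] by simp_all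

lemma conv_deriv_swap:
  assumes \<phi>: "\<phi> \<in> test_functions" and g: "smooth g"
  shows "conv \<phi> ((deriv ^^ k) g) = conv ((deriv ^^ k) \<phi>) g"
  using \<phi>
proof (induction k arbitrary: \<phi>)
  case (Suc k)
  have dg: "smooth ((deriv ^^ k) g)" by (rule smooth_deriv[OF g])
  have "conv \<phi> ((deriv ^^ Suc k) g) x = conv (deriv \<phi>) ((deriv ^^ k) g) x" for x
  proof -
    define h where "h = (\<lambda>y. 1 * (deriv ^^ k) g ((-1) * y + x))"
    have h: "smooth h" unfolding h_def by (rule smooth_affine[OF dg])
    have h': "deriv h y = - (deriv ^^ Suc k) g (x - y)" for y
      using funpow_deriv_affine[OF dg, of 1 1 "-1" x] unfolding h_def by (simp add: fun_eq_iff)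
    have "(LINT y|lborel. h y * deriv \<phi> y) = - (LINT y|lborel. deriv h y * \<phi> y)"
      by (rule integral_test_by_parts[OF h Suc.prems])
    thus ?thesis unfolding h' by (simp add: conv_def h_def mult.commute)
  qed
  hence "conv \<phi> ((deriv ^^ Suc k) g) = conv (deriv \<phi>) ((deriv ^^ k) g)" by blast
  also have "\<dots> = conv ((deriv ^^ k) (deriv \<phi>)) g"
    by (rule Suc.IH) (use test_deriv[OF Suc.prems, of 1] in simp)
  finally show ?case by (simp only: funpow_deriv_deriv)
qed simp

text \<open>For \<open>\<bar>y\<bar> \<le> S\<close> one has \<open>1 + x\<^sup>2 \<le> 2 * (1 + S\<^sup>2) * (1 + (x - y)\<^sup>2)\<close>, so a translation by \<open>y\<close> costs a factor that only
  depends on the support of \<open>\<phi>\<close>.\<close>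

lemma conv_bound:
  assumes \<phi>: "\<phi> \<in> test_functions"
  obtains D where "D \<ge> 0" and "\<And>g C x. smooth g \<Longrightarrow> C \<ge> 0 \<Longrightarrow> (\<And>x. \<bar>g x\<bar> \<le> C / (1 + x\<^sup>2)) \<Longrightarrow> \<bar>conv \<phi> g x\<bar> \<le> C * D / (1 + x\<^sup>2)"
proof -
  obtain S where S: "S > 0" "\<And>k x. \<bar>x\<bar> > S \<Longrightarrow> (deriv ^^ k) \<phi> x = 0"
    using test_support[OF \<phi>] by blast
  define D where "D = 2 * (1 + S\<^sup>2) * (LINT y|lborel. \<bar>\<phi> y\<bar>)"
  have \<phi>i: "integrable lborel (\<lambda>y. \<bar>\<phi> y\<bar>)" using test_integrable[OF \<phi>] by simp
  show ?thesis
  proof (rule that[of D])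
    show "D \<ge> 0" unfolding D_def by (intro mult_nonneg_nonneg integral_nonneg_AE) auto
    fix g C x assume g: "smooth g" "C \<ge> 0" "\<And>x. \<bar>g x\<bar> \<le> C / (1 + x\<^sup>2)"
    have pw: "\<bar>\<phi> y * g (x - y)\<bar> \<le> \<bar>\<phi> y\<bar> * (C * (2 * (1 + S\<^sup>2)) / (1 + x\<^sup>2))" for y
    proof (cases "\<bar>y\<bar> > S")
      case True thus ?thesis using S(2)[of y 0] by simp
    next
      case False
      hence y: "y\<^sup>2 \<le> S\<^sup>2" using S by (simp add: abs_le_square_iff[symmetric])
      have "x\<^sup>2 \<le> 2 * (x - y)\<^sup>2 + 2 * y\<^sup>2" using zero_le_power2[of "x - 2 * y"]
        by (simp add: power2_eq_square algebra_simps)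
      also have "\<dots> \<le> 2 * (x - y)\<^sup>2 + 2 * S\<^sup>2" using y by simp
      finally have "x\<^sup>2 \<le> 2 * (x - y)\<^sup>2 + 2 * S\<^sup>2" .
      moreover have "2 * (1 + S\<^sup>2) * (1 + (x - y)\<^sup>2) = 2 + 2 * S\<^sup>2 + 2 * (x - y)\<^sup>2 + 2 * (S\<^sup>2 * (x - y)\<^sup>2)"
        by (simp add: distrib_left distrib_right)
      moreover have "0 \<le> S\<^sup>2 * (x - y)\<^sup>2" by simp
      ultimately have "1 + x\<^sup>2 \<le> 2 * (1 + S\<^sup>2) * (1 + (x - y)\<^sup>2)" by linarith
      hence "1 / (1 + (x - y)\<^sup>2) \<le> 2 * (1 + S\<^sup>2) / (1 + x\<^sup>2)"
        using one_plus_sq_pos[of x] one_plus_sq_pos[of "x - y"] by (simp add: field_simps)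
      from mult_left_mono[OF this g(2)] have "\<bar>g (x - y)\<bar> \<le> C * (2 * (1 + S\<^sup>2)) / (1 + x\<^sup>2)"
        using g(3)[of "x - y"] by simp
      thus ?thesis unfolding abs_mult by (intro mult_left_mono) auto
    qed
    have "\<bar>conv \<phi> g x\<bar> \<le> (LINT y|lborel. \<bar>\<phi> y * g (x - y)\<bar>)" unfolding conv_def by (rule integral_abs_bound)
    also have "\<dots> \<le> (LINT y|lborel. \<bar>\<phi> y\<bar> * (C * (2 * (1 + S\<^sup>2)) / (1 + x\<^sup>2)))"
      by (rule integral_mono[OF _ _ pw]) (use conv_integrable[OF \<phi> g(1)] \<phi>i in auto)
    also have "\<dots> = C * D / (1 + x\<^sup>2)" by (simp add: D_def)
    finally show "\<bar>conv \<phi> g x\<bar> \<le> C * D / (1 + x\<^sup>2)" .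
  qed
qed

lemma conv_quad_decay:
  assumes \<phi>: "\<phi> \<in> test_functions" and g: "quad_decay g"
  shows "quad_decay (conv \<phi> g)"
  unfolding quad_decay_def
proof (intro conjI allI)
  show "smooth (conv \<phi> g)" by (rule smooth_conv[OF \<phi> quad_decay_smooth[OF g]])
  fix k
  obtain D where D: "\<And>g C x. smooth g \<Longrightarrow> C \<ge> 0 \<Longrightarrow> (\<And>x. \<bar>g x\<bar> \<le> C / (1 + x\<^sup>2)) \<Longrightarrow> \<bar>conv \<phi> g x\<bar> \<le> C * D / (1 + x\<^sup>2)"
    using conv_bound[OF \<phi>] by metis
  obtain C where C: "C \<ge> 0" "\<And>x. \<bar>(deriv ^^ k) g x\<bar> \<le> C / (1 + x\<^sup>2)" using quad_decay_bound[OF g] by metis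
  show "\<exists>C. \<forall>x. \<bar>(deriv ^^ k) (conv \<phi> g) x\<bar> \<le> C / (1 + x\<^sup>2)"
    unfolding funpow_deriv_conv[OF \<phi> quad_decay_smooth[OF g]]
    using D[OF smooth_deriv[OF quad_decay_smooth[OF g]] C] by blast
qed

section \<open>The Fejer kernel is an approximate identity\<close>

lemma conv_fejer_substitute:
  assumes "\<omega> > 0"
  shows "conv \<psi> (\<lambda>x. \<omega> * fejer (\<omega> * x)) x = (LINT z|lborel. \<psi> (x - z / \<omega>) * fejer z)"
proof -
  have "(LINT y|lborel. \<psi> y * (\<omega> * fejer (\<omega> * (x - y)))) =
    \<bar>- (1 / \<omega>)\<bar> *\<^sub>R (LINT z|lborel. \<psi> (x + (- (1 / \<omega>)) * z) * (\<omega> * fejer (\<omega> * (x - (x + (- (1 / \<omega>)) * z)))))"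
    by (rule lborel_integral_real_affine) (use assms in auto)
  also have "\<dots> = (1 / \<omega>) * (LINT z|lborel. \<omega> * (\<psi> (x - z / \<omega>) * fejer z))"
    using assms by (simp add: mult_ac)
  finally show ?thesis using assms by (simp add: conv_def)
qed

lemma conv_fejer_tendsto:
  assumes \<psi>: "\<psi> \<in> test_functions"
  shows "(\<lambda>n. conv \<psi> (\<lambda>x. real (Suc n) * fejer (real (Suc n) * x)) x) \<longlonglongrightarrow> fejer_mass * \<psi> x"
proof -
  obtain M where M: "M \<ge> 0" "\<And>x. \<bar>\<psi> x\<bar> \<le> M" using test_bounded[OF \<psi>, of 0] by auto
  have \<psi>c: "continuous_on UNIV \<psi>" using smooth_continuous[OF test_smooth[OF \<psi>], of UNIV 0] by simp
  have [measurable]: "\<psi> \<in> borel_measurable borel" by (rule borel_measurable_continuous_onI[OF \<psi>c])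
  have "(\<lambda>n. LINT z|lborel. \<psi> (x - z / real (Suc n)) * fejer z) \<longlonglongrightarrow> (LINT z|lborel. \<psi> x * fejer z)"
  proof (rule integral_dominated_convergence)
    show "integrable lborel (\<lambda>z. M * fejer z)" by (intro integrable_mult_right fejer_integrable)
    show "AE z in lborel. (\<lambda>n. \<psi> (x - z / real (Suc n)) * fejer z) \<longlonglongrightarrow> \<psi> x * fejer z"
    proof (intro AE_I2 tendsto_mult tendsto_const)
      fix z :: real
      have "(\<lambda>n. z * inverse (real (Suc n))) \<longlonglongrightarrow> 0" by (rule tendsto_mult_right_zero[OF LIMSEQ_inverse_real_of_nat])
      hence "(\<lambda>n. x - z / real (Suc n)) \<longlonglongrightarrow> x - 0"
        unfolding divide_inverse by (intro tendsto_diff tendsto_const)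
      moreover have "isCont \<psi> (x - 0)" using \<psi>c by (simp add: continuous_on_eq_continuous_at)
      ultimately show "(\<lambda>n. \<psi> (x - z / real (Suc n))) \<longlonglongrightarrow> \<psi> x"
        using isCont_tendsto_compose by fastforce
    qed
    show "AE z in lborel. norm (\<psi> (x - z / real (Suc n)) * fejer z) \<le> M * fejer z" for n
      using M fejer_nonneg by (intro AE_I2) (auto simp: abs_mult intro!: mult_right_mono)
  qed simp_all
  moreover have "conv \<psi> (\<lambda>x. real (Suc n) * fejer (real (Suc n) * x)) x = (LINT z|lborel. \<psi> (x - z / real (Suc n)) * fejer z)" for n
    by (rule conv_fejer_substitute) simp
  ultimately show ?thesis by (simp add: fejer_mass_def mult.commute)
qed

text \<open>Near the support of \<open>\<psi>\<close> the convolution is at most the supremum of \<open>\<psi>\<close> times the mass of the kernel, and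
  away from the support the kernel itself decays like \<open>1 / x\<^sup>2\<close>, uniformly in the band width.\<close>

lemma conv_fejer_bound:
  assumes \<psi>: "\<psi> \<in> test_functions"
  shows "\<exists>C. \<forall>n x. \<bar>conv \<psi> (\<lambda>x. real (Suc n) * fejer (real (Suc n) * x)) x\<bar> \<le> C / (1 + x\<^sup>2)"
proof -
  obtain S where S: "S > 0" "\<And>k x. \<bar>x\<bar> > S \<Longrightarrow> (deriv ^^ k) \<psi> x = 0"
    using test_support[OF \<psi>] by blast
  obtain M where M: "M \<ge> 0" "\<And>x. \<bar>\<psi> x\<bar> \<le> M" using test_bounded[OF \<psi>, of 0] by auto
  have \<psi>c: "continuous_on UNIV \<psi>" using smooth_continuous[OF test_smooth[OF \<psi>], of UNIV 0] by simp
  have [measurable]: "\<psi> \<in> borel_measurable borel" by (rule borel_measurable_continuous_onI[OF \<psi>c])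
  have \<psi>i: "integrable lborel (\<lambda>y. \<bar>\<psi> y\<bar>)" using test_integrable[OF \<psi>] by simp
  define J where "J = (LINT y|lborel. \<bar>\<psi> y\<bar>)"
  have J: "J \<ge> 0" unfolding J_def by (intro integral_nonneg_AE) auto
  define R where "R = 1 + S"
  have R: "R \<ge> 1" using S by (simp add: R_def)
  define C where "C = M * fejer_mass * (1 + 4 * R\<^sup>2) + 96 * J"
  have "\<bar>conv \<psi> (\<lambda>x. real (Suc n) * fejer (real (Suc n) * x)) x\<bar> \<le> C / (1 + x\<^sup>2)" for n x
  proof -
    define \<omega> where "\<omega> = real (Suc n)"
    have \<omega>: "\<omega> \<ge> 1" by (simp add: \<omega>_def)
    show ?thesis
    proof (cases "\<bar>x\<bar> \<le> 2 * R")
      case True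
      have "\<bar>conv \<psi> (\<lambda>x. \<omega> * fejer (\<omega> * x)) x\<bar> \<le> (LINT z|lborel. \<bar>\<psi> (x - z / \<omega>) * fejer z\<bar>)"
        using \<omega> by (subst conv_fejer_substitute) auto
      also have "\<dots> \<le> (LINT z|lborel. M * fejer z)"
      proof (rule integral_mono_AE')
        show "AE z in lborel. \<bar>\<psi> (x - z / \<omega>) * fejer z\<bar> \<le> M * fejer z"
          using M fejer_nonneg by (intro AE_I2) (auto simp: abs_mult intro!: mult_right_mono)
      qed (use fejer_integrable M fejer_nonneg in auto)
      also have "\<dots> = M * fejer_mass" by (simp add: fejer_mass_def)
      also have "\<dots> \<le> C / (1 + x\<^sup>2)"
      proof -
        have "x\<^sup>2 \<le> (2 * R)\<^sup>2" using True R abs_le_square_iff[of x "2 * R"] by simp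
        hence "x\<^sup>2 \<le> 4 * R\<^sup>2" by (simp add: power_mult_distrib)
        hence "M * fejer_mass * (1 + x\<^sup>2) \<le> M * fejer_mass * (1 + 4 * R\<^sup>2)"
          using M fejer_mass_pos by (intro mult_left_mono) auto
        also have "\<dots> \<le> C" using J by (simp add: C_def)
        finally show ?thesis using one_plus_sq_pos[of x] by (simp add: field_simps)
      qed
      finally show ?thesis unfolding \<omega>_def .
    next
      case False
      hence x0: "x \<noteq> 0" "x\<^sup>2 \<ge> 1" using R abs_le_square_iff[of 1 x] by auto
      have pw: "\<bar>\<psi> y * (\<omega> * fejer (\<omega> * (x - y)))\<bar> \<le> \<bar>\<psi> y\<bar> * (48 / x\<^sup>2)" for y
      proof (cases "\<bar>y\<bar> > S")
        case True thus ?thesis using S(2)[of y 0] by simp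
      next
        case False
        have "\<bar>x\<bar> > 2 + 2 * S" using \<open>\<not> \<bar>x\<bar> \<le> 2 * R\<close> by (simp add: R_def)
        hence "\<bar>x\<bar> \<le> 2 * \<bar>x - y\<bar>" using False abs_triangle_ineq2[of x y] by argo
        hence "\<bar>x / 2\<bar> \<le> \<bar>x - y\<bar>" by simp
        hence xy: "x\<^sup>2 / 4 \<le> (x - y)\<^sup>2" by (subst (asm) abs_le_square_iff) (simp add: power_divide)
        have "\<omega> * fejer (\<omega> * (x - y)) \<le> \<omega> * (12 / (1 + (\<omega> * (x - y))\<^sup>2))"
          using \<omega> by (intro mult_left_mono fejer_le) auto
        also have "\<dots> \<le> \<omega> * (12 / (\<omega> * (x\<^sup>2 / 4)))"
        proof (intro mult_left_mono divide_left_mono mult_pos_pos)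
          have "\<omega> * (x\<^sup>2 / 4) \<le> \<omega>\<^sup>2 * (x - y)\<^sup>2"
            using \<omega> xy by (intro mult_mono) (auto simp: power2_eq_square)
          thus "\<omega> * (x\<^sup>2 / 4) \<le> 1 + (\<omega> * (x - y))\<^sup>2" by (simp add: power_mult_distrib)
        qed (use \<omega> x0 one_plus_sq_pos in auto)
        also have "\<dots> = 48 / x\<^sup>2" using \<omega> by simp
        finally show ?thesis using fejer_nonneg[of "\<omega> * (x - y)"] \<omega>
          unfolding abs_mult by (intro mult_left_mono) auto
      qed
      have "\<bar>conv \<psi> (\<lambda>x. \<omega> * fejer (\<omega> * x)) x\<bar> \<le> (LINT y|lborel. \<bar>\<psi> y * (\<omega> * fejer (\<omega> * (x - y)))\<bar>)"
        unfolding conv_def by (rule integral_abs_bound)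
      also have "\<dots> \<le> (LINT y|lborel. \<bar>\<psi> y\<bar> * (48 / x\<^sup>2))"
        by (rule integral_mono_AE') (use \<psi>i pw in auto)
      also have "\<dots> = 48 * J / x\<^sup>2" by (simp add: J_def)
      also have "\<dots> \<le> C / (1 + x\<^sup>2)"
      proof -
        have "48 * J * (1 + x\<^sup>2) \<le> 48 * J * (2 * x\<^sup>2)" using J x0 by (intro mult_left_mono) auto
        also have "\<dots> \<le> C * x\<^sup>2"
        proof -
          have "96 * J \<le> C" using M fejer_mass_pos by (simp add: C_def)
          thus ?thesis using mult_right_mono[of "96 * J" C "x\<^sup>2"] by simp
        qed
        finally show ?thesis using one_plus_sq_pos[of x] x0 by (simp add: field_simps)
      qed
      finally show ?thesis unfolding \<omega>_def .
    qed
  qed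
  thus ?thesis by blast
qed

lemma sobolev_dual_fejer_tendsto:
  assumes l: "l \<in> sobolev_dual m" and \<phi>: "\<phi> \<in> test_functions"
  shows "(\<lambda>n. l (conv \<phi> (band_kernel (real (Suc n)) a d 0 0))) \<longlonglongrightarrow> fejer_mass * l \<phi>"
proof -
  define K where "K n = band_kernel (real (Suc n)) a d 0 0" for n
  have K: "K n = (\<lambda>x. real (Suc n) * fejer (real (Suc n) * x))" for n
    by (simp add: K_def band_kernel_fejer fun_eq_iff)
  have Ks: "smooth (K n)" for n unfolding K_def by (rule smooth_band_kernel)
  have dK: "(deriv ^^ k) (conv \<phi> (K n)) = conv ((deriv ^^ k) \<phi>) (\<lambda>x. real (Suc n) * fejer (real (Suc n) * x))" for k n
    by (simp only: funpow_deriv_conv[OF \<phi> Ks] conv_deriv_swap[OF \<phi> Ks]) (simp only: K)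
  have r: "quad_decay \<phi>" by (rule test_quad_decay[OF \<phi>])
  have "(\<lambda>n. l (conv \<phi> (K n))) \<longlonglongrightarrow> l (\<lambda>x. fejer_mass * \<phi> x)"
  proof (rule sobolev_dual_tendsto(1)[OF l])
    show "quad_decay (conv \<phi> (K n))" for n unfolding K_def by (intro conv_quad_decay \<phi> band_kernel_quad_decay) simp
    show "quad_decay (\<lambda>x. fejer_mass * \<phi> x)" by (rule quad_decay_cmult[OF r])
    show "(\<lambda>n. (deriv ^^ k) (conv \<phi> (K n)) x) \<longlonglongrightarrow> (deriv ^^ k) (\<lambda>x. fejer_mass * \<phi> x) x" for k x
      unfolding dK funpow_deriv_cmult[OF test_smooth[OF \<phi>]] by (rule conv_fejer_tendsto[OF test_deriv[OF \<phi>]])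
    show "\<exists>C. \<forall>n x. \<bar>(deriv ^^ k) (conv \<phi> (K n)) x\<bar> \<le> C / (1 + x\<^sup>2)" for k
      unfolding dK by (rule conv_fejer_bound[OF test_deriv[OF \<phi>]])
  qed
  thus ?thesis by (simp add: K_def sobolev_dual_cmult[OF l r])
qed

section \<open>The integral equation for functions with quadratic decay\<close>

text \<open>The approximants are products with dilated bumps that are normalised to be \<open>1\<close> at the origin; every
  derivative of the cutoff gains a factor \<open>1 / (n + 1)\<close>.\<close>

lemma quad_decay_approximation:
  assumes \<psi>: "quad_decay \<psi>"
  obtains f where "\<And>n. f n \<in> test_functions"
    and "\<And>k x. (\<lambda>n. (deriv ^^ k) (f n) x) \<longlonglongrightarrow> (deriv ^^ k) \<psi> x"
    and "\<And>k. \<exists>C. \<forall>n x. \<bar>(deriv ^^ k) (f n) x\<bar> \<le> C / (1 + x\<^sup>2)"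
proof -
  define b where "b = bump 1 (-1) 1"
  have bt: "b \<in> test_functions" unfolding b_def by (rule bump_test) simp
  note bs = test_smooth[OF bt]
  define e where "e = b 0"
  have e: "e > 0" by (simp add: e_def b_def bump_eq)
  define c where "c n = inverse (real (Suc n))" for n
  have c: "0 < c n" "c n \<le> 1" for n by (auto simp: c_def inverse_le_1_iff)
  have c0: "c \<longlonglongrightarrow> 0" unfolding c_def by (rule LIMSEQ_inverse_real_of_nat)
  define g where "g n x = (1 / e) * b (c n * x + 0)" for n x
  have gs: "smooth (g n)" for n unfolding g_def[abs_def] by (rule smooth_affine[OF bs])
  have dg: "(deriv ^^ k) (g n) x = 1 / e * c n ^ k * (deriv ^^ k) b (c n * x)" for k n x
    using funpow_deriv_affine[OF bs, of k "1 / e" "c n" 0] unfolding g_def[abs_def] by simp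
  define f where "f n = (\<lambda>x. \<psi> x * g n x)" for n
  have df: "(deriv ^^ k) (f n) x = (\<Sum>i\<le>k. real (k choose i) * (deriv ^^ i) \<psi> x * (deriv ^^ (k - i)) (g n) x)" for k n x
    unfolding f_def funpow_deriv_mult[OF quad_decay_smooth[OF \<psi>] gs] ..
  show ?thesis
  proof (rule that[of f])
    fix n
    obtain S where S: "S > 0" "\<And>k x. \<bar>x\<bar> > S \<Longrightarrow> (deriv ^^ k) b x = 0"
      using test_support[OF bt] by blast
    have "g n x = 0" if "\<bar>x\<bar> > S / c n" for x
    proof -
      have "\<bar>c n * x\<bar> > S" using that c[of n] by (simp add: abs_mult field_simps)
      thus ?thesis using S(2)[of "c n * x" 0] by (simp add: g_def)
    qed
    hence "g n \<in> test_functions" unfolding test_functions_iff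
      using gs[of n] S(1) c[of n] by (intro conjI exI[of _ "S / c n"]) auto
    thus "f n \<in> test_functions" unfolding f_def by (rule test_mult[OF quad_decay_smooth[OF \<psi>]])
  next
    fix k x
    have dgl: "(\<lambda>n. (deriv ^^ j) (g n) x) \<longlonglongrightarrow> (if j = 0 then 1 else 0)" for j
    proof -
      have "isCont ((deriv ^^ j) b) 0"
        using smooth_continuous[OF bs, of UNIV j] by (simp add: continuous_on_eq_continuous_at)
      moreover have "(\<lambda>n. c n * x) \<longlonglongrightarrow> 0" by (rule tendsto_mult_left_zero[OF c0])
      ultimately have "(\<lambda>n. (deriv ^^ j) b (c n * x)) \<longlonglongrightarrow> (deriv ^^ j) b 0"
        by (rule isCont_tendsto_compose)
      hence "(\<lambda>n. 1 / e * c n ^ j * (deriv ^^ j) b (c n * x)) \<longlonglongrightarrow> 1 / e * 0 ^ j * (deriv ^^ j) b 0"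
        by (intro tendsto_mult tendsto_const tendsto_power c0)
      moreover have "1 / e * 0 ^ j * (deriv ^^ j) b 0 = (if j = 0 then 1 else 0)"
        using e by (auto simp: e_def)
      ultimately show ?thesis unfolding dg by simp
    qed
    have "(\<lambda>n. \<Sum>i\<le>k. real (k choose i) * (deriv ^^ i) \<psi> x * (deriv ^^ (k - i)) (g n) x)
       \<longlonglongrightarrow> (\<Sum>i\<le>k. real (k choose i) * (deriv ^^ i) \<psi> x * (if k - i = 0 then 1 else 0))"
      by (intro tendsto_sum tendsto_mult tendsto_const dgl)
    also have "(\<Sum>i\<le>k. real (k choose i) * (deriv ^^ i) \<psi> x * (if k - i = 0 then 1 else 0)) =
        (\<Sum>i\<in>{k}. real (k choose i) * (deriv ^^ i) \<psi> x)"
      by (rule sum.mono_neutral_cong_right) auto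
    finally show "(\<lambda>n. (deriv ^^ k) (f n) x) \<longlonglongrightarrow> (deriv ^^ k) \<psi> x" unfolding df by simp
  next
    fix k
    have "\<forall>i. \<exists>C. C \<ge> 0 \<and> (\<forall>x. \<bar>(deriv ^^ i) \<psi> x\<bar> \<le> C / (1 + x\<^sup>2))" using quad_decay_bound[OF \<psi>] by metis
    then obtain C where C: "\<And>i. C i \<ge> 0" "\<And>i x. \<bar>(deriv ^^ i) \<psi> x\<bar> \<le> C i / (1 + x\<^sup>2)" by metis
    have "\<forall>j. \<exists>M. M \<ge> 0 \<and> (\<forall>x. \<bar>(deriv ^^ j) b x\<bar> \<le> M)" using test_bounded[OF bt] by metis
    then obtain M where M: "\<And>j. M j \<ge> 0" "\<And>j x. \<bar>(deriv ^^ j) b x\<bar> \<le> M j" by metis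
    have gb: "\<bar>(deriv ^^ j) (g n) x\<bar> \<le> M j / e" for j n x
    proof -
      have "\<bar>c n\<bar> ^ j \<le> 1" using c[of n] by (intro power_le_one) auto
      hence "\<bar>c n\<bar> ^ j * \<bar>(deriv ^^ j) b (c n * x)\<bar> \<le> 1 * M j" using M by (intro mult_mono) auto
      thus ?thesis unfolding dg using e by (simp add: abs_mult power_abs divide_right_mono)
    qed
    have "\<bar>(deriv ^^ k) (f n) x\<bar> \<le> (\<Sum>i\<le>k. real (k choose i) * C i * (M (k - i) / e)) / (1 + x\<^sup>2)" for n x
    proof -
      have "\<bar>(deriv ^^ k) (f n) x\<bar> \<le> (\<Sum>i\<le>k. \<bar>real (k choose i) * (deriv ^^ i) \<psi> x * (deriv ^^ (k - i)) (g n) x\<bar>)"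
        unfolding df by (rule sum_abs)
      also have "\<dots> \<le> (\<Sum>i\<le>k. real (k choose i) * (C i / (1 + x\<^sup>2)) * (M (k - i) / e))"
        unfolding abs_mult using C one_plus_sq_pos[of x]
        by (intro sum_mono mult_mono gb C mult_nonneg_nonneg divide_nonneg_pos) auto
      also have "\<dots> = (\<Sum>i\<le>k. real (k choose i) * C i * (M (k - i) / e)) / (1 + x\<^sup>2)"
        by (simp add: sum_divide_distrib mult_ac)
      finally show ?thesis .
    qed
    thus "\<exists>C. \<forall>n x. \<bar>(deriv ^^ k) (f n) x\<bar> \<le> C / (1 + x\<^sup>2)" by blast
  qed
qed

lemma solution_on_dual_bound:
  assumes sol: "solution_on m \<alpha> d a T U"
  obtains M where "M \<ge> 0" and
    "\<And>\<tau> \<psi>. 0 < \<tau> \<Longrightarrow> \<tau> \<le> T \<Longrightarrow> quad_decay \<psi> \<Longrightarrow> \<bar>U \<tau> \<psi>\<bar> \<le> M * \<tau> powr (- \<alpha>) * sobolev_norm m \<psi>"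
proof -
  from sol have "bdd_above ((\<lambda>t. t powr \<alpha> * sobolev_dual_norm m (U t)) ` {0..T})"
    by (simp add: solution_on_def)
  then obtain M where M: "\<And>t. t \<in> {0..T} \<Longrightarrow> t powr \<alpha> * sobolev_dual_norm m (U t) \<le> M"
    unfolding bdd_above_def by blast
  show ?thesis
  proof (rule that[of "\<bar>M\<bar>"])
    fix \<tau> \<psi> assume \<tau>: "0 < \<tau>" "\<tau> \<le> T" and \<psi>: "quad_decay \<psi>"
    have "U \<tau> \<in> sobolev_dual m" using sol \<tau> by (auto simp: solution_on_def)
    from sobolev_dual_bound[OF this \<psi>]
    have "\<bar>U \<tau> \<psi>\<bar> \<le> sobolev_dual_norm m (U \<tau>) * sobolev_norm m \<psi>" .
    also have "sobolev_dual_norm m (U \<tau>) \<le> \<bar>M\<bar> * \<tau> powr (- \<alpha>)"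
    proof -
      have "\<tau> powr \<alpha> * sobolev_dual_norm m (U \<tau>) \<le> \<bar>M\<bar>" using M[of \<tau>] \<tau> by auto
      thus ?thesis using \<tau> by (simp add: powr_minus field_simps)
    qed
    finally show "\<bar>U \<tau> \<psi>\<bar> \<le> \<bar>M\<bar> * \<tau> powr (- \<alpha>) * sobolev_norm m \<psi>"
      using sobolev_norm_nonneg[of m \<psi>] by (simp add: mult_right_mono)
  qed simp
qed

text \<open>The approximation passes to the limit at every time. The a priori bound on the dual norm of the solution
  dominates the integrands by a multiple of \<open>\<tau> powr (- \<alpha>) * (t - \<tau>) powr (\<alpha> - 1)\<close>, which is
  integrable as \<open>0 < \<alpha> < 1\<close>.\<close>

lemma solution_on_quad_decay:
  assumes sol: "solution_on m \<alpha> d a T U" and \<alpha>: "0 < \<alpha>" "\<alpha> < 1"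
    and t: "0 < t" "t \<le> T" and \<psi>: "quad_decay \<psi>"
  shows "integrable lborel (\<lambda>\<tau>. indicator {0..t} \<tau> * ((d * U \<tau> ((deriv ^^ 2) \<psi>) + a * U \<tau> \<psi>) * (t - \<tau>) powr (\<alpha> - 1)))"
    and "U t \<psi> = \<psi> 0 + 1 / Gamma \<alpha> *
       (LINT \<tau>|lborel. indicator {0..t} \<tau> * ((d * U \<tau> ((deriv ^^ 2) \<psi>) + a * U \<tau> \<psi>) * (t - \<tau>) powr (\<alpha> - 1)))"
proof -
  obtain f where f: "\<And>n. f n \<in> test_functions"
    and lim: "\<And>k x. (\<lambda>n. (deriv ^^ k) (f n) x) \<longlonglongrightarrow> (deriv ^^ k) \<psi> x"
    and dom: "\<And>k. \<exists>C. \<forall>n x. \<bar>(deriv ^^ k) (f n) x\<bar> \<le> C / (1 + x\<^sup>2)"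
    using quad_decay_approximation[OF \<psi>] by metis
  have rf: "quad_decay ((deriv ^^ j) (f n))" for n j by (intro quad_decay_deriv test_quad_decay f)
  have r\<psi>: "quad_decay ((deriv ^^ j) \<psi>)" for j by (intro quad_decay_deriv \<psi>)
  have dual: "U \<tau> \<in> sobolev_dual m" if "\<tau> \<in> {0..T}" for \<tau>
    using sol that by (auto simp: solution_on_def)
  have conv: "(\<lambda>n. U \<tau> ((deriv ^^ j) (f n))) \<longlonglongrightarrow> U \<tau> ((deriv ^^ j) \<psi>)" if "\<tau> \<in> {0..T}" for \<tau> j
    by (rule sobolev_dual_tendsto(1)[OF dual[OF that] rf r\<psi>])
       (use lim dom in \<open>auto simp: funpow_deriv_add\<close>)
  have "0 \<in> {0..T}" using t by auto
  have "\<forall>j. \<exists>B. \<forall>n. sobolev_norm m ((deriv ^^ j) (f n)) \<le> B"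
  proof
    fix j
    show "\<exists>B. \<forall>n. sobolev_norm m ((deriv ^^ j) (f n)) \<le> B"
      by (rule sobolev_dual_tendsto(2)[OF dual[OF \<open>0 \<in> {0..T}\<close>] rf r\<psi>[of j]])
         (use lim dom in \<open>auto simp: funpow_deriv_add\<close>)
  qed
  then obtain B where B: "\<And>j n. sobolev_norm m ((deriv ^^ j) (f n)) \<le> B j" by metis
  obtain M where M: "M \<ge> 0" "\<And>\<tau> \<psi>. 0 < \<tau> \<Longrightarrow> \<tau> \<le> T \<Longrightarrow> quad_decay \<psi> \<Longrightarrow> \<bar>U \<tau> \<psi>\<bar> \<le> M * \<tau> powr (- \<alpha>) * sobolev_norm m \<psi>"
    using solution_on_dual_bound[OF sol] by metis
  define h where "h n \<tau> = indicator {0..t} \<tau> * ((d * U \<tau> ((deriv ^^ 2) (f n)) + a * U \<tau> (f n)) * (t - \<tau>) powr (\<alpha> - 1))" for n \<tau>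
  define h0 where "h0 \<tau> = indicator {0..t} \<tau> * ((d * U \<tau> ((deriv ^^ 2) \<psi>) + a * U \<tau> \<psi>) * (t - \<tau>) powr (\<alpha> - 1))" for \<tau>
  have hi: "integrable lborel (h n)" and he: "U t (f n) = f n 0 + 1 / Gamma \<alpha> * (LINT \<tau>|lborel. h n \<tau>)" for n
  proof -
    have e: "x / (t - \<tau>) powr (1 - \<alpha>) = x * (t - \<tau>) powr (\<alpha> - 1)" for x \<tau>
      using powr_minus[of "t - \<tau>" "1 - \<alpha>"] by (simp add: divide_inverse)
    have "t \<in> {0..T}" using t by simp
    with sol f[of n] have
      "set_integrable lborel {0..t} (\<lambda>\<tau>. (d * U \<tau> ((deriv ^^ 2) (f n)) + a * U \<tau> (f n)) / (t - \<tau>) powr (1 - \<alpha>))"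
      "U t (f n) = f n 0 + 1 / Gamma \<alpha> *
        (LINT \<tau>:{0..t}|lborel. (d * U \<tau> ((deriv ^^ 2) (f n)) + a * U \<tau> (f n)) / (t - \<tau>) powr (1 - \<alpha>))"
      unfolding solution_on_def by blast+
    thus "integrable lborel (h n)" "U t (f n) = f n 0 + 1 / Gamma \<alpha> * (LINT \<tau>|lborel. h n \<tau>)"
      unfolding set_integrable_def set_lebesgue_integral_def h_def[abs_def] e by simp_all
  qed
  have ptw: "(\<lambda>n. h n \<tau>) \<longlonglongrightarrow> h0 \<tau>" for \<tau>
  proof (cases "\<tau> \<in> {0..t}")
    case True
    hence "\<tau> \<in> {0..T}" using t by auto
    from conv[OF this, of 0] conv[OF this, of 2] show ?thesis
      unfolding h_def h0_def by (intro tendsto_intros) simp_all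
  qed (simp add: h_def h0_def)
  define w where "w \<tau> = (\<bar>d\<bar> * (M * B 2) + \<bar>a\<bar> * (M * B 0)) * (indicator {0..t} \<tau> * (\<tau> powr ((1 - \<alpha>) - 1) * (t - \<tau>) powr (\<alpha> - 1)))" for \<tau>
  have wi: "integrable lborel w" unfolding w_def
    using has_bochner_integral_Beta[of "1 - \<alpha>" \<alpha> t] \<alpha> t by (intro integrable_mult_right) (auto simp: has_bochner_integral_iff)
  have hw: "norm (h n \<tau>) \<le> w \<tau>" if "\<tau> \<noteq> 0" for n \<tau>
  proof (cases "\<tau> \<in> {0..t}")
    case True
    hence \<tau>: "0 < \<tau>" "\<tau> \<le> T" using that t by auto
    have b: "\<bar>U \<tau> ((deriv ^^ j) (f n))\<bar> \<le> (M * B j) * \<tau> powr (- \<alpha>)" for j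
    proof -
      have "\<bar>U \<tau> ((deriv ^^ j) (f n))\<bar> \<le> M * \<tau> powr (- \<alpha>) * sobolev_norm m ((deriv ^^ j) (f n))"
        by (rule M(2)[OF \<tau> rf])
      also have "\<dots> \<le> M * \<tau> powr (- \<alpha>) * B j" using M(1) B by (intro mult_left_mono) auto
      finally show ?thesis by (simp add: mult_ac)
    qed
    have "\<bar>d * U \<tau> ((deriv ^^ 2) (f n)) + a * U \<tau> (f n)\<bar> \<le>
        \<bar>d\<bar> * ((M * B 2) * \<tau> powr (- \<alpha>)) + \<bar>a\<bar> * ((M * B 0) * \<tau> powr (- \<alpha>))"
      using mult_left_mono[OF b[of 2], of "\<bar>d\<bar>"] mult_left_mono[OF b[of 0], of "\<bar>a\<bar>"]
        abs_triangle_ineq[of "d * U \<tau> ((deriv ^^ 2) (f n))" "a * U \<tau> (f n)"]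
      by (simp add: abs_mult)
    also have "\<dots> = (\<bar>d\<bar> * (M * B 2) + \<bar>a\<bar> * (M * B 0)) * \<tau> powr (- \<alpha>)" by (simp add: algebra_simps)
    finally have "\<bar>d * U \<tau> ((deriv ^^ 2) (f n)) + a * U \<tau> (f n)\<bar> * (t - \<tau>) powr (\<alpha> - 1) \<le>
      (\<bar>d\<bar> * (M * B 2) + \<bar>a\<bar> * (M * B 0)) * \<tau> powr (- \<alpha>) * (t - \<tau>) powr (\<alpha> - 1)"
      by (rule mult_right_mono) simp
    thus ?thesis using True by (simp add: h_def w_def abs_mult mult.assoc)
  qed (simp add: h_def w_def)
  have ae: "AE \<tau> in lborel. norm (h n \<tau>) \<le> w \<tau>" for n
    using AE_lborel_singleton[of 0] by eventually_elim (use hw in auto)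
  have h0m: "h0 \<in> borel_measurable lborel"
    by (rule borel_measurable_LIMSEQ_real[OF ptw]) (use hi in \<open>auto dest: borel_measurable_integrable\<close>)
  have hm: "h n \<in> borel_measurable lborel" for n using hi by (rule borel_measurable_integrable)
  show "integrable lborel (\<lambda>\<tau>. indicator {0..t} \<tau> * ((d * U \<tau> ((deriv ^^ 2) \<psi>) + a * U \<tau> \<psi>) * (t - \<tau>) powr (\<alpha> - 1)))"
    using integrable_dominated_convergence[OF h0m hm wi AE_I2[OF ptw] ae] by (simp add: h0_def[abs_def])
  have "(\<lambda>n. LINT \<tau>|lborel. h n \<tau>) \<longlonglongrightarrow> (LINT \<tau>|lborel. h0 \<tau>)"
    by (rule integral_dominated_convergence[OF h0m hm wi AE_I2[OF ptw] ae])
  hence "(\<lambda>n. f n 0 + 1 / Gamma \<alpha> * (LINT \<tau>|lborel. h n \<tau>)) \<longlonglongrightarrow> \<psi> 0 + 1 / Gamma \<alpha> * (LINT \<tau>|lborel. h0 \<tau>)"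
    using lim[of 0 0] by (intro tendsto_add tendsto_mult tendsto_const) simp_all
  moreover have "(\<lambda>n. U t (f n)) \<longlonglongrightarrow> U t \<psi>" using conv[of t 0] t by simp
  ultimately show "U t \<psi> = \<psi> 0 + 1 / Gamma \<alpha> *
       (LINT \<tau>|lborel. indicator {0..t} \<tau> * ((d * U \<tau> ((deriv ^^ 2) \<psi>) + a * U \<tau> \<psi>) * (t - \<tau>) powr (\<alpha> - 1)))"
    unfolding he[symmetric] h0_def[symmetric] by (rule LIMSEQ_unique[rotated])
qed

section \<open>Iterating the integral equation\<close>

lemma ml_remainder_tendsto_0:
  assumes \<alpha>: "0 < \<alpha>" "\<alpha> < 1"
  shows "(\<lambda>j. z ^ j / Gamma (1 - \<alpha> + real j * \<alpha>)) \<longlonglongrightarrow> 0"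
proof -
  have "(\<lambda>k. z ^ Suc k / Gamma (1 + real k * \<alpha>)) \<longlonglongrightarrow> 0"
    using tendsto_mult_right_zero[OF summable_LIMSEQ_zero[OF ml_summable[OF \<alpha>]], of z z] by simp
  moreover have "1 - \<alpha> + real (Suc k) * \<alpha> = 1 + real k * \<alpha>" for k by (simp add: algebra_simps)
  ultimately have "(\<lambda>k. z ^ Suc k / Gamma (1 - \<alpha> + real (Suc k) * \<alpha>)) \<longlonglongrightarrow> 0" by (simp only:)
  thus ?thesis by (subst filterlim_sequentially_Suc[symmetric])
qed

text \<open>Inserting the equation for \<open>F (n + 1)\<close> into the one for \<open>F n\<close> again and again produces the partial sums of the
  series. By induction the remainder after \<open>j\<close> steps is at most a constant times
  \<open>B ^ j * t powr (j * \<alpha> - \<alpha>) / Gamma (1 - \<alpha> + j * \<alpha>)\<close>, since fractional integrals of powers are again powers; this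
  tends to \<open>0\<close>.\<close>

lemma iterated_fractional_integral:
  fixes F :: "nat \<Rightarrow> real \<Rightarrow> real"
  assumes \<alpha>: "0 < \<alpha>" "\<alpha> < 1"
    and int: "\<And>n t. 0 < t \<Longrightarrow> t \<le> T \<Longrightarrow> integrable lborel (\<lambda>\<tau>. indicator {0..t} \<tau> * (F (Suc n) \<tau> * (t - \<tau>) powr (\<alpha> - 1)))"
    and eq: "\<And>n t. 0 < t \<Longrightarrow> t \<le> T \<Longrightarrow> F n t = c n + 1 / Gamma \<alpha> *
        (LINT \<tau>|lborel. indicator {0..t} \<tau> * (F (Suc n) \<tau> * (t - \<tau>) powr (\<alpha> - 1)))"
    and bnd: "\<And>n t. 0 < t \<Longrightarrow> t \<le> T \<Longrightarrow> \<bar>F n t\<bar> \<le> C * B ^ n * t powr (- \<alpha>)"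
    and t: "0 < t" "t \<le> T"
  shows "(\<lambda>k. c k * (t powr \<alpha>) ^ k / Gamma (1 + real k * \<alpha>)) sums F 0 t"
proof -
  define S where "S n j t = (\<Sum>k<j. c (n + k) * (t powr (real k * \<alpha>) / Gamma (1 + real k * \<alpha>)))" for n j t
  define g where "g j = 1 - \<alpha> + real j * \<alpha>" for j
  have g: "g j > 0" for j using \<alpha> unfolding g_def by (intro add_pos_nonneg) auto
  have GG: "Gamma (g j) > 0" for j by (rule Gamma_real_pos[OF g])
  have G\<alpha>: "Gamma \<alpha> > 0" using \<alpha> by (intro Gamma_real_pos)
  note G1 = ml_Gamma_pos[OF \<alpha>]
  have claim: "\<bar>F n t - S n j t\<bar> \<le> C * Gamma (1 - \<alpha>) * B ^ (n + j) * (t powr (g j - 1) / Gamma (g j))"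
    if "0 < t" "t \<le> T" for n j t
    using that
  proof (induction j arbitrary: n t)
    case 0
    have "Gamma (1 - \<alpha>) \<noteq> 0" using GG[of 0] by (simp add: g_def)
    thus ?case using bnd[OF 0, of n] by (simp add: S_def g_def)
  next
    case (Suc j)
    define I where "I k \<tau> = indicator {0..t} \<tau> * (\<tau> powr ((1 + real k * \<alpha>) - 1) * (t - \<tau>) powr (\<alpha> - 1))" for k \<tau>
    have e1: "1 + real k * \<alpha> + \<alpha> = 1 + real (Suc k) * \<alpha>" for k by (simp add: algebra_simps)
    have I: "has_bochner_integral lborel (I k) (Gamma \<alpha> * Gamma (1 + real k * \<alpha>) * (t powr (real (Suc k) * \<alpha>) / Gamma (1 + real (Suc k) * \<alpha>)))" for k
    proof -
      have "has_bochner_integral lborel (I k) (t powr (1 + real k * \<alpha> + \<alpha> - 1) * Beta (1 + real k * \<alpha>) \<alpha>)"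
        unfolding I_def[abs_def] by (rule has_bochner_integral_Beta) (use \<alpha> Suc.prems in \<open>auto intro!: add_pos_nonneg\<close>)
      thus ?thesis unfolding e1 Beta_def by (simp add: mult_ac)
    qed
    define SI where "SI \<tau> = (\<Sum>k<j. c (Suc n + k) / Gamma (1 + real k * \<alpha>) * I k \<tau>)" for \<tau>
    have SI: "has_bochner_integral lborel SI (\<Sum>k<j. c (Suc n + k) / Gamma (1 + real k * \<alpha>) *
        (Gamma \<alpha> * Gamma (1 + real k * \<alpha>) * (t powr (real (Suc k) * \<alpha>) / Gamma (1 + real (Suc k) * \<alpha>))))"
      unfolding SI_def[abs_def] by (intro has_bochner_integral_sum has_bochner_integral_mult_right I)
    have SIe: "SI \<tau> = indicator {0..t} \<tau> * (S (Suc n) j \<tau> * (t - \<tau>) powr (\<alpha> - 1))" for \<tau>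
      unfolding SI_def I_def S_def by (simp add: sum_distrib_left sum_distrib_right mult_ac)
    have SIv: "c n + 1 / Gamma \<alpha> * (LINT \<tau>|lborel. SI \<tau>) = S n (Suc j) t"
    proof -
      have "(LINT \<tau>|lborel. SI \<tau>) = Gamma \<alpha> * (\<Sum>k<j. c (n + Suc k) * (t powr (real (Suc k) * \<alpha>) / Gamma (1 + real (Suc k) * \<alpha>)))"
        unfolding has_bochner_integral_integral_eq[OF SI] sum_distrib_left
      proof (intro sum.cong refl)
        fix k
        show "c (Suc n + k) / Gamma (1 + real k * \<alpha>) * (Gamma \<alpha> * Gamma (1 + real k * \<alpha>) *
            (t powr (real (Suc k) * \<alpha>) / Gamma (1 + real (Suc k) * \<alpha>))) =
          Gamma \<alpha> * (c (n + Suc k) * (t powr (real (Suc k) * \<alpha>) / Gamma (1 + real (Suc k) * \<alpha>)))"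
          using G1[of k] by (simp del: of_nat_Suc)
      qed
      thus ?thesis unfolding S_def sum.lessThan_Suc_shift using G\<alpha> Suc.prems by (simp del: of_nat_Suc)
    qed
    define R where "R \<tau> = indicator {0..t} \<tau> * (F (Suc n) \<tau> * (t - \<tau>) powr (\<alpha> - 1)) - SI \<tau>" for \<tau>
    have Ri: "integrable lborel R" unfolding R_def[abs_def]
      using int[OF Suc.prems] SI by (intro Bochner_Integration.integrable_diff) (auto simp: has_bochner_integral_iff)
    have "F n t - S n (Suc j) t = 1 / Gamma \<alpha> * (LINT \<tau>|lborel. R \<tau>)"
      using eq[OF Suc.prems, of n] SIv int[OF Suc.prems, of n] SI unfolding R_def[abs_def]
      by (subst Bochner_Integration.integral_diff) (auto simp: has_bochner_integral_iff algebra_simps)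
    hence "\<bar>F n t - S n (Suc j) t\<bar> = 1 / Gamma \<alpha> * \<bar>LINT \<tau>|lborel. R \<tau>\<bar>" using G\<alpha> by (simp add: abs_mult)
    also have "\<bar>LINT \<tau>|lborel. R \<tau>\<bar> \<le> (LINT \<tau>|lborel. \<bar>R \<tau>\<bar>)" by (rule integral_abs_bound)
    also have "(LINT \<tau>|lborel. \<bar>R \<tau>\<bar>) \<le> (LINT \<tau>|lborel. C * Gamma (1 - \<alpha>) * B ^ (Suc n + j) / Gamma (g j) *
        (indicator {0..t} \<tau> * (\<tau> powr (g j - 1) * (t - \<tau>) powr (\<alpha> - 1))))"
    proof (rule integral_mono_AE)
      show "integrable lborel (\<lambda>\<tau>. \<bar>R \<tau>\<bar>)" using Ri by simp
      show "integrable lborel (\<lambda>\<tau>. C * Gamma (1 - \<alpha>) * B ^ (Suc n + j) / Gamma (g j) *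
        (indicator {0..t} \<tau> * (\<tau> powr (g j - 1) * (t - \<tau>) powr (\<alpha> - 1))))"
        using has_bochner_integral_Beta[OF g \<alpha>(1) Suc.prems(1), of j]
        by (intro integrable_mult_right) (auto simp: has_bochner_integral_iff)
      show "AE \<tau> in lborel. \<bar>R \<tau>\<bar> \<le> C * Gamma (1 - \<alpha>) * B ^ (Suc n + j) / Gamma (g j) *
        (indicator {0..t} \<tau> * (\<tau> powr (g j - 1) * (t - \<tau>) powr (\<alpha> - 1)))"
        using AE_lborel_singleton[of 0]
      proof eventually_elim
        case (elim \<tau>)
        show ?case
        proof (cases "\<tau> \<in> {0..t}")
          case True
          hence "0 < \<tau>" "\<tau> \<le> T" using elim Suc.prems by auto
          from mult_right_mono[OF Suc.IH[OF this, of "Suc n"], of "(t - \<tau>) powr (\<alpha> - 1)"]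
          show ?thesis using True unfolding R_def SIe
            by (simp add: left_diff_distrib[symmetric] abs_mult mult_ac)
        qed (simp add: R_def SIe)
      qed
    qed
    also have "\<dots> = C * Gamma (1 - \<alpha>) * B ^ (Suc n + j) / Gamma (g j) * (t powr (g j + \<alpha> - 1) * Beta (g j) \<alpha>)"
      using has_bochner_integral_Beta[OF g \<alpha>(1) Suc.prems(1), of j]
      by (simp add: has_bochner_integral_iff)
    also have "1 / Gamma \<alpha> * \<dots> = C * Gamma (1 - \<alpha>) * B ^ (n + Suc j) * (t powr (g (Suc j) - 1) / Gamma (g (Suc j)))"
    proof -
      have e: "g j + \<alpha> = g (Suc j)" by (simp add: g_def algebra_simps)
      show ?thesis unfolding e Beta_def using GG[of j] G\<alpha> by simp
    qed
    finally show ?case using G\<alpha> by (simp add: mult_left_mono divide_right_mono)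
  qed
  have "(\<lambda>j. F 0 t - S 0 j t) \<longlonglongrightarrow> 0"
  proof (rule Lim_null_comparison)
    show "eventually (\<lambda>j. norm (F 0 t - S 0 j t) \<le> C * Gamma (1 - \<alpha>) * t powr (- \<alpha>) * ((B * t powr \<alpha>) ^ j / Gamma (g j))) sequentially"
    proof (intro always_eventually allI)
      fix j
      have "t powr (g j - 1) = t powr (- \<alpha>) * (t powr \<alpha>) ^ j"
        using powr_mult_nat[OF \<alpha> t(1), of j] by (simp add: g_def powr_add[symmetric])
      thus "norm (F 0 t - S 0 j t) \<le> C * Gamma (1 - \<alpha>) * t powr (- \<alpha>) * ((B * t powr \<alpha>) ^ j / Gamma (g j))"
        using claim[OF t, of 0 j] by (simp add: power_mult_distrib mult_ac)
    qed
    show "(\<lambda>j. C * Gamma (1 - \<alpha>) * t powr (- \<alpha>) * ((B * t powr \<alpha>) ^ j / Gamma (g j))) \<longlonglongrightarrow> 0"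
      unfolding g_def by (rule tendsto_mult_right_zero[OF ml_remainder_tendsto_0[OF \<alpha>]])
  qed
  hence "(\<lambda>j. F 0 t - (F 0 t - S 0 j t)) \<longlonglongrightarrow> F 0 t - 0" by (intro tendsto_diff tendsto_const)
  hence "(\<lambda>j. S 0 j t) \<longlonglongrightarrow> F 0 t" by simp
  thus ?thesis unfolding sums_def S_def using powr_mult_nat[OF \<alpha> t(1)] by simp
qed

section \<open>Identification of the solution\<close>

lemma series_integral_swap:
  fixes f :: "nat \<Rightarrow> real \<Rightarrow> real"
  assumes m: "\<And>k. f k \<in> borel_measurable lborel" and w: "integrable lborel w"
    and b: "\<And>k x. \<bar>f k x\<bar> \<le> w x * b k" "summable b"
  shows "(\<lambda>k. LINT x|lborel. f k x) sums (LINT x|lborel. (\<Sum>k. f k x))"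
    and "\<bar>LINT x|lborel. f k x\<bar> \<le> (LINT x|lborel. w x) * b k"
proof -
  have le: "norm (f k x) \<le> norm (w x * b k)" for k x using b(1)[of k x] by simp
  have fi: "integrable lborel (f k)" for k
    by (rule Bochner_Integration.integrable_bound[OF integrable_mult_left[OF w, of "b k"] m AE_I2[OF le]])
  have fa: "(LINT x|lborel. \<bar>f k x\<bar>) \<le> (LINT x|lborel. w x) * b k" for k
  proof -
    have "(LINT x|lborel. \<bar>f k x\<bar>) \<le> (LINT x|lborel. w x * b k)"
      by (rule integral_mono[OF _ integrable_mult_left[OF w]]) (use fi b in auto)
    thus ?thesis by simp
  qed
  have s1: "summable (\<lambda>k. norm (f k x))" for x
    by (rule summable_comparison_test'[OF summable_mult[OF b(2), of "w x"]]) (use b(1) in auto)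
  have s2: "summable (\<lambda>k. LINT x|lborel. norm (f k x))"
    by (rule summable_comparison_test'[OF summable_mult[OF b(2), of "LINT x|lborel. w x"]]) (use fa in auto)
  have ab: "\<bar>LINT x|lborel. f k x\<bar> \<le> (LINT x|lborel. \<bar>f k x\<bar>)" for k by (rule integral_abs_bound)
  have "summable (\<lambda>k. LINT x|lborel. f k x)"
    by (rule summable_comparison_test'[OF s2]) (use ab in auto)
  moreover have "(LINT x|lborel. (\<Sum>k. f k x)) = (\<Sum>k. LINT x|lborel. f k x)"
    by (rule integral_suminf[OF fi AE_I2[OF s1] s2])
  ultimately show "(\<lambda>k. LINT x|lborel. f k x) sums (LINT x|lborel. (\<Sum>k. f k x))"
    by (simp add: summable_sums)
  show "\<bar>LINT x|lborel. f k x\<bar> \<le> (LINT x|lborel. w x) * b k" using ab[of k] fa[of k] by linarith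
qed

text \<open>The two functions below are the cosine integral of \<open>\<eta> \<mapsto> E\<^sub>\<alpha>((a - d * \<eta>\<^sup>2) * z)\<close>, with and without the triangular
  cutoff at frequency \<open>\<omega>\<close> that belongs to the Fejer kernel. With \<open>\<eta> = 2 * pi * \<xi>\<close> the second is \<open>pi\<close> times the
  inverse Fourier integral of the fundamental solution.\<close>

definition band_limited_solution :: "real \<Rightarrow> real \<Rightarrow> real \<Rightarrow> real \<Rightarrow> real \<Rightarrow> real \<Rightarrow> real" where
  "band_limited_solution \<omega> \<alpha> d a z y =
     \<omega> * (LINT s|lborel. indicator {0..1} s * ((1 - s) * mittag_leffler \<alpha> ((a - d * (\<omega> * s)\<^sup>2) * z) * cos (\<omega> * y * s)))"

definition cosine_solution :: "real \<Rightarrow> real \<Rightarrow> real \<Rightarrow> real \<Rightarrow> real \<Rightarrow> real" where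
  "cosine_solution \<alpha> d a z y =
     (LINT \<eta>|lborel. indicator {0..} \<eta> * (mittag_leffler \<alpha> ((a - d * \<eta>\<^sup>2) * z) * cos (y * \<eta>)))"

text \<open>On the band-limited functions \<open>\<psi> n\<close> the spatial operator acts as a shift of \<open>n\<close>, so the integral equation can be
  iterated. It gives the pairing as a power series in \<open>t powr \<alpha>\<close> whose coefficients are integrals of the powers of the
  symbol \<open>a - d * (\<omega> * s)\<^sup>2\<close>, and summation under the integral sign yields \<open>E\<^sub>\<alpha>\<close>.\<close>

lemma solution_conv_band_kernel:
  assumes \<alpha>: "0 < \<alpha>" "\<alpha> < 1" and sol: "fundamental_solution m \<alpha> d a U"
    and t: "t > 0" and \<phi>: "\<phi> \<in> test_functions" and \<omega>: "\<omega> > 0"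
  shows "U t (conv \<phi> (band_kernel \<omega> a d 0 0)) =
         (LINT y|lborel. \<phi> y * band_limited_solution \<omega> \<alpha> d a (t powr \<alpha>) y)"
proof -
  have sol: "solution_on m \<alpha> d a t U" using sol t by (simp add: fundamental_solution_def)
  define \<psi> where "\<psi> n = conv \<phi> (band_kernel \<omega> a d n 0)" for n
  note ks = smooth_band_kernel[of \<omega> a d]
  have r: "quad_decay (\<psi> n)" for n unfolding \<psi>_def by (intro conv_quad_decay \<phi> band_kernel_quad_decay \<omega>)
  have d\<psi>: "(deriv ^^ j) (\<psi> n) = conv \<phi> (band_kernel \<omega> a d n j)" for j n
    unfolding \<psi>_def funpow_deriv_conv[OF \<phi> ks] funpow_deriv_band_kernel ..
  have ci: "integrable lborel (\<lambda>y. \<phi> y * band_kernel \<omega> a d n j (x - y))" for n j x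
    using conv_integrable[OF \<phi> smooth_deriv[OF ks, of j n]] by (simp add: funpow_deriv_band_kernel)
  have step: "\<psi> (Suc n) = (\<lambda>x. d * (deriv ^^ 2) (\<psi> n) x + a * \<psi> n x)" for n
  proof
    fix x
    have "d * conv \<phi> (band_kernel \<omega> a d n 2) x + a * conv \<phi> (band_kernel \<omega> a d n 0) x =
       (LINT y|lborel. d * (\<phi> y * band_kernel \<omega> a d n 2 (x - y)) + a * (\<phi> y * band_kernel \<omega> a d n 0 (x - y)))"
      unfolding conv_def using ci[of n 2 x] ci[of n 0 x] by simp
    also have "(\<lambda>y. d * (\<phi> y * band_kernel \<omega> a d n 2 (x - y)) + a * (\<phi> y * band_kernel \<omega> a d n 0 (x - y)))
       = (\<lambda>y. \<phi> y * band_kernel \<omega> a d (Suc n) 0 (x - y))"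
      unfolding band_kernel_operator[symmetric] by (simp add: algebra_simps)
    finally show "\<psi> (Suc n) x = d * (deriv ^^ 2) (\<psi> n) x + a * \<psi> n x"
      unfolding d\<psi> by (simp add: \<psi>_def conv_def)
  qed
  have Ustep: "d * U \<tau> ((deriv ^^ 2) (\<psi> n)) + a * U \<tau> (\<psi> n) = U \<tau> (\<psi> (Suc n))" if "\<tau> \<in> {0..t}" for \<tau> n
  proof -
    have l: "U \<tau> \<in> sobolev_dual m" using sol that by (simp add: solution_on_def)
    have r2: "quad_decay ((deriv ^^ 2) (\<psi> n))" by (rule quad_decay_deriv[OF r])
    show ?thesis unfolding step
      by (simp only: sobolev_dual_add[OF l quad_decay_cmult[OF r2] quad_decay_cmult[OF r]] sobolev_dual_cmult[OF l r2] sobolev_dual_cmult[OF l r])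
  qed
  obtain M where M: "M \<ge> 0" "\<And>\<tau> \<psi>. 0 < \<tau> \<Longrightarrow> \<tau> \<le> t \<Longrightarrow> quad_decay \<psi> \<Longrightarrow> \<bar>U \<tau> \<psi>\<bar> \<le> M * \<tau> powr (- \<alpha>) * sobolev_norm m \<psi>"
    using solution_on_dual_bound[OF sol] by metis
  obtain B A where BA: "B \<ge> 0" "\<And>j. A j \<ge> 0" "\<And>n j x. \<bar>band_kernel \<omega> a d n j x\<bar> \<le> A j * B ^ n / (1 + x\<^sup>2)"
    using band_kernel_bound[OF \<omega>, of a d] by metis
  obtain D where D: "D \<ge> 0" "\<And>g C x. smooth g \<Longrightarrow> C \<ge> 0 \<Longrightarrow> (\<And>x. \<bar>g x\<bar> \<le> C / (1 + x\<^sup>2)) \<Longrightarrow> \<bar>conv \<phi> g x\<bar> \<le> C * D / (1 + x\<^sup>2)"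
    using conv_bound[OF \<phi>] by metis
  define A' where "A' = (\<Sum>j\<le>m. A j)"
  have A': "A' \<ge> 0" "j \<le> m \<Longrightarrow> A j \<le> A'" for j
    unfolding A'_def using BA(2) by (auto intro: sum_nonneg member_le_sum)
  define \<Lambda> where "\<Lambda> = sqrt (real (Suc m) * (LINT x|lborel. 1 / (1 + x\<^sup>2)))"
  have N: "sobolev_norm m (\<psi> n) \<le> A' * D * \<Lambda> * B ^ n" for n
  proof -
    have "sobolev_norm m (\<psi> n) \<le> (A' * B ^ n * D) * \<Lambda>" unfolding \<Lambda>_def
    proof (rule quad_decay_sobolev_norm_le[OF r])
      show "0 \<le> A' * B ^ n * D" using A' BA D by simp
      fix k x assume k: "k \<le> m"
      show "\<bar>(deriv ^^ k) (\<psi> n) x\<bar> \<le> A' * B ^ n * D / (1 + x\<^sup>2)"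
        unfolding d\<psi>
      proof (rule D(2))
        show "smooth (band_kernel \<omega> a d n k)"
          using smooth_deriv[OF ks, of k n] by (simp add: funpow_deriv_band_kernel)
        show "0 \<le> A' * B ^ n" using A' BA by simp
        fix x
        have "A k * B ^ n / (1 + x\<^sup>2) \<le> A' * B ^ n / (1 + x\<^sup>2)"
          using A'(2)[OF k] BA one_plus_sq_pos[of x] by (intro divide_right_mono mult_right_mono) auto
        thus "\<bar>band_kernel \<omega> a d n k x\<bar> \<le> A' * B ^ n / (1 + x\<^sup>2)" using BA(3)[of n k x] by linarith
      qed
    qed
    thus ?thesis by (simp add: mult_ac)
  qed
  have sums1: "(\<lambda>k. \<psi> k 0 * (t powr \<alpha>) ^ k / Gamma (1 + real k * \<alpha>)) sums U t (\<psi> 0)"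
  proof (rule iterated_fractional_integral[OF \<alpha>, where F = "\<lambda>n \<tau>. U \<tau> (\<psi> n)" and T = t and B = B and C = "M * (A' * D * \<Lambda>)"])
    fix n \<tau> assume \<tau>: "0 < \<tau>" "\<tau> \<le> t"
    have e: "indicator {0..\<tau>} s * ((d * U s ((deriv ^^ 2) (\<psi> n)) + a * U s (\<psi> n)) * (\<tau> - s) powr (\<alpha> - 1))
       = indicator {0..\<tau>} s * (U s (\<psi> (Suc n)) * (\<tau> - s) powr (\<alpha> - 1))" for s
      using Ustep[of s n] \<tau> by (cases "s \<in> {0..\<tau>}") auto
    show "integrable lborel (\<lambda>s. indicator {0..\<tau>} s * (U s (\<psi> (Suc n)) * (\<tau> - s) powr (\<alpha> - 1)))"
      using solution_on_quad_decay(1)[OF sol \<alpha> \<tau> r[of n]] by (simp only: e)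
    show "U \<tau> (\<psi> n) = \<psi> n 0 + 1 / Gamma \<alpha> *
        (LINT s|lborel. indicator {0..\<tau>} s * (U s (\<psi> (Suc n)) * (\<tau> - s) powr (\<alpha> - 1)))"
      using solution_on_quad_decay(2)[OF sol \<alpha> \<tau> r[of n]] by (simp only: e)
    have "\<bar>U \<tau> (\<psi> n)\<bar> \<le> M * \<tau> powr (- \<alpha>) * sobolev_norm m (\<psi> n)" by (rule M(2)[OF \<tau> r])
    also have "\<dots> \<le> M * \<tau> powr (- \<alpha>) * (A' * D * \<Lambda> * B ^ n)"
      using M(1) N by (intro mult_left_mono) auto
    finally show "\<bar>U \<tau> (\<psi> n)\<bar> \<le> M * (A' * D * \<Lambda>) * B ^ n * \<tau> powr (- \<alpha>)" by (simp add: mult_ac)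
  qed (use t in auto)
  define z where "z = t powr \<alpha>"
  define P where "P s = a - d * (\<omega> * s)\<^sup>2" for s
  define B' where "B' = \<bar>a\<bar> + \<bar>d * \<omega>\<^sup>2\<bar>"
  have P: "\<bar>P s\<bar> \<le> B'" if "s \<in> {0..1}" for s
  proof -
    have "\<bar>d * \<omega>\<^sup>2\<bar> * s\<^sup>2 \<le> \<bar>d * \<omega>\<^sup>2\<bar> * 1" using that by (intro mult_left_mono power_le_one) auto
    moreover have "\<bar>d * (\<omega> * s)\<^sup>2\<bar> = \<bar>d * \<omega>\<^sup>2\<bar> * s\<^sup>2" by (simp add: power_mult_distrib abs_mult)
    ultimately show ?thesis unfolding P_def B'_def using abs_triangle_ineq4[of a "d * (\<omega> * s)\<^sup>2"] by linarith
  qed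
  have z: "z \<ge> 0" by (simp add: z_def)
  define b where "b k = (B' * z) ^ k / Gamma (1 + real k * \<alpha>)" for k
  have bs: "summable b" unfolding b_def by (rule ml_summable[OF \<alpha>])
  note G = ml_Gamma_pos[OF \<alpha>]
  define f where "f y k s = indicator {0..1} s * ((1 - s) * (P s * z) ^ k / Gamma (1 + real k * \<alpha>) * cos (\<omega> * y * s))" for y k s
  have fm: "f y k \<in> borel_measurable lborel" for y k unfolding f_def P_def by measurable
  have fb: "\<bar>f y k s\<bar> \<le> indicator {0..1} s * b k" for y k s
  proof (cases "s \<in> {0..1}")
    case True
    have "\<bar>(1 - s) * (P s * z) ^ k / Gamma (1 + real k * \<alpha>) * cos (\<omega> * y * s)\<bar>
       = \<bar>1 - s\<bar> * (\<bar>P s\<bar> * z) ^ k / Gamma (1 + real k * \<alpha>) * \<bar>cos (\<omega> * y * s)\<bar>"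
      using G[of k] z by (simp add: abs_mult power_abs)
    also have "\<dots> \<le> 1 * (B' * z) ^ k / Gamma (1 + real k * \<alpha>) * 1"
      using True P[OF True] G[of k] z
      by (intro mult_mono divide_right_mono power_mono mult_nonneg_nonneg divide_nonneg_nonneg zero_le_power) auto
    finally show ?thesis using True by (simp add: f_def b_def)
  qed (simp add: f_def)
  have w1: "integrable lborel (indicator {0..1} :: real \<Rightarrow> real)"
    by (rule integrable_real_indicator) auto
  define g where "g k y = \<omega> * (LINT s|lborel. f y k s)" for k y
  have fsum: "(\<Sum>k. f y k s) = indicator {0..1} s * ((1 - s) * mittag_leffler \<alpha> (P s * z) * cos (\<omega> * y * s))" for y s
  proof -
    have "(\<Sum>k. (P s * z) ^ k / Gamma (1 + real k * \<alpha>) * (indicator {0..1} s * (1 - s) * cos (\<omega> * y * s)))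
       = mittag_leffler \<alpha> (P s * z) * (indicator {0..1} s * (1 - s) * cos (\<omega> * y * s))"
      unfolding mittag_leffler_def by (rule suminf_mult2[symmetric]) (rule ml_summable[OF \<alpha>])
    thus ?thesis by (simp add: f_def mult_ac)
  qed
  have gs: "(\<lambda>k. g k y) sums band_limited_solution \<omega> \<alpha> d a z y" for y
  proof -
    have "(\<lambda>k. LINT s|lborel. f y k s) sums (LINT s|lborel. (\<Sum>k. f y k s))"
      by (rule series_integral_swap(1)[where f = "f y", OF fm w1 fb bs])
    from sums_mult[OF this, of \<omega>] show ?thesis
      unfolding g_def band_limited_solution_def fsum P_def .
  qed
  have gb: "\<bar>g k y\<bar> \<le> \<omega> * b k" for k y
  proof -
    have "\<bar>LINT s|lborel. f y k s\<bar> \<le> (LINT s|lborel. indicator {0..1::real} s) * b k"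
      by (rule series_integral_swap(2)[where f = "f y", OF fm w1 fb bs])
    thus ?thesis using \<omega> unfolding g_def by (simp add: abs_mult)
  qed
  have gk: "g k y = band_kernel \<omega> a d k 0 (- y) * (z ^ k / Gamma (1 + real k * \<alpha>))" for k y
  proof -
    have "integral {0..1} (\<lambda>s. band_symbol \<omega> a d k 0 s * cos (\<omega> * (- y) * s + real 0 * (pi / 2)))
      = (LINT s|lborel. indicator {0..1} s * (band_symbol \<omega> a d k 0 s * cos (\<omega> * (- y) * s + real 0 * (pi / 2))))"
      by (intro integral_Icc_lborel(2) continuous_intros band_symbol_continuous)
    moreover have "f y k s = (indicator {0..1} s * (band_symbol \<omega> a d k 0 s * cos (\<omega> * (- y) * s + real 0 * (pi / 2)))) * (z ^ k / Gamma (1 + real k * \<alpha>))" for s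
      by (simp add: f_def band_symbol_def P_def power_mult_distrib mult_ac)
    ultimately show ?thesis by (simp add: g_def band_kernel_def)
  qed
  have gm: "(\<lambda>y. \<phi> y * g k y) \<in> borel_measurable lborel" for k
  proof -
    have "integrable lborel (\<lambda>y. \<phi> y * band_kernel \<omega> a d k 0 (0 - y) * (z ^ k / Gamma (1 + real k * \<alpha>)))"
      by (rule integrable_mult_left[OF ci])
    hence "integrable lborel (\<lambda>y. \<phi> y * g k y)" unfolding gk by (simp add: mult.assoc)
    thus ?thesis by (rule borel_measurable_integrable)
  qed
  have wi: "integrable lborel (\<lambda>y. \<bar>\<phi> y\<bar>)" using test_integrable[OF \<phi>] by simp
  have "(\<lambda>k. LINT y|lborel. \<phi> y * g k y) sums (LINT y|lborel. (\<Sum>k. \<phi> y * g k y))"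
  proof (rule series_integral_swap(1)[OF gm wi])
    show "\<bar>\<phi> y * g k y\<bar> \<le> \<bar>\<phi> y\<bar> * (\<omega> * b k)" for k y
      unfolding abs_mult by (intro mult_left_mono gb) auto
    show "summable (\<lambda>k. \<omega> * b k)" by (rule summable_mult[OF bs])
  qed
  also have "(\<lambda>y. \<Sum>k. \<phi> y * g k y) = (\<lambda>y. \<phi> y * band_limited_solution \<omega> \<alpha> d a z y)"
  proof
    fix y
    show "(\<Sum>k. \<phi> y * g k y) = \<phi> y * band_limited_solution \<omega> \<alpha> d a z y"
      using suminf_mult[OF sums_summable[OF gs[of y]], of "\<phi> y"] sums_unique[OF gs[of y]] by simp
  qed
  also have "(\<lambda>k. LINT y|lborel. \<phi> y * g k y) = (\<lambda>k. \<psi> k 0 * (t powr \<alpha>) ^ k / Gamma (1 + real k * \<alpha>))"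
  proof
    fix k
    have "(LINT y|lborel. \<phi> y * g k y) = (LINT y|lborel. (\<phi> y * band_kernel \<omega> a d k 0 (0 - y)) * (z ^ k / Gamma (1 + real k * \<alpha>)))"
      unfolding gk by (simp add: mult_ac)
    also have "\<dots> = conv \<phi> (band_kernel \<omega> a d k 0) 0 * (z ^ k / Gamma (1 + real k * \<alpha>))"
      unfolding conv_def by (rule integral_mult_left_zero)
    finally show "(LINT y|lborel. \<phi> y * g k y) = \<psi> k 0 * (t powr \<alpha>) ^ k / Gamma (1 + real k * \<alpha>)"
      by (simp add: \<psi>_def z_def)
  qed
  finally show ?thesis using sums1 sums_unique2 by (simp add: \<psi>_def z_def) blast
qed

lemma inverse_quadratic_bound:
  fixes G d a \<eta> :: real
  assumes "G > 0" "d > 0" "a > 0" "d * \<eta>\<^sup>2 \<ge> a"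
  shows "1 / (1 + (d * \<eta>\<^sup>2 - a) / G) \<le> (2 + 2 * a / d + 2 * G / d) / (1 + \<eta>\<^sup>2)"
proof -
  have den: "1 + (d * \<eta>\<^sup>2 - a) / G \<ge> 1" using assms by simp
  have "1 + \<eta>\<^sup>2 \<le> (2 + 2 * a / d + 2 * G / d) * (1 + (d * \<eta>\<^sup>2 - a) / G)"
  proof (cases "d * \<eta>\<^sup>2 \<le> 2 * a")
    case True
    hence "\<eta>\<^sup>2 \<le> 2 * a / d" using assms by (simp add: field_simps)
    hence "1 + \<eta>\<^sup>2 \<le> (2 + 2 * a / d + 2 * G / d) * 1" using assms by (simp add: add_increasing2)
    also have "\<dots> \<le> (2 + 2 * a / d + 2 * G / d) * (1 + (d * \<eta>\<^sup>2 - a) / G)"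
      using assms den by (intro mult_left_mono) auto
    finally show ?thesis .
  next
    case False
    have "\<eta>\<^sup>2 = (2 * G / d) * ((d * \<eta>\<^sup>2 / 2) / G)" using assms by simp
    also have "\<dots> \<le> (2 * G / d) * ((d * \<eta>\<^sup>2 - a) / G)"
      using assms False by (intro mult_left_mono divide_right_mono) auto
    also have "\<dots> \<le> (2 + 2 * a / d + 2 * G / d) * ((d * \<eta>\<^sup>2 - a) / G)"
      using assms by (intro mult_right_mono) auto
    finally have "\<eta>\<^sup>2 \<le> (2 + 2 * a / d + 2 * G / d) * ((d * \<eta>\<^sup>2 - a) / G)" .
    moreover have "1 \<le> 2 + 2 * a / d + 2 * G / d" using assms by (simp add: add_increasing2)
    ultimately show ?thesis by (simp add: distrib_left)
  qed
  thus ?thesis using den one_plus_sq_pos[of \<eta>] by (simp add: field_simps)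
qed

lemma ml_all_nonneg: "0 < \<alpha> \<Longrightarrow> \<alpha> < 1 \<Longrightarrow> mittag_leffler \<alpha> r \<ge> 0"
  using ml_nonneg[of \<alpha> r] ml_neg_bounds(1)[of \<alpha> "- r"] by (cases "r \<ge> 0") auto

text \<open>The decay of \<open>E\<^sub>\<alpha>\<close> on the negative axis makes the symbol integrable, with a bound that improves as \<open>z\<close> grows.\<close>

lemma ml_symbol_tail:
  assumes \<alpha>: "0 < \<alpha>" "\<alpha> < 1" and pos: "d > 0" "a > 0" "z > 0" and \<eta>: "d * \<eta>\<^sup>2 \<ge> a"
  shows "mittag_leffler \<alpha> ((a - d * \<eta>\<^sup>2) * z) \<le> (2 + 2 * a / d + 2 * (Gamma (1 + \<alpha>) / z) / d) / (1 + \<eta>\<^sup>2)"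
proof -
  have G: "Gamma (1 + \<alpha>) > 0" using \<alpha> by (intro Gamma_real_pos) auto
  have "(a - d * \<eta>\<^sup>2) * z = - ((d * \<eta>\<^sup>2 - a) * z)" by (simp add: algebra_simps)
  hence "mittag_leffler \<alpha> ((a - d * \<eta>\<^sup>2) * z) \<le> 1 / (1 + (d * \<eta>\<^sup>2 - a) * z / Gamma (1 + \<alpha>))"
    using ml_neg_bounds(2)[OF \<alpha>, of "(d * \<eta>\<^sup>2 - a) * z"] \<eta> pos by simp
  also have "(d * \<eta>\<^sup>2 - a) * z / Gamma (1 + \<alpha>) = (d * \<eta>\<^sup>2 - a) / (Gamma (1 + \<alpha>) / z)" by simp
  also have "1 / (1 + (d * \<eta>\<^sup>2 - a) / (Gamma (1 + \<alpha>) / z)) \<le> (2 + 2 * a / d + 2 * (Gamma (1 + \<alpha>) / z) / d) / (1 + \<eta>\<^sup>2)"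
    by (rule inverse_quadratic_bound) (use G pos \<eta> in auto)
  finally show ?thesis .
qed

lemma ml_symbol_continuous:
  assumes \<alpha>: "0 < \<alpha>" "\<alpha> < 1"
  shows "continuous_on A (\<lambda>\<eta>. mittag_leffler \<alpha> ((a - d * \<eta>\<^sup>2) * z))"
  by (rule continuous_on_compose2[OF ml_continuous[OF \<alpha>, of UNIV]]) (auto intro!: continuous_intros)

lemma ml_symbol_integrable:
  assumes \<alpha>: "0 < \<alpha>" "\<alpha> < 1" and pos: "d > 0" "a > 0" "z > 0"
  shows "integrable lborel (\<lambda>\<eta>. mittag_leffler \<alpha> ((a - d * \<eta>\<^sup>2) * z))"
proof -
  define C where "C = 2 + 2 * a / d + 2 * (Gamma (1 + \<alpha>) / z) / d"
  define C' where "C' = mittag_leffler \<alpha> (a * z) * (1 + a / d)"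
  have G: "Gamma (1 + \<alpha>) > 0" using \<alpha> by (intro Gamma_real_pos) auto
  have C: "C \<ge> 0" using G pos by (simp add: C_def)
  have C': "C' \<ge> 0" using ml_nonneg[OF \<alpha>, of "a * z"] pos by (simp add: C'_def)
  have bd: "mittag_leffler \<alpha> ((a - d * \<eta>\<^sup>2) * z) \<le> (C + C') * (1 / (1 + \<eta>\<^sup>2))" for \<eta>
  proof (cases "d * \<eta>\<^sup>2 \<ge> a")
    case True
    have "mittag_leffler \<alpha> ((a - d * \<eta>\<^sup>2) * z) \<le> C / (1 + \<eta>\<^sup>2)"
      unfolding C_def by (rule ml_symbol_tail[OF \<alpha> pos True])
    also have "\<dots> \<le> (C + C') / (1 + \<eta>\<^sup>2)" using C' one_plus_sq_pos[of \<eta>] by (intro divide_right_mono) auto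
    finally show ?thesis by simp
  next
    case False
    have "mittag_leffler \<alpha> ((a - d * \<eta>\<^sup>2) * z) \<le> mittag_leffler \<alpha> (a * z)"
      using False pos by (intro ml_mono[OF \<alpha>] mult_right_mono mult_nonneg_nonneg) auto
    also have "\<dots> \<le> C' / (1 + \<eta>\<^sup>2)"
    proof -
      have "\<eta>\<^sup>2 \<le> a / d" using False pos by (simp add: field_simps)
      hence "mittag_leffler \<alpha> (a * z) * (1 + \<eta>\<^sup>2) \<le> C'" unfolding C'_def
        using ml_nonneg[OF \<alpha>, of "a * z"] pos by (intro mult_left_mono) auto
      thus ?thesis using one_plus_sq_pos[of \<eta>] by (simp add: pos_le_divide_eq)
    qed
    also have "\<dots> \<le> (C + C') / (1 + \<eta>\<^sup>2)" using C one_plus_sq_pos[of \<eta>] by (intro divide_right_mono) auto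
    finally show ?thesis by simp
  qed
  show ?thesis
  proof (rule Bochner_Integration.integrable_bound)
    show "integrable lborel (\<lambda>\<eta>. (C + C') * (1 / (1 + \<eta>\<^sup>2)))"
      by (intro integrable_mult_right integrable_inverse_1_plus_sq)
    show "(\<lambda>\<eta>. mittag_leffler \<alpha> ((a - d * \<eta>\<^sup>2) * z)) \<in> borel_measurable lborel"
      using borel_measurable_continuous_onI[OF ml_symbol_continuous[OF \<alpha>]] by simp
    show "AE \<eta> in lborel. norm (mittag_leffler \<alpha> ((a - d * \<eta>\<^sup>2) * z)) \<le> norm ((C + C') * (1 / (1 + \<eta>\<^sup>2)))"
    proof (rule AE_I2)
      fix \<eta>
      show "norm (mittag_leffler \<alpha> ((a - d * \<eta>\<^sup>2) * z)) \<le> norm ((C + C') * (1 / (1 + \<eta>\<^sup>2)))"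
        using bd[of \<eta>] ml_all_nonneg[OF \<alpha>, of "(a - d * \<eta>\<^sup>2) * z"] C C' by simp
    qed
  qed
qed

lemma band_limited_solution_eq:
  assumes "\<omega> > 0"
  shows "band_limited_solution \<omega> \<alpha> d a z y =
    (LINT \<eta>|lborel. indicator {0..\<omega>} \<eta> * ((1 - \<eta> / \<omega>) * mittag_leffler \<alpha> ((a - d * \<eta>\<^sup>2) * z) * cos (y * \<eta>)))"
proof -
  define f where "f s = indicator {0..1} s * ((1 - s) * mittag_leffler \<alpha> ((a - d * (\<omega> * s)\<^sup>2) * z) * cos (\<omega> * y * s))" for s
  have "(LINT s|lborel. f s) = \<bar>1 / \<omega>\<bar> *\<^sub>R (LINT \<eta>|lborel. f (0 + 1 / \<omega> * \<eta>))"
    by (rule lborel_integral_real_affine) (use assms in simp)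
  also have "(\<lambda>\<eta>. f (0 + 1 / \<omega> * \<eta>)) =
     (\<lambda>\<eta>. indicator {0..\<omega>} \<eta> * ((1 - \<eta> / \<omega>) * mittag_leffler \<alpha> ((a - d * \<eta>\<^sup>2) * z) * cos (y * \<eta>)))"
  proof
    fix \<eta> :: real
    have "indicator {0..1} (\<eta> / \<omega>) = (indicator {0..\<omega>} \<eta> :: real)"
      using assms by (simp add: indicator_def field_simps)
    moreover have "\<omega> * y * (\<eta> / \<omega>) = y * \<eta>" "\<omega> * (\<eta> / \<omega>) = \<eta>" using assms by auto
    ultimately show "f (0 + 1 / \<omega> * \<eta>) =
      indicator {0..\<omega>} \<eta> * ((1 - \<eta> / \<omega>) * mittag_leffler \<alpha> ((a - d * \<eta>\<^sup>2) * z) * cos (y * \<eta>))"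
      by (simp add: f_def)
  qed
  finally show ?thesis using assms by (simp add: band_limited_solution_def f_def)
qed

lemma continuous_test_integrable:
  assumes f: "continuous_on UNIV f" and \<phi>: "\<phi> \<in> test_functions"
  shows "integrable lborel (\<lambda>x. f x * \<phi> x)"
proof -
  obtain S where S: "S > 0" "\<And>k x. \<bar>x\<bar> > S \<Longrightarrow> (deriv ^^ k) \<phi> x = 0"
    using test_support[OF \<phi>] by blast
  have "continuous_on UNIV (\<lambda>x. f x * \<phi> x)"
    using smooth_continuous[OF test_smooth[OF \<phi>], of UNIV 0] by (intro continuous_on_mult f) simp
  hence "continuous_on {-S..S} (\<lambda>x. f x * \<phi> x)" by (rule continuous_on_subset) simp
  hence "integrable lborel (\<lambda>x. indicator {-S..S} x * (f x * \<phi> x))"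
    by (rule integral_Icc_lborel(1))
  also have "(\<lambda>x. indicator {-S..S} x * (f x * \<phi> x)) = (\<lambda>x. f x * \<phi> x)"
  proof
    fix x show "indicator {-S..S} x * (f x * \<phi> x) = f x * \<phi> x"
      using S(2)[of x 0] by (cases "\<bar>x\<bar> > S") (auto simp: indicator_def)
  qed
  finally show ?thesis .
qed

lemma continuous_AE_zero:
  fixes h :: "real \<Rightarrow> real"
  assumes h: "continuous_on UNIV h" and ae: "AE x in lborel. h x = 0"
  shows "h x = 0"
proof (rule ccontr)
  assume nz: "h x \<noteq> 0"
  have op: "open {y. h y \<noteq> 0}" using h by (intro open_Collect_neq continuous_on_const)
  then obtain e where e: "e > 0" "ball x e \<subseteq> {y. h y \<noteq> 0}" using nz by (auto elim: openE)
  have "{x<..<x + e} \<subseteq> ball x e" by (auto simp: dist_real_def)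
  hence sub: "{x<..<x + e} \<subseteq> {y. h y \<noteq> 0}" using e by blast
  have "{y. h y \<noteq> 0} \<in> sets lborel" using borel_open[OF op] by simp
  hence "{y. h y \<noteq> 0} \<in> null_sets lborel" using AE_iff_null_sets[of "{y. h y \<noteq> 0}" lborel] ae by simp
  hence "{x<..<x + e} \<in> null_sets lborel"
    by (rule null_sets_subset) (use sub in auto)
  thus False using e by (auto simp: null_sets_def)
qed

text \<open>Any test function \<open>\<phi>\<close> is, up to the factor \<open>fejer_mass\<close>, the limit of the band-limited functions on which the solution
  is known. So \<open>fejer_mass * u\<close> and the cosine integral agree as distributions, and both are continuous.\<close>

lemma fejer_mass_times_solution:
  assumes \<alpha>: "0 < \<alpha>" "\<alpha> < 1" and pos: "d > 0" "a > 0"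
    and sol: "fundamental_solution m \<alpha> d a U" and u: "pointwise_values U u" and t: "t > 0"
  shows "fejer_mass * u x t = cosine_solution \<alpha> d a (t powr \<alpha>) x"
proof -
  define z where "z = t powr \<alpha>"
  have z: "z > 0" using t by (simp add: z_def)
  define E where "E \<eta> = mittag_leffler \<alpha> ((a - d * \<eta>\<^sup>2) * z)" for \<eta>
  have E0: "E \<eta> \<ge> 0" for \<eta> unfolding E_def by (rule ml_all_nonneg[OF \<alpha>])
  have Ei: "integrable lborel E" unfolding E_def by (rule ml_symbol_integrable[OF \<alpha> pos z])
  have [measurable]: "E \<in> borel_measurable borel" using borel_measurable_integrable[OF Ei] by simp
  define V where "V y = (LINT \<eta>|lborel. indicator {0..} \<eta> * (E \<eta> * cos (y * \<eta>)))" for y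
  define v where "v n y = (LINT \<eta>|lborel. indicator {0..real (Suc n)} \<eta> * ((1 - \<eta> / real (Suc n)) * E \<eta> * cos (y * \<eta>)))" for n y
  have v: "band_limited_solution (real (Suc n)) \<alpha> d a z y = v n y" for n y
    unfolding v_def E_def by (rule band_limited_solution_eq) simp
  have cb: "\<bar>c * e * cos w\<bar> \<le> e" if "0 \<le> c" "c \<le> 1" "0 \<le> e" for c e w :: real
  proof -
    have "\<bar>c * e * cos w\<bar> \<le> 1 * e * 1" unfolding abs_mult
      using that by (intro mult_mono mult_nonneg_nonneg) auto
    thus ?thesis by simp
  qed
  have dom: "norm (indicator {0..real (Suc n)} \<eta> * ((1 - \<eta> / real (Suc n)) * E \<eta> * cos (y * \<eta>))) \<le> E \<eta>" for n \<eta> y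
  proof (cases "\<eta> \<in> {0..real (Suc n)}")
    case True
    thus ?thesis using cb[of "1 - \<eta> / real (Suc n)" "E \<eta>" "y * \<eta>"] E0[of \<eta>] by simp
  qed (use E0 in simp)
  have lim: "(\<lambda>n. v n y) \<longlonglongrightarrow> V y" for y
    unfolding v_def V_def
  proof (rule integral_dominated_convergence[OF _ _ Ei])
    show "AE \<eta> in lborel. (\<lambda>n. indicator {0..real (Suc n)} \<eta> * ((1 - \<eta> / real (Suc n)) * E \<eta> * cos (y * \<eta>)))
        \<longlonglongrightarrow> indicator {0..} \<eta> * (E \<eta> * cos (y * \<eta>))"
    proof (rule AE_I2)
      fix \<eta> :: real
      have "eventually (\<lambda>n. \<eta> \<le> real (Suc n)) sequentially"
      proof -
        obtain N where N: "\<eta> \<le> real N" using real_arch_simple by blast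
        show ?thesis using eventually_ge_at_top[of N] by eventually_elim (use N in auto)
      qed
      hence "eventually (\<lambda>n. indicator {0..} \<eta> = (indicator {0..real (Suc n)} \<eta> :: real)) sequentially"
        by eventually_elim (auto simp: indicator_def)
      hence "(\<lambda>n. indicator {0..real (Suc n)} \<eta>) \<longlonglongrightarrow> (indicator {0..} \<eta> :: real)"
        by (rule tendsto_cong[THEN iffD1]) simp
      moreover have "(\<lambda>n. 1 - \<eta> * inverse (real (Suc n))) \<longlonglongrightarrow> 1 - 0"
        by (intro tendsto_diff tendsto_const tendsto_mult_right_zero[OF LIMSEQ_inverse_real_of_nat])
      ultimately have "(\<lambda>n. indicator {0..real (Suc n)} \<eta> * ((1 - \<eta> * inverse (real (Suc n))) * E \<eta> * cos (y * \<eta>)))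
        \<longlonglongrightarrow> indicator {0..} \<eta> * ((1 - 0) * E \<eta> * cos (y * \<eta>))"
        by (intro tendsto_mult tendsto_const)
      thus "(\<lambda>n. indicator {0..real (Suc n)} \<eta> * ((1 - \<eta> / real (Suc n)) * E \<eta> * cos (y * \<eta>)))
        \<longlonglongrightarrow> indicator {0..} \<eta> * (E \<eta> * cos (y * \<eta>))"
        by (simp add: divide_inverse)
    qed
  qed (use dom in \<open>auto simp del: of_nat_Suc\<close>)
  define I where "I = (LINT \<eta>|lborel. E \<eta>)"
  have vI: "\<bar>v n y\<bar> \<le> I" for n y
  proof -
    have "\<bar>v n y\<bar> \<le> (LINT \<eta>|lborel. norm (indicator {0..real (Suc n)} \<eta> * ((1 - \<eta> / real (Suc n)) * E \<eta> * cos (y * \<eta>))))"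
      unfolding v_def using integral_norm_bound by fastforce
    also have "\<dots> \<le> I" unfolding I_def
      by (rule integral_mono_AE'[OF Ei]) (use dom E0 in auto)
    finally show ?thesis .
  qed
  have vm: "v n \<in> borel_measurable borel" for n
    unfolding v_def[abs_def]
    by (rule sigma_finite_measure.borel_measurable_lebesgue_integral[OF sigma_finite_lborel]) measurable
  have Vm: "V \<in> borel_measurable borel"
    by (rule borel_measurable_LIMSEQ_real[OF lim vm])
  have main: "fejer_mass * (LINT y|lborel. u y t * \<phi> y) = (LINT y|lborel. \<phi> y * V y)" if \<phi>: "\<phi> \<in> test_functions" for \<phi>
  proof -
    have "U t \<in> sobolev_dual m" using sol t by (auto simp: fundamental_solution_def solution_on_def)
    from sobolev_dual_fejer_tendsto[OF this \<phi>, of a d]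
    have "(\<lambda>n. LINT y|lborel. \<phi> y * v n y) \<longlonglongrightarrow> fejer_mass * U t \<phi>"
      using solution_conv_band_kernel[OF \<alpha> sol t \<phi>] by (simp add: v z_def[symmetric] del: of_nat_Suc)
    moreover have "(\<lambda>n. LINT y|lborel. \<phi> y * v n y) \<longlonglongrightarrow> (LINT y|lborel. \<phi> y * V y)"
    proof (rule integral_dominated_convergence)
      have pm: "\<phi> \<in> borel_measurable borel" using smooth_measurable[OF test_smooth[OF \<phi>], of 0] by simp
      show "integrable lborel (\<lambda>y. \<bar>\<phi> y\<bar> * I)" using test_integrable[OF \<phi>] by (intro integrable_mult_left) simp
      show "AE y in lborel. norm (\<phi> y * v n y) \<le> \<bar>\<phi> y\<bar> * I" for n
        using vI by (intro AE_I2) (auto simp: abs_mult intro!: mult_left_mono)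
      show "AE y in lborel. (\<lambda>n. \<phi> y * v n y) \<longlonglongrightarrow> \<phi> y * V y"
        by (intro AE_I2 tendsto_mult tendsto_const lim)
      show "(\<lambda>y. \<phi> y * V y) \<in> borel_measurable lborel" "(\<lambda>y. \<phi> y * v n y) \<in> borel_measurable lborel" for n
        using pm Vm vm[of n] by simp_all
    qed
    moreover have "U t \<phi> = (LINT y|lborel. u y t * \<phi> y)"
      using u t \<phi> by (simp add: pointwise_values_def)
    ultimately show ?thesis using LIMSEQ_unique by metis
  qed
  have uc: "continuous_on UNIV (\<lambda>x. u x t)" using u t by (simp add: pointwise_values_def)
  have Vc: "continuous_on UNIV V"
    unfolding continuous_on_sequentially
  proof (intro allI ballI impI)
    fix y :: "nat \<Rightarrow> real" and y0 assume "(\<forall>n. y n \<in> UNIV) \<and> y \<longlonglongrightarrow> y0"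
    hence y: "y \<longlonglongrightarrow> y0" by simp
    show "(V \<circ> y) \<longlonglongrightarrow> V y0" unfolding comp_def V_def
    proof (rule integral_dominated_convergence[OF _ _ Ei])
      show "AE \<eta> in lborel. (\<lambda>n. indicator {0..} \<eta> * (E \<eta> * cos (y n * \<eta>))) \<longlonglongrightarrow> indicator {0..} \<eta> * (E \<eta> * cos (y0 * \<eta>))"
        by (intro AE_I2 tendsto_intros y)
      show "AE \<eta> in lborel. norm (indicator {0..} \<eta> * (E \<eta> * cos (y n * \<eta>))) \<le> E \<eta>" for n
        using cb[of 1 "E _"] E0 by (intro AE_I2) (auto simp: indicator_def)
    qed auto
  qed
  define h where "h x = fejer_mass * u x t - V x" for x
  have hc: "continuous_on UNIV h" unfolding h_def by (intro continuous_intros uc Vc)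
  have "AE x in lborel. h x = 0"
  proof (rule du_Bois_Reymond)
    show "set_integrable lborel {p..q} h" for p q by (rule continuous_set_integrable[OF hc])
    fix \<phi> assume \<phi>: "\<phi> \<in> test_functions"
    have "(LINT x|lborel. h x * \<phi> x) = (LINT x|lborel. fejer_mass * (u x t * \<phi> x) - V x * \<phi> x)"
      by (simp add: h_def algebra_simps)
    also have "\<dots> = fejer_mass * (LINT x|lborel. u x t * \<phi> x) - (LINT x|lborel. V x * \<phi> x)"
      using continuous_test_integrable[OF uc \<phi>] continuous_test_integrable[OF Vc \<phi>] by simp
    also have "\<dots> = 0" using main[OF \<phi>] by (simp add: mult.commute)
    finally show "(LINT x|lborel. h x * \<phi> x) = 0" .
  qed
  from continuous_AE_zero[OF hc this, of x] show ?thesis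
    by (simp add: h_def V_def cosine_solution_def E_def z_def)
qed

section \<open>The lower bound along the curve\<close>

lemma ml_growth:
  assumes \<alpha>: "0 < \<alpha>" "\<alpha> < 1" and half: "1 / 2 \<le> \<alpha>" and pos: "p > 0" "a > 0"
  shows "filterlim (\<lambda>t. p * t powr (-1/2) * mittag_leffler \<alpha> (a * t powr \<alpha>)) at_top at_top"
proof -
  define K where "K = p * (a\<^sup>2 / Gamma (1 + 2 * \<alpha>))"
  have "Gamma (1 + 2 * \<alpha>) > 0" using \<alpha> by (intro Gamma_real_pos) auto
  hence K: "K > 0" using pos by (simp add: K_def)
  define \<gamma> where "\<gamma> = 2 * \<alpha> - 1 / 2"
  have \<gamma>: "\<gamma> > 0" using half by (simp add: \<gamma>_def)
  have "filterlim (\<lambda>t. K * t powr \<gamma>) at_top at_top" using K \<gamma> by real_asymp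
  moreover have "eventually (\<lambda>t. K * t powr \<gamma> \<le> p * t powr (-1/2) * mittag_leffler \<alpha> (a * t powr \<alpha>)) at_top"
    using eventually_gt_at_top[of 0]
  proof eventually_elim
    case (elim t)
    have "(a * t powr \<alpha>) ^ 2 / Gamma (1 + real 2 * \<alpha>) \<le> mittag_leffler \<alpha> (a * t powr \<alpha>)"
      by (rule ml_ge_term[OF \<alpha>]) (use pos in auto)
    moreover have "(a * t powr \<alpha>) ^ 2 = a\<^sup>2 * t powr (2 * \<alpha>)"
      using elim powr_mult_nat[OF \<alpha>, of t 2] by (simp add: power_mult_distrib)
    ultimately have "a\<^sup>2 / Gamma (1 + 2 * \<alpha>) * t powr (2 * \<alpha>) \<le> mittag_leffler \<alpha> (a * t powr \<alpha>)" by simp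
    from mult_left_mono[OF this, of "p * t powr (-1/2)"]
    have "K * (t powr (-1/2) * t powr (2 * \<alpha>)) \<le> p * t powr (-1/2) * mittag_leffler \<alpha> (a * t powr \<alpha>)"
      using pos by (simp add: K_def mult_ac)
    thus ?case by (simp add: \<gamma>_def flip: powr_add)
  qed
  ultimately show ?thesis by (rule filterlim_at_top_mono)
qed

text \<open>Within the frequency window of width \<open>t powr (-1/2)\<close> the argument of \<open>E\<^sub>\<alpha>\<close> changes by a relative amount of order
  \<open>1 / t\<close>, while the index of the largest term is of order \<open>t\<close>.\<close>

lemma ml_symbol_lower_bound:
  assumes \<alpha>: "0 < \<alpha>" "\<alpha> < 1" and pos: "d > 0" "a > 0"
  obtains \<delta> where "\<delta> > 0" and "\<And>t \<eta>. t \<ge> 1 \<Longrightarrow> 0 \<le> \<eta> \<Longrightarrow> \<eta> \<le> \<delta> * t powr (-1/2) \<Longrightarrow>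
     mittag_leffler \<alpha> (a * t powr \<alpha>) / 4 \<le> mittag_leffler \<alpha> ((a - d * \<eta>\<^sup>2) * t powr \<alpha>)"
proof -
  define q where "q = (4 * a) powr (1 / \<alpha>) / \<alpha>"
  define M where "M = q + 1"
  have q: "q > 0" using \<alpha> pos by (simp add: q_def)
  have M: "M \<ge> 1" using q by (simp add: M_def)
  define \<delta> where "\<delta> = sqrt (a / (2 * M * d))"
  have \<delta>2: "\<delta>\<^sup>2 = a / (2 * M * d)" unfolding \<delta>_def using pos M by (intro real_sqrt_pow2) auto
  show ?thesis
  proof (rule that[of \<delta>])
    show "\<delta> > 0" using pos M by (simp add: \<delta>_def)
    fix t \<eta> :: real assume t: "t \<ge> 1" and \<eta>: "0 \<le> \<eta>" "\<eta> \<le> \<delta> * t powr (-1/2)"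
    define k1 where "k1 = nat \<lceil>q * t\<rceil>"
    have k1: "q * t \<le> real k1" "real k1 \<le> M * t"
    proof -
      have "q * t \<ge> 0" using q t by simp
      thus "q * t \<le> real k1" unfolding k1_def by linarith
      have "real k1 \<le> q * t + 1" unfolding k1_def using \<open>q * t \<ge> 0\<close> by linarith
      also have "\<dots> \<le> M * t" using t by (simp add: M_def distrib_right)
      finally show "real k1 \<le> M * t" .
    qed
    define \<epsilon> where "\<epsilon> = d * \<eta>\<^sup>2 / a"
    have "\<eta>\<^sup>2 \<le> (\<delta> * t powr (-1/2))\<^sup>2" using \<eta> by (intro power_mono) auto
    also have "\<dots> = \<delta>\<^sup>2 / t"
    proof -
      have "t powr (-1/2) * t powr (-1/2) = 1 / t" using t by (simp add: powr_minus_divide flip: powr_add)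
      moreover have "(\<delta> * t powr (-1/2))\<^sup>2 = \<delta>\<^sup>2 * (t powr (-1/2) * t powr (-1/2))"
        by (simp only: power2_eq_square mult_ac)
      ultimately show ?thesis by simp
    qed
    finally have "d * \<eta>\<^sup>2 / a \<le> d * (a / (2 * M * d) / t) / a"
      unfolding \<delta>2 using pos by (intro divide_right_mono mult_left_mono) auto
    also have "\<dots> = 1 / (2 * (M * t))" using pos by simp
    finally have \<epsilon>: "\<epsilon> \<le> 1 / (2 * (M * t))" unfolding \<epsilon>_def .
    have \<epsilon>0: "\<epsilon> \<ge> 0" using pos by (simp add: \<epsilon>_def)
    have Mt: "M * t \<ge> 1" using mult_mono[of 1 M 1 t] M t by simp
    have "mittag_leffler \<alpha> (a * t powr \<alpha>) / 4 \<le> mittag_leffler \<alpha> (a * t powr \<alpha> * (1 - \<epsilon>))"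
    proof (rule ml_perturb_lower[OF \<alpha>, where ?k1.0 = k1])
      have "4 * (a * t powr \<alpha>) = (q * t * \<alpha>) powr \<alpha>"
        using \<alpha> pos t by (simp add: q_def powr_mult powr_powr)
      also have "\<dots> \<le> (1 + real k1 * \<alpha>) powr \<alpha>"
      proof (rule powr_mono2)
        have "q * t * \<alpha> \<le> real k1 * \<alpha>" using k1 \<alpha> by (intro mult_right_mono) auto
        thus "q * t * \<alpha> \<le> 1 + real k1 * \<alpha>" by linarith
      qed (use \<alpha> q t in auto)
      finally show "4 * (a * t powr \<alpha>) \<le> (1 + real k1 * \<alpha>) powr \<alpha>" .
      have "1 / (2 * (M * t)) \<le> 1 / 2" using Mt by (simp add: field_simps)
      thus "\<epsilon> \<le> 1" using \<epsilon> by linarith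
      have "real k1 * \<epsilon> \<le> (M * t) * (1 / (2 * (M * t)))" using k1 \<epsilon> \<epsilon>0 by (intro mult_mono) auto
      also have "\<dots> = 1 / 2" using M t by simp
      finally show "real k1 * \<epsilon> \<le> 1 / 2" .
    qed (use pos \<epsilon>0 in auto)
    also have "a * t powr \<alpha> * (1 - \<epsilon>) = (a - d * \<eta>\<^sup>2) * t powr \<alpha>"
      using pos by (simp add: \<epsilon>_def algebra_simps)
    finally show "mittag_leffler \<alpha> (a * t powr \<alpha>) / 4 \<le> mittag_leffler \<alpha> ((a - d * \<eta>\<^sup>2) * t powr \<alpha>)" .
  qed
qed

text \<open>Frequencies above \<open>s\<close> lower the argument by the relative amount \<open>\<epsilon> = d * s\<^sup>2 / a\<close> at least, and the terms that matter have
  index at least \<open>\<mu> * t - 1\<close>.\<close>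

lemma ml_symbol_upper_bound:
  assumes \<alpha>: "0 < \<alpha>" "\<alpha> < 1" and pos: "d > 0" "a > 0"
  obtains \<mu> where "\<mu> > 0" and "\<And>t s \<eta>. t \<ge> 1 / \<mu> \<Longrightarrow> 0 \<le> s \<Longrightarrow> d * s\<^sup>2 \<le> a / 2 \<Longrightarrow> s \<le> \<eta> \<Longrightarrow> d * \<eta>\<^sup>2 \<le> a \<Longrightarrow>
     mittag_leffler \<alpha> ((a - d * \<eta>\<^sup>2) * t powr \<alpha>) \<le>
       2 * exp (- (d * s\<^sup>2 / a * (\<mu> * t - 1))) * mittag_leffler \<alpha> (a * t powr \<alpha>)"
proof -
  define q where "q = (a / 2) powr (1 / \<alpha>)"
  have q: "q > 0" using pos by (simp add: q_def)
  define \<mu> where "\<mu> = q / 4"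
  show ?thesis
  proof (rule that[of \<mu>])
    show \<mu>: "\<mu> > 0" using q by (simp add: \<mu>_def)
    fix t s \<eta> :: real
    assume t: "t \<ge> 1 / \<mu>" and s: "0 \<le> s" "d * s\<^sup>2 \<le> a / 2" "s \<le> \<eta>" and \<eta>: "d * \<eta>\<^sup>2 \<le> a"
    have t0: "t > 0" using t \<mu> by (meson less_le_trans zero_less_divide_1_iff)
    have \<mu>t: "\<mu> * t \<ge> 1" using t \<mu> by (simp add: field_simps)
    define k0 where "k0 = nat \<lfloor>\<mu> * t\<rfloor>"
    have k0: "real k0 \<le> \<mu> * t" "\<mu> * t - 1 \<le> real k0" unfolding k0_def using \<mu>t by linarith+
    define \<epsilon> where "\<epsilon> = d * s\<^sup>2 / a"
    have \<epsilon>: "0 \<le> \<epsilon>" "\<epsilon> \<le> 1 / 2" using pos s by (auto simp: \<epsilon>_def field_simps)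
    have "s\<^sup>2 \<le> \<eta>\<^sup>2" using s by (intro power_mono) auto
    hence "mittag_leffler \<alpha> ((a - d * \<eta>\<^sup>2) * t powr \<alpha>) \<le> mittag_leffler \<alpha> ((a - d * s\<^sup>2) * t powr \<alpha>)"
      using pos \<eta> by (intro ml_mono[OF \<alpha>] mult_right_mono) auto
    also have "(a - d * s\<^sup>2) * t powr \<alpha> = a * t powr \<alpha> * (1 - \<epsilon>)"
      using pos by (simp add: \<epsilon>_def algebra_simps)
    also have "mittag_leffler \<alpha> (a * t powr \<alpha> * (1 - \<epsilon>)) \<le> 2 * (1 - \<epsilon>) ^ k0 * mittag_leffler \<alpha> (a * t powr \<alpha>)"
    proof (rule ml_perturb_upper[OF \<alpha> _ _ \<epsilon>])
      have "1 + real (2 * k0) * \<alpha> \<le> \<mu> * t + 2 * (\<mu> * t) * 1"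
        using \<mu>t k0 \<alpha> by (intro add_mono mult_mono) auto
      also have "\<dots> \<le> q * t" using \<mu>t by (simp add: \<mu>_def)
      finally have "(1 + real (2 * k0) * \<alpha>) powr \<alpha> \<le> (q * t) powr \<alpha>"
        using \<alpha> by (intro powr_mono2) (auto intro: add_nonneg_nonneg)
      also have "\<dots> = a * t powr \<alpha> / 2" using \<alpha> pos t0 q by (simp add: q_def powr_mult powr_powr)
      finally show "(1 + real (2 * k0) * \<alpha>) powr \<alpha> \<le> a * t powr \<alpha> / 2" .
    qed (use pos in auto)
    also have "\<dots> \<le> 2 * exp (- (\<epsilon> * (\<mu> * t - 1))) * mittag_leffler \<alpha> (a * t powr \<alpha>)"
    proof (intro mult_right_mono mult_left_mono)
      have "(1 - \<epsilon>) ^ k0 \<le> exp (- \<epsilon>) ^ k0"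
        using \<epsilon> exp_ge_add_one_self[of "- \<epsilon>"] by (intro power_mono) auto
      also have "\<dots> = exp (- (\<epsilon> * real k0))" by (simp add: exp_of_nat_mult[symmetric] mult.commute)
      also have "\<dots> \<le> exp (- (\<epsilon> * (\<mu> * t - 1)))" using \<epsilon> k0 by (simp add: mult_left_mono)
      finally show "(1 - \<epsilon>) ^ k0 \<le> exp (- (\<epsilon> * (\<mu> * t - 1)))" .
    qed (use ml_nonneg[OF \<alpha>, of "a * t powr \<alpha>"] pos in auto)
    finally show "mittag_leffler \<alpha> ((a - d * \<eta>\<^sup>2) * t powr \<alpha>) \<le>
       2 * exp (- (d * s\<^sup>2 / a * (\<mu> * t - 1))) * mittag_leffler \<alpha> (a * t powr \<alpha>)"
      by (simp add: \<epsilon>_def)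
  qed
qed

text \<open>The integrand is compared with a step function. On the window of width \<open>\<delta> * t powr (-1/2)\<close> the angle \<open>y * \<eta>\<close> tends to
  \<open>0\<close> because \<open>\<beta> < 1 / 2\<close>, so the cosine is at least \<open>1 / 2\<close>. Up to \<open>s t\<close>, where the angle reaches \<open>pi / 2\<close>, the integrand is nonnegative.
  Frequencies between \<open>s t\<close> and \<open>sqrt (a / d)\<close> contribute at most a factor \<open>Q t\<close> that is exponentially small in
  \<open>t powr (1 - 2 * \<beta>)\<close>, and the frequencies with negative argument contribute a bounded amount.\<close>

lemma cosine_solution_lower_bound:
  assumes \<alpha>: "0 < \<alpha>" "\<alpha> < 1" and pos: "d > 0" "a > 0" "c > 0" and \<beta>: "0 < \<beta>" "\<beta> < 1 / 2"
    and half: "1 / 2 \<le> \<alpha>"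
  obtains \<delta> where "\<delta> > 0" and "eventually (\<lambda>t. cosine_solution \<alpha> d a (t powr \<alpha>) (c * t powr \<beta>)
     \<ge> \<delta> * t powr (-1/2) * mittag_leffler \<alpha> (a * t powr \<alpha>)) at_top"
proof -
  define E where "E t = mittag_leffler \<alpha> (a * t powr \<alpha>)" for t
  have E0: "E t \<ge> 0" for t unfolding E_def using pos by (intro ml_nonneg[OF \<alpha>]) auto
  obtain \<delta> where \<delta>: "\<delta> > 0" and low: "\<And>t \<eta>. t \<ge> 1 \<Longrightarrow> 0 \<le> \<eta> \<Longrightarrow> \<eta> \<le> \<delta> * t powr (-1/2) \<Longrightarrow>
     E t / 4 \<le> mittag_leffler \<alpha> ((a - d * \<eta>\<^sup>2) * t powr \<alpha>)"
    using ml_symbol_lower_bound[OF \<alpha> pos(1,2)] unfolding E_def by metis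
  obtain \<mu> where \<mu>: "\<mu> > 0" and up: "\<And>t s \<eta>. t \<ge> 1 / \<mu> \<Longrightarrow> 0 \<le> s \<Longrightarrow> d * s\<^sup>2 \<le> a / 2 \<Longrightarrow> s \<le> \<eta> \<Longrightarrow> d * \<eta>\<^sup>2 \<le> a \<Longrightarrow>
     mittag_leffler \<alpha> ((a - d * \<eta>\<^sup>2) * t powr \<alpha>) \<le> 2 * exp (- (d * s\<^sup>2 / a * (\<mu> * t - 1))) * E t"
    using ml_symbol_upper_bound[OF \<alpha> pos(1,2)] unfolding E_def by metis
  define s where "s t = pi / (2 * c) * t powr (- \<beta>)" for t
  define Q where "Q t = 2 * exp (- (d * (s t)\<^sup>2 / a * (\<mu> * t - 1)))" for t
  define S where "S = sqrt (a / d)"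
  define C1 where "C1 = 2 + 2 * a / d + 2 * Gamma (1 + \<alpha>) / d"
  define C2 where "C2 = C1 * (LINT \<eta>|lborel. 1 / (1 + \<eta>\<^sup>2))"
  have G: "Gamma (1 + \<alpha>) > 0" "Gamma (1 + 2 * \<alpha>) > 0" using \<alpha> by (auto intro!: Gamma_real_pos)
  have C1: "C1 \<ge> 0" using pos G by (simp add: C1_def)
  have S: "S \<ge> 0" "S\<^sup>2 = a / d" using pos by (auto simp: S_def)
  have Q0: "Q t \<ge> 0" for t by (simp add: Q_def)
  have bound: "\<delta> / 8 * t powr (-1/2) * E t - S * Q t * E t - C2
      \<le> cosine_solution \<alpha> d a (t powr \<alpha>) (c * t powr \<beta>)"
    if t: "t \<ge> 1" "t \<ge> 1 / \<mu>" and st: "d * (s t)\<^sup>2 \<le> a / 2" and ang: "c * t powr \<beta> * (\<delta> * t powr (-1/2)) \<le> pi / 3" for t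
  proof -
    define z where "z = t powr \<alpha>"
    define y where "y = c * t powr \<beta>"
    define x where "x = \<delta> * t powr (-1/2)"
    have z: "z \<ge> 1" unfolding z_def using t \<alpha> by (intro ge_one_powr_ge_zero) auto
    have y: "y > 0" using pos t by (simp add: y_def)
    have x: "x > 0" using \<delta> t by (simp add: x_def)
    have s0: "s t > 0" using pos t by (simp add: s_def)
    define e where "e \<eta> = mittag_leffler \<alpha> ((a - d * \<eta>\<^sup>2) * z)" for \<eta>
    have e0: "e \<eta> \<ge> 0" for \<eta> unfolding e_def by (rule ml_all_nonneg[OF \<alpha>])
    have ei: "integrable lborel e" unfolding e_def by (rule ml_symbol_integrable[OF \<alpha>]) (use pos z in auto)
    define g where "g \<eta> = E t / 8 * indicator {0..x} \<eta> - Q t * E t * indicator {0..S} \<eta> - C1 * (1 / (1 + \<eta>\<^sup>2))" for \<eta>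
    have tail: "0 \<le> C1 * (1 / (1 + \<eta>\<^sup>2))" for \<eta> using C1 one_plus_sq_pos[of \<eta>] by simp
    have QE: "Q t * E t * indicator {0..S} \<eta> \<ge> 0" for \<eta> using Q0 E0 by simp
    have pw: "g \<eta> \<le> indicator {0..} \<eta> * (e \<eta> * cos (y * \<eta>))" for \<eta>
    proof -
      have ge: "e \<eta> * cos (y * \<eta>) \<ge> - e \<eta>"
        using mult_left_mono[OF cos_ge_minus_one[of "y * \<eta>"] e0[of \<eta>]] by simp
      consider "\<eta> < 0" | "0 \<le> \<eta>" "\<eta> \<le> x" | "x < \<eta>" "\<eta> \<le> s t" | "x < \<eta>" "s t < \<eta>" "d * \<eta>\<^sup>2 \<le> a"
        | "x < \<eta>" "s t < \<eta>" "d * \<eta>\<^sup>2 > a" by linarith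
      thus ?thesis
      proof cases
        case 1
        thus ?thesis using tail[of \<eta>] by (simp add: g_def)
      next
        case 2
        have "y * \<eta> \<le> y * x" using 2 y by (intro mult_left_mono) auto
        also have "\<dots> \<le> pi / 3" using ang by (simp add: y_def x_def)
        finally have "cos (pi / 3) \<le> cos (y * \<eta>)" using 2 y by (intro cos_monotone_0_pi_le) auto
        hence "cos (y * \<eta>) \<ge> 1 / 2" by (simp add: cos_60)
        moreover have "e \<eta> \<ge> E t / 4" unfolding e_def z_def using low[OF t(1) 2(1)] 2(2) by (simp add: x_def)
        ultimately have "(E t / 4) * (1 / 2) \<le> e \<eta> * cos (y * \<eta>)"
          using E0[of t] by (intro mult_mono) auto
        moreover have "g \<eta> \<le> E t / 8"
        proof -
          have ind: "indicator {0..x} \<eta> = (1::real)" using 2 by simp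
          show ?thesis using tail[of \<eta>] QE[of \<eta>] unfolding g_def ind mult_1_right by linarith
        qed
        ultimately show ?thesis using 2 by simp
      next
        case 3
        have "y * \<eta> \<le> y * s t" using 3 y by (intro mult_left_mono) auto
        also have "y * s t = pi / 2" using pos t powr_add[of t \<beta> "- \<beta>"] by (simp add: y_def s_def)
        finally have "cos (y * \<eta>) \<ge> 0" using 3 x y by (intro cos_ge_zero) (auto intro: order_trans[of _ 0])
        hence "e \<eta> * cos (y * \<eta>) \<ge> 0" using e0 by simp
        moreover have "g \<eta> \<le> 0" using 3 tail[of \<eta>] QE[of \<eta>] by (simp add: g_def)
        ultimately show ?thesis using 3 x by simp
      next
        case 4
        have "e \<eta> \<le> Q t * E t" unfolding e_def z_def Q_def using up[of t "s t" \<eta>] t st s0 4 by simp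
        moreover have "\<eta> \<le> S" 
        proof -
          have "d * \<eta>\<^sup>2 \<le> d * S\<^sup>2" using 4 pos S by simp
          hence "\<eta>\<^sup>2 \<le> S\<^sup>2" using pos by simp
          thus ?thesis using S(1) by (rule power2_le_imp_le)
        qed
        hence "g \<eta> \<le> - (Q t * E t)" using 4 x tail[of \<eta>] by (simp add: g_def)
        ultimately show ?thesis using ge 4 x by simp
      next
        case 5
        have "e \<eta> \<le> (2 + 2 * a / d + 2 * (Gamma (1 + \<alpha>) / z) / d) / (1 + \<eta>\<^sup>2)"
          unfolding e_def by (rule ml_symbol_tail[OF \<alpha>]) (use pos z 5 in auto)
        also have "\<dots> \<le> C1 * (1 / (1 + \<eta>\<^sup>2))"
        proof -
          have "Gamma (1 + \<alpha>) / z \<le> Gamma (1 + \<alpha>) / 1" using G z by (intro divide_left_mono) auto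
          hence "2 * (Gamma (1 + \<alpha>) / z) / d \<le> 2 * Gamma (1 + \<alpha>) / d"
            using pos by (intro divide_right_mono) linarith+
          thus ?thesis using one_plus_sq_pos[of \<eta>] by (simp add: C1_def divide_right_mono)
        qed
        finally have "e \<eta> \<le> C1 * (1 / (1 + \<eta>\<^sup>2))" .
        moreover have "g \<eta> \<le> - (C1 * (1 / (1 + \<eta>\<^sup>2)))" using 5 QE[of \<eta>] by (simp add: g_def)
        ultimately have "g \<eta> \<le> e \<eta> * cos (y * \<eta>)" using ge by linarith
        thus ?thesis using 5 x by simp
      qed
    qed
    have ii: "has_bochner_integral lborel (indicator {0..r} :: real \<Rightarrow> real) r" if "r \<ge> 0" for r :: real
      using has_bochner_integral_real_indicator[of "{0..r}" lborel] that by simp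
    have gi: "has_bochner_integral lborel g (E t / 8 * x - Q t * E t * S - C1 * (LINT \<eta>|lborel. 1 / (1 + \<eta>\<^sup>2)))"
      unfolding g_def
      by (intro has_bochner_integral_diff has_bochner_integral_mult_right has_bochner_integral_integrable ii integrable_inverse_1_plus_sq)
         (use x S in auto)
    have "(LINT \<eta>|lborel. g \<eta>) \<le> (LINT \<eta>|lborel. indicator {0..} \<eta> * (e \<eta> * cos (y * \<eta>)))"
    proof (rule integral_mono[OF _ _ pw])
      show "integrable lborel g" using gi by (simp add: has_bochner_integral_iff)
      have [measurable]: "e \<in> borel_measurable borel" using borel_measurable_integrable[OF ei] by simp
      show "integrable lborel (\<lambda>\<eta>. indicator {0..} \<eta> * (e \<eta> * cos (y * \<eta>)))"
      proof (rule Bochner_Integration.integrable_bound[OF ei])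
        show "AE \<eta> in lborel. norm (indicator {0..} \<eta> * (e \<eta> * cos (y * \<eta>))) \<le> norm (e \<eta>)"
        proof (rule AE_I2)
          fix \<eta>
          have "\<bar>e \<eta>\<bar> * \<bar>cos (y * \<eta>)\<bar> \<le> \<bar>e \<eta>\<bar> * 1" by (intro mult_left_mono) auto
          thus "norm (indicator {0..} \<eta> * (e \<eta> * cos (y * \<eta>))) \<le> norm (e \<eta>)"
            by (auto simp: indicator_def abs_mult)
        qed
      qed measurable
    qed
    thus ?thesis using gi
      by (simp add: has_bochner_integral_iff cosine_solution_def e_def z_def y_def x_def C2_def mult_ac)
  qed
  have ev: "eventually (\<lambda>t. t \<ge> 1 \<and> t \<ge> 1 / \<mu>) at_top"
    by (intro eventually_conj eventually_ge_at_top)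
  have ev1: "eventually (\<lambda>t. d * (s t)\<^sup>2 \<le> a / 2) at_top"
  proof -
    have "((\<lambda>t. d * (pi / (2 * c) * t powr (- \<beta>))\<^sup>2) \<longlongrightarrow> d * (pi / (2 * c) * 0)\<^sup>2) at_top"
      by (intro tendsto_intros tendsto_neg_powr filterlim_ident) (use \<beta> in auto)
    hence "((\<lambda>t. d * (s t)\<^sup>2) \<longlongrightarrow> 0) at_top" by (simp add: s_def)
    thus ?thesis using pos by (auto dest!: order_tendstoD(2)[of _ _ _ "a / 2"] elim!: eventually_mono)
  qed
  have ev2: "eventually (\<lambda>t. c * t powr \<beta> * (\<delta> * t powr (-1/2)) \<le> pi / 3) at_top"
  proof -
    have "((\<lambda>t. c * \<delta> * t powr (\<beta> - 1/2)) \<longlongrightarrow> c * \<delta> * 0) at_top"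
      by (intro tendsto_intros tendsto_neg_powr filterlim_ident) (use \<beta> in auto)
    hence "eventually (\<lambda>t. c * \<delta> * t powr (\<beta> - 1/2) < pi / 3) at_top" by (rule order_tendstoD) simp
    thus ?thesis
    proof eventually_elim
      case (elim t)
      have "t powr (\<beta> - 1/2) = t powr \<beta> * t powr (-1/2)" using powr_add[of t \<beta> "-1/2"] by simp
      thus ?case using elim by (simp add: mult_ac)
    qed
  qed
  have ev3: "eventually (\<lambda>t. S * Q t \<le> \<delta> / 32 * t powr (-1/2)) at_top"
  proof -
    define A where "A = d * (pi / (2 * c))\<^sup>2 / a"
    have A: "A > 0" using pos by (simp add: A_def)
    define \<gamma> where "\<gamma> = 1 - 2 * \<beta>"
    have \<gamma>: "\<gamma> > 0" using \<beta> by (simp add: \<gamma>_def)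
    have "((\<lambda>t. S * (2 * exp (- (A * \<mu> / 2) * t powr \<gamma>)) * t powr (1/2)) \<longlongrightarrow> 0) at_top"
      using A \<mu> \<gamma> by real_asymp
    hence "eventually (\<lambda>t. S * (2 * exp (- (A * \<mu> / 2) * t powr \<gamma>)) * t powr (1/2) < \<delta> / 32) at_top"
      by (rule order_tendstoD) (use \<delta> in simp)
    with eventually_ge_at_top[of "2 / \<mu>"] show ?thesis
    proof eventually_elim
      case (elim t)
      have t: "t > 0" using elim \<mu> by (meson less_le_trans zero_less_divide_iff zero_less_numeral)
      have "\<mu> * t / 2 \<le> \<mu> * t - 1" using elim \<mu> by (simp add: field_simps)
      hence i: "A * t powr (- (2 * \<beta>)) * (\<mu> * t / 2) \<le> A * t powr (- (2 * \<beta>)) * (\<mu> * t - 1)"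
        using A by (intro mult_left_mono) auto
      have ii: "A * t powr (- (2 * \<beta>)) * (\<mu> * t / 2) = A * \<mu> / 2 * t powr \<gamma>"
        using t powr_add[of t 1 "- (2 * \<beta>)"] by (simp add: \<gamma>_def mult_ac)
      have iii: "d * (s t)\<^sup>2 / a = A * t powr (- (2 * \<beta>))"
      proof -
        have "(t powr (- \<beta>))\<^sup>2 = t powr (- (2 * \<beta>))"
          using t by (simp add: power2_eq_square flip: powr_add)
        hence "(s t)\<^sup>2 = (pi / (2 * c))\<^sup>2 * t powr (- (2 * \<beta>))"
          unfolding s_def by (simp only: power_mult_distrib)
        thus ?thesis by (simp add: A_def)
      qed
      have "A * \<mu> / 2 * t powr \<gamma> \<le> d * (s t)\<^sup>2 / a * (\<mu> * t - 1)"
        using i unfolding ii iii .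
      hence "Q t \<le> 2 * exp (- (A * \<mu> / 2) * t powr \<gamma>)" by (simp add: Q_def)
      hence "S * Q t * t powr (1/2) \<le> S * (2 * exp (- (A * \<mu> / 2) * t powr \<gamma>)) * t powr (1/2)"
        using S by (intro mult_right_mono mult_left_mono) auto
      hence le: "S * Q t * t powr (1/2) \<le> \<delta> / 32" using elim by linarith
      have one: "t powr (1/2) * t powr (-1/2) = 1" using t by (simp flip: powr_add)
      have "S * Q t = S * Q t * (t powr (1/2) * t powr (-1/2))" unfolding one by simp
      also have "\<dots> = (S * Q t * t powr (1/2)) * t powr (-1/2)" by (simp only: mult.assoc)
      also have "\<dots> \<le> \<delta> / 32 * t powr (-1/2)" by (intro mult_right_mono le) auto
      finally show ?case .
    qed
  qed
  have ev4: "eventually (\<lambda>t. C2 \<le> \<delta> / 32 * t powr (-1/2) * E t) at_top"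
    using ml_growth[OF \<alpha> half _ pos(2), of "\<delta> / 32"] \<delta> unfolding filterlim_at_top E_def by simp
  show ?thesis
  proof (rule that[of "\<delta> / 16"])
    show "\<delta> / 16 > 0" using \<delta> by simp
    show "eventually (\<lambda>t. cosine_solution \<alpha> d a (t powr \<alpha>) (c * t powr \<beta>)
       \<ge> \<delta> / 16 * t powr (-1/2) * mittag_leffler \<alpha> (a * t powr \<alpha>)) at_top"
      using ev ev1 ev2 ev3 ev4
    proof eventually_elim
      case (elim t)
      define p where "p = \<delta> * t powr (-1/2) * E t"
      have 1: "S * Q t * E t \<le> p / 32" using mult_right_mono[OF elim(4) E0[of t]] by (simp add: p_def)
      have 2: "C2 \<le> p / 32" using elim(5) by (simp add: p_def)
      have 3: "p / 8 - S * Q t * E t - C2 \<le> cosine_solution \<alpha> d a (t powr \<alpha>) (c * t powr \<beta>)"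
        using bound[of t] elim(1-3) by (simp add: p_def)
      have "p / 16 \<le> cosine_solution \<alpha> d a (t powr \<alpha>) (c * t powr \<beta>)" using 1 2 3 by linarith
      thus ?case by (simp add: p_def E_def)
    qed
  qed
qed

text \<open>The defect \<open>r\<close> is \<open>0\<close> where \<open>f\<close> is at least \<open>W\<close>, hence eventually, and makes the inequality an equality elsewhere.\<close>

lemma smallo_defect:
  fixes f W :: "real \<Rightarrow> real"
  assumes W: "\<And>t. t > 0 \<Longrightarrow> W t > 0" and ev: "eventually (\<lambda>t. f t \<ge> W t) at_top"
  shows "\<exists>r \<in> o[at_top](\<lambda>_. 1 :: real). \<forall>t>0. f t \<ge> W t * (1 - r t)"
proof
  define r where "r t = (if f t \<ge> W t then 0 else 1 - f t / W t)" for t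
  have "eventually (\<lambda>t. r t / 1 = 0) at_top" using ev by eventually_elim (simp add: r_def)
  hence "((\<lambda>t. r t / 1) \<longlongrightarrow> 0) at_top" by (rule tendsto_eventually)
  thus "r \<in> o[at_top](\<lambda>_. 1 :: real)" by (rule smalloI_tendsto) simp
  show "\<forall>t>0. f t \<ge> W t * (1 - r t)"
  proof (intro allI impI)
    fix t :: real assume "t > 0"
    from W[OF this] show "f t \<ge> W t * (1 - r t)" by (simp add: r_def)
  qed
qed

theorem theorem1p2:
  fixes \<alpha> d a \<beta> c :: real and m :: nat
    and U :: "real \<Rightarrow> (real \<Rightarrow> real) \<Rightarrow> real" and u :: "real \<Rightarrow> real \<Rightarrow> real"
  assumes "1/2 \<le> \<alpha>" "\<alpha> < 1" "d > 0" "a > 0"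
    and "real m > 1/2"
    and "fundamental_solution m \<alpha> d a U"
    and "pointwise_values U u"
    and "0 < \<beta>" "\<beta> < 1/2" "c > 0"
  shows "(\<exists>r \<in> o[at_top](\<lambda>_. 1 :: real). \<forall>t>0.
            u (c * t powr \<beta>) t
              \<ge> c * \<alpha> * t powr (\<beta> - 2 * \<alpha>) * mittag_leffler \<alpha> (a * t powr \<alpha>) * (1 - r t))
       \<and> (a \<ge> 1 \<longrightarrow> (\<exists>r \<in> o[at_top](\<lambda>_. 1 :: real). \<forall>t>0.
            u (c * t powr \<beta>) t
              \<ge> c * \<alpha> * t powr (\<beta> - 2 * \<alpha>) * mittag_leffler \<alpha> (t powr \<alpha>) * (1 - r t)))
       \<and> filterlim (\<lambda>t. u (c * t powr \<beta>) t) at_top at_top"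
proof -
  have \<alpha>: "0 < \<alpha>" "\<alpha> < 1" using assms by auto
  define E where "E b t = mittag_leffler \<alpha> (b * t powr \<alpha>)" for b t
  have Epos: "E b t > 0" if "b > 0" for b t unfolding E_def using that by (intro ml_pos[OF \<alpha>]) auto
  obtain \<delta> where \<delta>: "\<delta> > 0" and V: "eventually (\<lambda>t. cosine_solution \<alpha> d a (t powr \<alpha>) (c * t powr \<beta>)
     \<ge> \<delta> * t powr (-1/2) * E a t) at_top"
    unfolding E_def by (rule cosine_solution_lower_bound[OF \<alpha> assms(3,4,10,8,9,1)])
  define \<delta>' where "\<delta>' = \<delta> / fejer_mass"
  have \<delta>': "\<delta>' > 0" using \<delta> fejer_mass_pos by (simp add: \<delta>'_def)
  have u: "eventually (\<lambda>t. u (c * t powr \<beta>) t \<ge> \<delta>' * t powr (-1/2) * E a t) at_top"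
    using V eventually_gt_at_top[of 0]
  proof eventually_elim
    case (elim t)
    thus ?case
      using fejer_mass_times_solution[OF \<alpha> assms(3,4,6,7), of t "c * t powr \<beta>"] fejer_mass_pos
      by (simp add: \<delta>'_def field_simps)
  qed
  have main: "eventually (\<lambda>t. u (c * t powr \<beta>) t \<ge> c * \<alpha> * t powr (\<beta> - 2 * \<alpha>) * E a t) at_top"
  proof -
    have "((\<lambda>t. c * \<alpha> * t powr (\<beta> - 2 * \<alpha> + 1/2)) \<longlongrightarrow> c * \<alpha> * 0) at_top"
      by (intro tendsto_intros tendsto_neg_powr filterlim_ident) (use assms in auto)
    hence "eventually (\<lambda>t. c * \<alpha> * t powr (\<beta> - 2 * \<alpha> + 1/2) < \<delta>') at_top"
      by (rule order_tendstoD) (use \<delta>' in simp)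
    with u eventually_gt_at_top[of 0] show ?thesis
    proof eventually_elim
      case (elim t)
      have "t powr (\<beta> - 2 * \<alpha>) = t powr (\<beta> - 2 * \<alpha> + 1/2) * t powr (-1/2)" by (simp flip: powr_add)
      hence "c * \<alpha> * t powr (\<beta> - 2 * \<alpha>) * E a t = (c * \<alpha> * t powr (\<beta> - 2 * \<alpha> + 1/2)) * (t powr (-1/2) * E a t)"
        by simp
      also have "\<dots> \<le> \<delta>' * (t powr (-1/2) * E a t)"
        using elim Epos[of a t] assms by (intro mult_right_mono) auto
      finally show ?case using elim by (simp add: mult.assoc)
    qed
  qed
  have 1: "\<exists>r \<in> o[at_top](\<lambda>_. 1 :: real). \<forall>t>0. u (c * t powr \<beta>) t \<ge> c * \<alpha> * t powr (\<beta> - 2 * \<alpha>) * E a t * (1 - r t)"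
    by (rule smallo_defect[OF _ main]) (use Epos[of a] assms \<alpha> in auto)
  have 2: "\<exists>r \<in> o[at_top](\<lambda>_. 1 :: real). \<forall>t>0. u (c * t powr \<beta>) t \<ge> c * \<alpha> * t powr (\<beta> - 2 * \<alpha>) * E 1 t * (1 - r t)"
    if a: "a \<ge> 1"
  proof (rule smallo_defect)
    show "c * \<alpha> * t powr (\<beta> - 2 * \<alpha>) * E 1 t > 0" if "t > 0" for t
      using Epos[of 1 t] assms \<alpha> that by auto
    show "eventually (\<lambda>t. u (c * t powr \<beta>) t \<ge> c * \<alpha> * t powr (\<beta> - 2 * \<alpha>) * E 1 t) at_top"
      using main
    proof eventually_elim
      case (elim t)
      have "E 1 t \<le> E a t" unfolding E_def using a by (intro ml_mono[OF \<alpha>] mult_right_mono) auto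
      hence "c * \<alpha> * t powr (\<beta> - 2 * \<alpha>) * E 1 t \<le> c * \<alpha> * t powr (\<beta> - 2 * \<alpha>) * E a t"
        using assms \<alpha> by (intro mult_left_mono) auto
      thus ?case using elim by linarith
    qed
  qed
  have 3: "filterlim (\<lambda>t. u (c * t powr \<beta>) t) at_top at_top"
    using ml_growth[OF \<alpha> assms(1) \<delta>' assms(4)] u unfolding E_def by (rule filterlim_at_top_mono)
  show ?thesis using 1 2 3 by (simp add: E_def)
qed

end
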